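(* Let $k$ be an uncountable algebraically closed field of arbitrary characteristic. For every integer $r\ge 8$, the Coble representation $\mathrm{co}_{3,r}$ of the Weyl group $W_{3,r}$ on the moduli space of semistable $r$-tuples of points in $\mathbb{P}^3$ (acting by birational self-maps) is injective.
   Context: For $r\ge 5$, $W_{3,r}$ is the Weyl (Coxeter) group of the root system $T_{2,4,r-4}$. It has involutive generators $\tau_1,\dots,\tau_{r-1},s$, and its Dynkin diagram is the horizontal chain $\tau_1 - \tau_2 - \cdots - \tau_{r-1}$ together with one additional vertex $s$ joined only to $\tau_4$, all edges being simple. That is, the relations are: all generators square to the identity; the product of two generators joined by an edge has order $3$; generators not joined by an edge commute. A set of points of $\mathbb{P}^3$ is called linearly independent if no four of them lie on a common plane. Let $U_r$ be the moduli space of $r$-tuples of distinct, linearly independent points in $\mathbb{P}^3$, up to projective equivalence (the diagonal action of $\mathrm{PGL}_4(k)$). It is an open dense subset of the moduli space of semistable $r$-tuples of points in $\mathbb{P}^3$, so the two spaces have the same group of birational self-maps $\mathrm{Bir}(U_r)$. The Coble representation is the (known to be well-defined) representation $\mathrm{co}_{3,r}:W_{3,r}\to \mathrm{Bir}(U_r)$ which sends $\tau_i$ ($1\le i\le r-1$) to the map exchanging the $i$-th and $(i+1)$-th points of the tuple, and sends $s$ to the birational map $$[p_1,\dots,p_r]\mapsto [p_1,p_2,p_3,p_4,\mathrm{cr}(p_5),\mathrm{cr}(p_6),\dots,\mathrm{cr}(p_r)],$$ where $\mathrm{cr}$ is the standard Cremona transformation of $\mathbb{P}^3$ centered at $p_1,p_2,p_3,p_4$,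 i.e. the map $[x_0:x_1:x_2:x_3]\mapsto[x_0^{-1}:x_1^{-1}:x_2^{-1}:x_3^{-1}]$ in homogeneous coordinates for which $p_1,\dots,p_4$ are the four coordinate points. *)

theory Defs
  imports "HOL-Analysis.Analysis" "HOL-Algebra.Group" "HOL-Computational_Algebra.Polynomial"
begin

section \<open>The Weyl group\<close>

datatype generator = Tau nat | Cr

definition generators :: "nat \<Rightarrow> generator set" where
  "generators r = Tau ` {1..<r} \<union> {Cr}"

fun joined :: "generator \<Rightarrow> generator \<Rightarrow> bool" where
  "joined (Tau i) (Tau j) \<longleftrightarrow> j = Suc i \<or> i = Suc j"
| "joined (Tau i) Cr \<longleftrightarrow> i = 4"
| "joined Cr (Tau j) \<longleftrightarrow> j = 4"
| "joined Cr Cr \<longleftrightarrow> False"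

definition coxeter_exponent :: "generator \<Rightarrow> generator \<Rightarrow> nat" where
  "coxeter_exponent a b = (if a = b then 1 else if joined a b then 3 else 2)"

text \<open>The generators are their own inverses, so the group with the Coxeter presentation is the
  monoid with the same presentation: words in the generators modulo the congruence generated by
  the relators \<open>(a b)\<^sup>m = 1\<close>, where \<open>m\<close> is the Coxeter exponent (\<open>m = 1\<close> for \<open>a = b\<close>
  says that \<open>a\<close> squares to the identity).\<close>

inductive_set word_rel :: "nat \<Rightarrow> (generator list \<times> generator list) set" for r where
  refl: "w \<in> lists (generators r) \<Longrightarrow> (w, w) \<in> word_rel r"
| sym: "(v, w) \<in> word_rel r \<Longrightarrow> (w, v) \<in> word_rel r"
| trans: "(u, v) \<in> word_rel r \<Longrightarrow> (v, w) \<in> word_rel r \<Longrightarrow> (u, w) \<in> word_rel r"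
| relator: "\<lbrakk>a \<in> generators r; b \<in> generators r; u \<in> lists (generators r); v \<in> lists (generators r)\<rbrakk>
    \<Longrightarrow> (u @ concat (replicate (coxeter_exponent a b) [a, b]) @ v, u @ v) \<in> word_rel r"

definition weyl_group :: "nat \<Rightarrow> generator list set monoid" where
  "weyl_group r =
    \<lparr>carrier = lists (generators r) // word_rel r,
     mult = \<lambda>A B. \<Union>u\<in>A. \<Union>v\<in>B. word_rel r `` {u @ v},
     one = word_rel r `` {[]}\<rparr>"

section \<open>Birational self-maps of spaces with functions\<close>

text \<open>A variety over an algebraically closed field \<open>'k\<close>, viewed as a topological space together
  with, for every open \<open>V\<close>, the regular functions on \<open>V\<close>.  Functions are total; only their values
  on \<open>V\<close> are relevant to membership in \<open>regular X V\<close>.\<close>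

record ('a, 'k) fun_space =
  zariski :: "'a topology"
  regular :: "'a set \<Rightarrow> ('a \<Rightarrow> 'k) set"

definition dense_open :: "('a, 'k, 'm) fun_space_scheme \<Rightarrow> 'a set \<Rightarrow> bool" where
  "dense_open X V \<longleftrightarrow>
    openin (zariski X) V \<and> zariski X closure_of V = topspace (zariski X)"

text \<open>Representatives of rational self-maps: morphisms to \<open>X\<close> defined on a dense open subset.\<close>

definition rational_map :: "('a, 'k, 'm) fun_space_scheme \<Rightarrow> ('a \<rightharpoonup> 'a) \<Rightarrow> bool" where
  "rational_map X f \<longleftrightarrow>
    dense_open X (dom f) \<and> ran f \<subseteq> topspace (zariski X) \<and>
    (\<forall>W. openin (zariski X) W \<longrightarrow>
      openin (zariski X) {x \<in> dom f. the (f x) \<in> W} \<and>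
      (\<forall>h \<in> regular X W. (\<lambda>x. h (the (f x))) \<in> regular X {x \<in> dom f. the (f x) \<in> W}))"

definition agree :: "('a, 'k, 'm) fun_space_scheme \<Rightarrow> ('a \<rightharpoonup> 'a) \<Rightarrow> ('a \<rightharpoonup> 'a) \<Rightarrow> bool" where
  "agree X f g \<longleftrightarrow> (\<exists>D. dense_open X D \<and> D \<subseteq> dom f \<inter> dom g \<and> (\<forall>x\<in>D. f x = g x))"

definition identity_map :: "('a, 'k, 'm) fun_space_scheme \<Rightarrow> ('a \<rightharpoonup> 'a)" where
  "identity_map X = Some |` topspace (zariski X)"

definition birational_map :: "('a, 'k, 'm) fun_space_scheme \<Rightarrow> ('a \<rightharpoonup> 'a) \<Rightarrow> bool" where
  "birational_map X f \<longleftrightarrow> rational_map X f \<and>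
    (\<exists>g. rational_map X g \<and> agree X (g \<circ>\<^sub>m f) (identity_map X)
      \<and> agree X (f \<circ>\<^sub>m g) (identity_map X))"

definition birational_rel :: "('a, 'k, 'm) fun_space_scheme \<Rightarrow> ('a \<rightharpoonup> 'a) rel" where
  "birational_rel X = {(f, g). birational_map X f \<and> birational_map X g \<and> agree X f g}"

definition Bir :: "('a, 'k, 'm) fun_space_scheme \<Rightarrow> ('a \<rightharpoonup> 'a) set monoid" where
  "Bir X =
    \<lparr>carrier = {f. birational_map X f} // birational_rel X,
     mult = \<lambda>A B. \<Union>f\<in>A. \<Union>g\<in>B. birational_rel X `` {f \<circ>\<^sub>m g},
     one = birational_rel X `` {identity_map X}\<rparr>"

section \<open>Affine space of \<open>r\<close>-tuples of vectors\<close>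

definition affine_space :: "nat \<Rightarrow> (nat \<Rightarrow> 'k::field ^ 4) set" where
  "affine_space r = {1..r} \<rightarrow>\<^sub>E UNIV"

inductive_set poly_fun :: "nat \<Rightarrow> ((nat \<Rightarrow> 'k::field ^ 4) \<Rightarrow> 'k) set" for r where
  const: "(\<lambda>c. a) \<in> poly_fun r"
| coord: "i \<in> {1..r} \<Longrightarrow> (\<lambda>c. c i $ j) \<in> poly_fun r"
| add: "f \<in> poly_fun r \<Longrightarrow> g \<in> poly_fun r \<Longrightarrow> (\<lambda>c. f c + g c) \<in> poly_fun r"
| mult: "f \<in> poly_fun r \<Longrightarrow> g \<in> poly_fun r \<Longrightarrow> (\<lambda>c. f c * g c) \<in> poly_fun r"

definition affine_zariski :: "nat \<Rightarrow> (nat \<Rightarrow> 'k::field ^ 4) topology" where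
  "affine_zariski r = topology_generated_by {{c \<in> affine_space r. f c \<noteq> 0} | f. f \<in> poly_fun r}"

definition affine_regular ::
    "nat \<Rightarrow> (nat \<Rightarrow> 'k::field ^ 4) set \<Rightarrow> ((nat \<Rightarrow> 'k ^ 4) \<Rightarrow> 'k) set" where
  "affine_regular r V =
    {h. \<forall>c\<in>V. \<exists>N. openin (affine_zariski r) N \<and> c \<in> N \<and> N \<subseteq> V \<and>
      (\<exists>f\<in>poly_fun r. \<exists>g\<in>poly_fun r. \<forall>d\<in>N. g d \<noteq> 0 \<and> h d = f d / g d)}"

section \<open>Point configurations in projective three-space\<close>

text \<open>Points of projective space are lines through the origin of \<open>'k ^ 4\<close>; \<open>r\<close>-tuples of points
  are extensional functions on \<open>{1..r}\<close>.\<close>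

type_synonym 'k point = "('k ^ 4) set"
type_synonym 'k tuple = "nat \<Rightarrow> 'k point"

definition P3 :: "'k::field point set" where
  "P3 = {vec.span {v} | v. v \<noteq> 0}"

definition planes :: "('k::field ^ 4) set set" where
  "planes = {H. vec.subspace H \<and> vec.dim H = 3}"

definition lin_indep_tuples :: "nat \<Rightarrow> 'k::field tuple set" where
  "lin_indep_tuples r = {p \<in> {1..r} \<rightarrow>\<^sub>E P3. inj_on p {1..r} \<and>
    (\<forall>S \<subseteq> {1..r}. card S = 4 \<longrightarrow> \<not> (\<exists>H\<in>planes. \<forall>i\<in>S. p i \<subseteq> H))}"

definition transform :: "'k::field ^ 4 ^ 4 \<Rightarrow> 'k point \<Rightarrow> 'k point" where
  "transform A L = (\<lambda>v. A *v v) ` L"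

definition proj_class :: "nat \<Rightarrow> 'k::field tuple \<Rightarrow> 'k tuple set" where
  "proj_class r p = {(\<lambda>i\<in>{1..r}. transform A (p i)) | A. invertible A}"

definition U_set :: "nat \<Rightarrow> 'k::field tuple set set" where
  "U_set r = proj_class r ` lin_indep_tuples r"

definition lifts :: "nat \<Rightarrow> (nat \<Rightarrow> 'k::field ^ 4) set" where
  "lifts r = {c \<in> affine_space r. (\<forall>i\<in>{1..r}. c i \<noteq> 0) \<and>
    (\<lambda>i\<in>{1..r}. vec.span {c i}) \<in> lin_indep_tuples r}"

definition lift_class :: "nat \<Rightarrow> (nat \<Rightarrow> 'k::field ^ 4) \<Rightarrow> 'k tuple set" where
  "lift_class r c = proj_class r (\<lambda>i\<in>{1..r}. vec.span {c i})"

text \<open>The variety structure on \<open>U\<^sub>r\<close> is that of the geometric quotient: \<open>U\<^sub>r\<close> is the quotient of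
  the open set \<open>lifts r\<close> of affine space by the commuting actions of the torus rescaling the
  vectors (which gives an open subset of the \<open>r\<close>-fold product of projective space) and of the
  general linear group. So a set is open, and a function regular, iff its pullback to
  \<open>lifts r\<close> is.\<close>

definition U_zariski :: "nat \<Rightarrow> 'k::field tuple set topology" where
  "U_zariski r = topology (\<lambda>V. V \<subseteq> U_set r \<and>
    openin (affine_zariski r) {c \<in> lifts r. lift_class r c \<in> V})"

definition U_space :: "nat \<Rightarrow> ('k::field tuple set, 'k) fun_space" where
  "U_space r =
    \<lparr>zariski = U_zariski r,
     regular = \<lambda>V. {h. (\<lambda>c. h (lift_class r c)) \<in>
       affine_regular r {c \<in> lifts r. lift_class r c \<in> V}}\<rparr>"

lemma openin_U_zariski:
  fixes V :: "'k::field tuple set set"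
  shows "openin (U_zariski r) V \<longleftrightarrow>
    V \<subseteq> U_set r \<and> openin (affine_zariski r) {c \<in> lifts r. lift_class r c \<in> V}"
proof -
  let ?P = "\<lambda>V :: 'k tuple set set. {c \<in> lifts r. lift_class r c \<in> V}"
  have int: "?P (S \<inter> T) = ?P S \<inter> ?P T" for S T by auto
  have un: "?P (\<Union>K) = \<Union>(?P ` K)" for K by auto
  have "istopology (\<lambda>V. V \<subseteq> U_set r \<and> openin (affine_zariski r) (?P V))"
    unfolding istopology_def int un by blast
  from topology_inverse'[OF this] show ?thesis
    unfolding U_zariski_def by simp
qed

section \<open>The Coble representation\<close>

definition swap_map :: "nat \<Rightarrow> nat \<Rightarrow> ('k::field tuple set \<rightharpoonup> 'k tuple set)" where
  "swap_map r i x =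
    (if x \<in> U_set r then Some ((\<lambda>p. p(i := p (Suc i), Suc i := p i)) ` x) else None)"

text \<open>The coordinate points are the lines spanned by \<open>axis 1 1, \<dots>, axis 4 1\<close>; recall
  that \<open>UNIV = {1, 2, 3, 4 :: 4}\<close>.\<close>

definition sends_to_coordinate_points :: "'k::field ^ 4 ^ 4 \<Rightarrow> 'k tuple \<Rightarrow> bool" where
  "sends_to_coordinate_points A p \<longleftrightarrow> invertible A \<and>
    (\<forall>i\<in>{1..4}. transform A (p i) = vec.span {axis (of_nat i) 1})"

text \<open>As \<open>inverse 0 = 0\<close>, the image of a line all of whose nonzero vectors have nonzero
  coordinates is again a line. Off the coordinate planes this is the Cremona transformation; it
  is only applied there, since by linear independence \<open>p 5, \<dots>, p r\<close> do not lie on a plane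
  through three of \<open>p 1, \<dots>, p 4\<close>.\<close>

definition standard_cremona :: "'k::field point \<Rightarrow> 'k point" where
  "standard_cremona L = (\<lambda>v. \<chi> j. inverse (v $ j)) ` L"

definition centered_cremona :: "'k::field ^ 4 ^ 4 \<Rightarrow> 'k point \<Rightarrow> 'k point" where
  "centered_cremona A L = transform (matrix_inv A) (standard_cremona (transform A L))"

definition cremona_tuple :: "nat \<Rightarrow> 'k::field ^ 4 ^ 4 \<Rightarrow> 'k tuple \<Rightarrow> 'k tuple" where
  "cremona_tuple r A p = (\<lambda>i\<in>{1..r}. if i \<le> 4 then p i else centered_cremona A (p i))"

text \<open>The matrix \<open>A\<close> is only determined up to a diagonal factor, and the tuple up to
  projective equivalence, but the class of the resulting tuple does not depend on these choices.
  The map is undefined where the resulting points are not linearly independent.\<close>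

definition cremona_map :: "nat \<Rightarrow> ('k::field tuple set \<rightharpoonup> 'k tuple set)" where
  "cremona_map r x =
    (let y = the_elem {proj_class r (cremona_tuple r A p) | A p.
                        p \<in> x \<and> sends_to_coordinate_points A p}
     in if x \<in> U_set r \<and> y \<in> U_set r then Some y else None)"

fun generator_map :: "nat \<Rightarrow> generator \<Rightarrow> ('k::field tuple set \<rightharpoonup> 'k tuple set)" where
  "generator_map r (Tau i) = swap_map r i"
| "generator_map r Cr = cremona_map r"

definition word_value ::
    "nat \<Rightarrow> generator list \<Rightarrow> ('k::field tuple set \<rightharpoonup> 'k tuple set) set" where
  "word_value r w =
    foldr (\<lambda>a B. birational_rel (U_space r) `` {generator_map r a} \<otimes>\<^bsub>Bir (U_space r)\<^esub> B) w
      \<one>\<^bsub>Bir (U_space r)\<^esub>"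

text \<open>All words representing an element of the Weyl group have the same value, which is the image
  of that element.\<close>

definition coble :: "nat \<Rightarrow> generator list set \<Rightarrow> ('k::field tuple set \<rightharpoonup> 'k tuple set) set" where
  "coble r A = the_elem (word_value r ` A)"

end

theory Submission
  imports Defs
begin

text \<open>
  Throughout, a configuration of points is handled through a lift, that is, a choice of vectors
  spanning the points. Four points are coplanar iff the bracket (determinant) of their vectors
  vanishes, and two lifts define the same element of \<open>U\<^sub>r\<close> iff they differ by an invertible matrix
  and rescalings.

  \<^bold>\<open>Why there is a homomorphism.\<close> On lifts, the transpositions and the Cremona transformation are
  polynomial maps, so they define rational maps, and each is its own inverse. The Coxeter relations
  are verified pointwise, wherever the composite is defined. Only the braid relation between the
  Cremona transformation and \<open>\<tau>\<^sub>4\<close> needs an idea: move the first five points to the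
  coordinate points and the unit point. In the affine coordinates \<open>x\<^sub>k / x\<^sub>4\<close> of the other points the two
  maps become \<open>t \<mapsto> 1 / t\<close> and \<open>t \<mapsto> 1 - t\<close>, whose composite has order three.

  \<^bold>\<open>Why it is injective.\<close> The curve \<open>z \<mapsto> (z, z\<^sup>2, z\<^sup>3, 1 + \<lambda> z\<^sup>4)\<close> is a nodal quartic of arithmetic
  genus one. Four of its points are coplanar iff two of the parameters agree or
  \<open>\<lambda> z\<^sub>1 z\<^sub>2 z\<^sub>3 z\<^sub>4 = 1\<close> (\<open>det_nodal_points\<close>). So \<open>r\<close> points on such a curve are described by a point
  \<open>X = (\<lambda>, z\<^sub>1, \<dots>, z\<^sub>r)\<close> of a torus, and they are in general position unless one of
  finitely many roots, seen as a character, takes the value \<open>1\<close> at \<open>X\<close>. The Cremona transformation carries such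
  a configuration to another one, and the new parameters are monomials in the old ones
  (\<open>nodal_cremona_related\<close>). Hence the Weyl group acts on these configurations through its
  reflection representation on the character lattice of the torus.

  Suppose that \<open>w\<close> acts trivially on \<open>U\<^sub>r\<close>. Then it preserves all cross-ratios of brackets, also at the
  nodal configurations (\<open>cross_ratio_invariant\<close>: two regular functions that agree on a dense set
  agree). At \<open>X\<close> such a cross-ratio is a quotient of two products of four factors \<open>1 - \<chi>\<^sub>n(X)\<close> with
  \<open>n\<close> a root. Comparing the divisors on the torus of the two sides
  (\<open>root_identity_common_factor\<close>, by restriction to one-parameter subgroups) shows that \<open>w\<close>
  permutes the roots that occur, up to sign, and varying the cross-ratio shows that \<open>w\<close> maps every simple root
  to itself up to sign (\<open>trivial_word_fixes_simple_roots\<close>).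

  It remains to see that such a \<open>w\<close> is trivial (\<open>word_trivial_if_roots_fixed_up_to_sign\<close>).
  By Tits' argument (\<open>length_increase_imp_root_positive\<close>) a nontrivial \<open>w\<close> makes some simple root
  negative, hence negates it; as the Dynkin diagram is connected, \<open>w\<close> then negates all simple roots.
  For \<open>r \<ge> 8\<close> the diagram contains the affine diagram \<open>T\<^sub>2\<^sub>,\<^sub>4\<^sub>,\<^sub>4\<close>. Its isotropic vector is a
  positive combination of simple roots and has nonpositive pairing with every simple root. Therefore
  its orbit remains on the positive side, which contradicts that \<open>w\<close> negates it. For \<open>r = 7\<close> the
  argument breaks down here: the finite group of type \<open>E\<^sub>7\<close> does contain \<open>-1\<close>.
\<close>

section \<open>The root lattice and the faithfulness of its reflection representation\<close>

text \<open>Coordinate \<open>0\<close> of the lattice is the exponent of \<open>\<lambda>\<close>, coordinate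
  \<open>i \<ge> 1\<close> that of \<open>z\<^sub>i\<close>. As a character, the simple root of
  \<open>\<tau>\<^sub>i\<close> takes the value \<open>1\<close> when the points \<open>i\<close> and \<open>i +
  1\<close> collide, and that of \<open>s\<close> when the first four points become coplanar.\<close>

fun simple_root :: "generator \<Rightarrow> nat \<Rightarrow> int" where
  "simple_root (Tau i) = (\<lambda>j. if j = Suc i then 1 else if j = i then -1 else 0)"
| "simple_root Cr = (\<lambda>j. if j \<le> 4 then 1 else 0)"

text \<open>The pairing with a simple root under the form \<open>- 2 n\<^sub>0 m\<^sub>0 + \<Sum> n\<^sub>i
  m\<^sub>i\<close> (\<open>lattice_form\<close> below), written out so that it does not depend on the
  rank.\<close>

fun coroot :: "generator \<Rightarrow> (nat \<Rightarrow> int) \<Rightarrow> int" where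
  "coroot (Tau i) n = n (Suc i) - n i"
| "coroot Cr n = n 1 + n 2 + n 3 + n 4 - 2 * n 0"

definition reflect :: "generator \<Rightarrow> (nat \<Rightarrow> int) \<Rightarrow> nat \<Rightarrow> int" where
  "reflect a n = (\<lambda>j. n j - coroot a n * simple_root a j)"

definition lattice_action :: "generator list \<Rightarrow> (nat \<Rightarrow> int) \<Rightarrow> nat \<Rightarrow> int" where
  "lattice_action w = foldr reflect w"

lemma lattice_action_simps [simp]:
  "lattice_action [] n = n"
  "lattice_action (a # w) n = reflect a (lattice_action w n)"
  "lattice_action (u @ w) n = lattice_action u (lattice_action w n)"
  by (simp_all add: lattice_action_def)

lemma coroot_linear:
  "coroot a (\<lambda>j. x * n j + y * m j) = x * coroot a n + y * coroot a m"
  by (cases a) (auto simp: algebra_simps)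

lemma coroot_diff: "coroot a (\<lambda>j. n j - y * m j) = coroot a n - y * coroot a m"
  by (cases a) (auto simp: algebra_simps)

lemma lattice_action_linear:
  "lattice_action w (\<lambda>j. x * n j + y * m j)
    = (\<lambda>j. x * lattice_action w n j + y * lattice_action w m j)"
proof (induction w)
  case (Cons a w)
  then show ?case
    by (simp add: reflect_def coroot_linear algebra_simps)
qed auto

lemma lattice_action_scale: "lattice_action w (\<lambda>j. x * n j) = (\<lambda>j. x * lattice_action w n j)"
  using lattice_action_linear[of w x n 0 n] by simp

lemma lattice_action_minus: "lattice_action w (\<lambda>j. - n j) = (\<lambda>j. - lattice_action w n j)"
  using lattice_action_scale[of w "-1" n] by simp

lemma lattice_action_add:
  "lattice_action w (\<lambda>j. n j + m j) = (\<lambda>j. lattice_action w n j + lattice_action w m j)"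
  using lattice_action_linear[of w 1 n 1 m] by simp

lemma Tau_in_generators: "Tau i \<in> generators r \<longleftrightarrow> 1 \<le> i \<and> i < r"
  and Cr_in_generators: "Cr \<in> generators r"
  by (auto simp: generators_def)

lemma joined_sym: "joined a b \<longleftrightarrow> joined b a"
  by (cases a; cases b) auto

lemma not_joined_self: "\<not> joined a a"
  by (cases a) auto

lemma coroot_simple_root:
  assumes "a \<in> generators r" "b \<in> generators r"
  shows "coroot a (simple_root b) = (if a = b then 2 else if joined a b then -1 else 0)"
  using assms by (cases a; cases b) (auto simp: generators_def)

text \<open>The vectors \<open>n - x \<alpha>\<^sub>a - y \<alpha>\<^sub>b\<close> are stable under both
  reflections, which act on \<open>(x, y)\<close> by affine maps depending only on \<open>coroot a n\<close>,
  \<open>coroot b n\<close> and the Cartan integers; so it suffices to follow \<open>(0, 0)\<close>.\<close>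

lemma lattice_action_relator:
  assumes "a \<in> generators r" "b \<in> generators r"
  shows "lattice_action (concat (replicate (coxeter_exponent a b) [a, b])) n = n"
proof -
  define p q f where "p = coroot a (simple_root b)" and "q = coroot b (simple_root a)"
    and "f x y = (\<lambda>j. n j - (x * simple_root a j + y * simple_root b j))" for x y
  have a: "coroot a (f x y) = coroot a n - (x * 2 + y * p)"
    and b: "coroot b (f x y) = coroot b n - (x * q + y * 2)" for x y
    using coroot_diff[of _ n 1 "\<lambda>j. x * simple_root a j + y * simple_root b j"]
      coroot_simple_root[OF assms(1,1)] coroot_simple_root[OF assms(2,2)]
    by (simp_all add: f_def coroot_linear p_def q_def)
  have ra: "reflect a (f x y) = f (coroot a n - x - y * p) y" for x y
    unfolding reflect_def a by (auto simp: f_def algebra_simps)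
  have rb: "reflect b (f x y) = f x (coroot b n - y - x * q)" for x y
    unfolding reflect_def b by (auto simp: f_def algebra_simps)
  have n: "n = f 0 0" by (simp add: f_def)
  have "lattice_action (concat (replicate (coxeter_exponent a b) [a, b])) (f 0 0) = f 0 0"
  proof (cases "a = b")
    case True
    have "p = 2" using True coroot_simple_root[OF assms] by (simp add: p_def)
    have "reflect a (reflect a (f 0 0)) = f 0 0" unfolding ra by simp
    with True show ?thesis by (simp add: coxeter_exponent_def)
  next
    case False
    show ?thesis
    proof (cases "joined a b")
      case True
      then have "p = -1" "q = -1"
        using False coroot_simple_root[OF assms] coroot_simple_root[OF assms(2,1)] joined_sym[of a b]
        by (auto simp: p_def q_def)
      with True False show ?thesis by (simp add: coxeter_exponent_def numeral_3_eq_3 ra rb)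
    next
      case nj: False
      then have "p = 0" "q = 0"
        using False coroot_simple_root[OF assms] coroot_simple_root[OF assms(2,1)] joined_sym[of a b]
        by (auto simp: p_def q_def)
      with nj False show ?thesis by (simp add: coxeter_exponent_def numeral_2_eq_2 ra rb)
    qed
  qed
  with n show ?thesis by simp
qed

lemma word_rel_lists: "(u, v) \<in> word_rel r \<Longrightarrow> u \<in> lists (generators r) \<and> v \<in> lists (generators r)"
proof (induction rule: word_rel.induct)
  case (relator a b u v)
  have "set (concat (replicate (coxeter_exponent a b) [a, b])) \<subseteq> generators r"
    using relator by (auto dest!: in_set_replicate[THEN iffD1])
  with relator show ?case by (auto simp: lists_eq_set)
qed auto

lemma lattice_action_word_rel: "(u, v) \<in> word_rel r \<Longrightarrow> lattice_action u = lattice_action v"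
proof (induction rule: word_rel.induct)
  case (relator a b u v)
  then show ?case by (simp add: fun_eq_iff lattice_action_relator del: lattice_action_simps(2))
qed auto

text \<open>This makes \<open>w\<close> and \<open>w a\<close> have different lengths, so that every generator
  either lengthens or shortens a word.\<close>

lemma word_rel_parity: "(u, v) \<in> word_rel r \<Longrightarrow> even (length u) \<longleftrightarrow> even (length v)"
proof (induction rule: word_rel.induct)
  case (relator a b u v)
  have "length (concat (replicate n [a, b])) = 2 * n" for n
    by (induction n) auto
  then show ?case by simp
qed auto

lemma word_rel_cong:
  assumes "(u, v) \<in> word_rel r" "x \<in> lists (generators r)" "y \<in> lists (generators r)"
  shows "(x @ u @ y, x @ v @ y) \<in> word_rel r"
  using assms
proof (induction rule: word_rel.induct)
  case (refl w)
  then show ?case by (intro word_rel.refl) auto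
next
  case (relator a b u v)
  then show ?case
    using word_rel.relator[of a r b "x @ u" "v @ y"] by auto
qed (auto intro: word_rel.sym word_rel.trans)

lemma word_rel_append:
  assumes "(u, v) \<in> word_rel r" "(u', v') \<in> word_rel r"
  shows "(u @ u', v @ v') \<in> word_rel r"
  using word_rel_cong[OF assms(1), of "[]" u'] word_rel_cong[OF assms(2), of v "[]"]
    word_rel_lists[OF assms(1)] word_rel_lists[OF assms(2)]
  by (auto intro: word_rel.trans)

lemma word_rel_square:
  assumes "a \<in> generators r" "u \<in> lists (generators r)" "v \<in> lists (generators r)"
  shows "(u @ a # a # v, u @ v) \<in> word_rel r"
  using word_rel.relator[OF assms(1,1,2,3)] by (simp add: coxeter_exponent_def)

lemma word_rel_rev_cancel:
  assumes "w \<in> lists (generators r)"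
  shows "(rev w @ w, []) \<in> word_rel r"
  using assms
proof (induction w)
  case (Cons a w)
  then have "(rev w @ a # a # w, rev w @ w) \<in> word_rel r"
    by (intro word_rel_square) auto
  with Cons show ?case by (auto intro: word_rel.trans)
qed (auto intro: word_rel.refl)

lemma word_rel_commute:
  assumes "a \<in> generators r" "b \<in> generators r" "\<not> joined a b" "a \<noteq> b"
  shows "([a, b], [b, a]) \<in> word_rel r"
proof -
  have *: "([a, b, a, b], []) \<in> word_rel r"
    using word_rel.relator[of a r b "[]" "[]"] assms
    by (simp add: coxeter_exponent_def numeral_2_eq_2)
  have "([a, b, a, b] @ [b, a], [] @ [b, a]) \<in> word_rel r"
    by (rule word_rel_append[OF *]) (use assms in \<open>auto intro: word_rel.refl\<close>)
  moreover have "([a, b, a, b, b, a], [a, b]) \<in> word_rel r"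
    using word_rel_square[of b r "[a, b, a]" "[a]"] word_rel_square[of a r "[a, b]" "[]"] assms
    by (auto intro: word_rel.trans)
  ultimately show ?thesis by (auto intro: word_rel.trans word_rel.sym)
qed

lemma word_rel_braid:
  assumes "a \<in> generators r" "b \<in> generators r" "joined a b"
  shows "([a, b, a], [b, a, b]) \<in> word_rel r"
proof -
  have ne: "a \<noteq> b" using assms not_joined_self by auto
  have *: "([a, b, a, b, a, b], []) \<in> word_rel r"
    using word_rel.relator[of a r b "[]" "[]"] assms ne
    by (simp add: coxeter_exponent_def numeral_3_eq_3)
  have "([a, b, a, b, a, b] @ [b, a, b], [] @ [b, a, b]) \<in> word_rel r"
    by (rule word_rel_append[OF *]) (use assms in \<open>auto intro: word_rel.refl\<close>)
  moreover have "([a, b, a, b, a, b, b, a, b], [a, b, a]) \<in> word_rel r"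
    using word_rel_square[of b r "[a, b, a, b, a]" "[a, b]"]
      word_rel_square[of a r "[a, b, a, b]" "[b]"] word_rel_square[of b r "[a, b, a]" "[]"] assms
    by (auto intro: word_rel.trans)
  ultimately show ?thesis by (auto intro: word_rel.trans word_rel.sym)
qed

definition coxeter_length :: "nat \<Rightarrow> generator list \<Rightarrow> nat" where
  "coxeter_length r u = (LEAST n. \<exists>v. (u, v) \<in> word_rel r \<and> length v = n)"

lemma coxeter_length_le: "(u, v) \<in> word_rel r \<Longrightarrow> coxeter_length r u \<le> length v"
  unfolding coxeter_length_def by (rule Least_le) blast

lemma coxeter_length_attained:
  assumes "u \<in> lists (generators r)"
  obtains v where "(u, v) \<in> word_rel r" "length v = coxeter_length r u"
proof -
  have "\<exists>n v. (u, v) \<in> word_rel r \<and> length v = n"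
    using assms word_rel.refl by blast
  from LeastI_ex[OF this] that show ?thesis
    unfolding coxeter_length_def by blast
qed

lemma coxeter_length_cong:
  assumes "(u, v) \<in> word_rel r"
  shows "coxeter_length r u = coxeter_length r v"
  using assms coxeter_length_le coxeter_length_attained word_rel_lists
  by (metis (no_types, lifting) word_rel.sym word_rel.trans le_antisym)

lemma coxeter_length_append_le:
  assumes "u \<in> lists (generators r)" "v \<in> lists (generators r)"
  shows "coxeter_length r (u @ v) \<le> coxeter_length r u + length v"
proof -
  obtain u' where "(u, u') \<in> word_rel r" "length u' = coxeter_length r u"
    using coxeter_length_attained[OF assms(1)] .
  with coxeter_length_le[OF word_rel_append[of u u' r v v]] assms show ?thesis
    by (simp add: word_rel.refl)
qed

lemma coxeter_length_parity:
  assumes "u \<in> lists (generators r)"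
  shows "even (coxeter_length r u) \<longleftrightarrow> even (length u)"
  using coxeter_length_attained[OF assms] word_rel_parity by metis

lemma coxeter_length_step:
  assumes "u \<in> lists (generators r)" "a \<in> generators r"
  shows "coxeter_length r (u @ [a]) < coxeter_length r u
    \<or> coxeter_length r u < coxeter_length r (u @ [a])"
  using coxeter_length_parity[of u r] coxeter_length_parity[of "u @ [a]" r] assms
  by (metis append_in_lists_conv even_Suc length_append_singleton lists.Cons lists.Nil linorder_neqE_nat)

lemma coxeter_length_cancel:
  assumes "u \<in> lists (generators r)" "a \<in> generators r"
  shows "coxeter_length r (u @ [a, a]) = coxeter_length r u"
  using coxeter_length_cong[OF word_rel_square[of a r u "[]"]] assms by simp

lemma coxeter_length_descent:
  assumes "u \<in> lists (generators r)" "(u, []) \<notin> word_rel r"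
  obtains b where "b \<in> generators r" "coxeter_length r (u @ [b]) < coxeter_length r u"
proof -
  obtain v where v: "(u, v) \<in> word_rel r" "length v = coxeter_length r u"
    using coxeter_length_attained[OF assms(1)] .
  with assms(2) have "v \<noteq> []" by auto
  then obtain v' b where v': "v = v' @ [b]" by (metis rev_exhaust)
  have b: "b \<in> generators r" "v' \<in> lists (generators r)"
    using word_rel_lists[OF v(1)] v' by auto
  have "(u @ [b], v @ [b]) \<in> word_rel r"
    by (rule word_rel_append[OF v(1)]) (use b in \<open>auto intro: word_rel.refl\<close>)
  moreover have "(v @ [b], v') \<in> word_rel r"
    using word_rel_square[of b r v' "[]"] b v' by simp
  ultimately have "coxeter_length r (u @ [b]) \<le> length v'"
    using coxeter_length_le word_rel.trans by blast
  with v v' b that show ?thesis by auto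
qed

text \<open>Any linear functional that is positive on the simple roots would do. It replaces the cone spanned
  by the simple roots in Tits' argument, where only sums of positive vectors are formed. The weight \<open>-
  9\<close> gives \<open>\<alpha>\<^sub>s\<close> the height \<open>1 + 2 + 3 + 4 - 9 = 1\<close>.\<close>

definition height :: "nat \<Rightarrow> (nat \<Rightarrow> int) \<Rightarrow> int" where
  "height r n = (\<Sum>i = 1..r. int i * n i) - 9 * n 0"

lemma height_linear: "height r (\<lambda>j. x * n j + y * m j) = x * height r n + y * height r m"
  by (simp add: height_def sum.distrib sum_distrib_left algebra_simps)

lemma height_add: "height r (\<lambda>j. n j + m j) = height r n + height r m"
  using height_linear[of r 1 n 1 m] by simp

lemma height_minus: "height r (\<lambda>j. - n j) = - height r n"
  using height_linear[of r "-1" n 0 n] by simp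

lemma height_simple_root:
  assumes "a \<in> generators r" "r \<ge> 8"
  shows "height r (simple_root a) = 1"
proof (cases a)
  case (Tau i)
  then have i: "1 \<le> i" "i < r" using assms by (auto simp: generators_def)
  have "(\<Sum>j = 1..r. int j * simple_root a j)
      = (\<Sum>j = 1..r. (if j = Suc i then int (Suc i) else 0) - (if j = i then int i else 0))"
    by (rule sum.cong) (auto simp: Tau)
  then show ?thesis using i by (simp add: height_def sum_subtractf Tau)
next
  case Cr
  have "(\<Sum>j = 1..r. int j * simple_root a j) = (\<Sum>j = 1..4. int j)"
    using assms by (intro sum.mono_neutral_cong_right) (auto simp: Cr)
  also have "\<dots> = 10" by (simp add: numeral_eq_Suc)
  finally show ?thesis by (simp add: height_def Cr)
qed

lemma reflect_simple_root_joined: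
  assumes "a \<in> generators r" "b \<in> generators r" "joined a b"
  shows "reflect b (simple_root a) = (\<lambda>j. simple_root a j + simple_root b j)"
  using coroot_simple_root[OF assms(2,1)] assms not_joined_self[of a] joined_sym[of a b]
  by (auto simp: reflect_def)

lemma reflect_simple_root_self:
  assumes "a \<in> generators r"
  shows "reflect a (simple_root a) = (\<lambda>j. - simple_root a j)"
  using coroot_simple_root[OF assms assms] by (simp add: reflect_def)

text \<open>Tits' argument, by induction on the length of \<open>w\<close>. Let \<open>b\<close> be a
  generator that shortens \<open>w\<close> to \<open>w'\<close>. If \<open>a\<close> and \<open>b\<close>
  commute, \<open>a\<close> also lengthens \<open>w'\<close>, and \<open>w \<alpha>\<^sub>a = w'
  \<alpha>\<^sub>a\<close>. If they are joined, then \<open>w \<alpha>\<^sub>a = w' \<alpha>\<^sub>a + w'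
  \<alpha>\<^sub>b\<close>, which settles the case that \<open>a\<close> lengthens \<open>w'\<close>; otherwise
  \<open>w'' = w' a\<close> is shorter still, is lengthened by \<open>b\<close> because of the braid relation,
  and satisfies \<open>w \<alpha>\<^sub>a = w'' \<alpha>\<^sub>b\<close>.\<close>

lemma length_increase_imp_root_positive:
  assumes "r \<ge> 8" "w \<in> lists (generators r)" "a \<in> generators r"
    and "coxeter_length r w < coxeter_length r (w @ [a])"
  shows "height r (lattice_action w (simple_root a)) > 0"
  using assms(2-)
proof (induction "coxeter_length r w" arbitrary: w a rule: less_induct)
  case less
  note w = less.prems(1) and a = less.prems(2) and up = less.prems(3)
  let ?l = "coxeter_length r"
  show ?case
  proof (cases "(w, []) \<in> word_rel r")
    case True
    then show ?thesis
      using lattice_action_word_rel[OF True] height_simple_root[OF a assms(1)] by simp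
  next
    case False
    obtain b where b: "b \<in> generators r" "?l (w @ [b]) < ?l w"
      using coxeter_length_descent[OF w False] .
    have ab: "a \<noteq> b" using b up by auto
    define w' where "w' = w @ [b]"
    have w': "w' \<in> lists (generators r)" "?l w' < ?l w" using b w by (auto simp: w'_def)
    have w'b: "?l w' < ?l (w' @ [b])"
      using b coxeter_length_cancel[OF w b(1)] by (simp add: w'_def)
    have act: "lattice_action w n = lattice_action w' (reflect b n)" for n
      using lattice_action_word_rel[OF word_rel_square[OF b(1) w, of "[]"]]
      by (simp add: w'_def fun_eq_iff)
    have posb: "height r (lattice_action w' (simple_root b)) > 0"
      using less.hyps[OF w'(2) w'(1) b(1) w'b] .
    have len_w: "?l (w @ v) = ?l (w' @ b # v)" if "v \<in> lists (generators r)" for v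
      using coxeter_length_cong[OF word_rel_square[OF b(1) w that]] by (simp add: w'_def)
    have lw: "?l w \<le> Suc (?l w')"
      using coxeter_length_append_le[OF w'(1), of "[b]"] b len_w[of "[]"] by simp
    show ?thesis
    proof (cases "joined a b")
      case False
      have "\<not> ?l (w' @ [a]) < ?l w'"
      proof
        assume down: "?l (w' @ [a]) < ?l w'"
        have "(w' @ [b, a], w' @ [a, b]) \<in> word_rel r"
          using word_rel_append[OF word_rel.refl[OF w'(1)] word_rel_commute[of b r a]]
            False ab a b joined_sym by auto
        then have "?l (w @ [a]) = ?l ((w' @ [a]) @ [b])"
          using coxeter_length_cong len_w[of "[a]"] a by auto
        also have "\<dots> \<le> ?l (w' @ [a]) + 1"
          using coxeter_length_append_le[of "w' @ [a]" r "[b]"] a b w' by auto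
        finally show False using down up w' by simp
      qed
      then have "height r (lattice_action w' (simple_root a)) > 0"
        using less.hyps[OF w'(2) w'(1) a] coxeter_length_step[OF w'(1) a] by auto
      moreover have "reflect b (simple_root a) = simple_root a"
        using coroot_simple_root[OF b(1) a] ab False joined_sym by (auto simp: reflect_def)
      ultimately show ?thesis by (simp add: act)
    next
      case True
      show ?thesis
      proof (cases "?l w' < ?l (w' @ [a])")
        case True': True
        then have "height r (lattice_action w' (simple_root a)) > 0"
          using less.hyps[OF w'(2) w'(1) a] by auto
        with posb show ?thesis
          by (simp add: act reflect_simple_root_joined[OF a b(1) True] lattice_action_add height_add)
      next
        case False
        define w'' where "w'' = w' @ [a]"
        have w'': "w'' \<in> lists (generators r)" "?l w'' < ?l w'"
          using coxeter_length_step[OF w'(1) a] False a w' by (auto simp: w''_def)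
        have "\<not> ?l (w'' @ [b]) < ?l w''"
        proof
          assume down: "?l (w'' @ [b]) < ?l w''"
          have "(w' @ [b, a], w' @ [a, a, b, a]) \<in> word_rel r"
            using word_rel_square[OF a w'(1), of "[b, a]"] a b by (auto intro: word_rel.sym)
          moreover have "(w'' @ [a, b, a], w'' @ [b, a, b]) \<in> word_rel r"
            using word_rel_append[OF word_rel.refl[OF w''(1)] word_rel_braid[OF a b(1) True]] .
          ultimately have "?l (w' @ [b, a]) = ?l ((w'' @ [b]) @ [a, b])"
            using coxeter_length_cong by (auto simp: w''_def)
          also have "\<dots> \<le> ?l (w'' @ [b]) + 2"
            using coxeter_length_append_le[of "w'' @ [b]" r "[a, b]"] a b w'' by auto
          finally show False using down up w' w'' len_w[of "[a]"] a by simp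
        qed
        then have "height r (lattice_action w'' (simple_root b)) > 0"
          using less.hyps[of w'' b] w' w'' coxeter_length_step[OF w''(1) b(1)] b by auto
        moreover have "lattice_action w'' (simple_root b) = lattice_action w (simple_root a)"
          using reflect_simple_root_joined[OF a b(1) True] reflect_simple_root_joined[of b r a]
            joined_sym[of a b] a b True
          by (simp add: w''_def act add.commute)
        ultimately show ?thesis by simp
      qed
    qed
  qed
qed

text \<open>The form of signature \<open>(r, 1)\<close> for which the generators act by orthogonal
  reflections.\<close>

definition lattice_form :: "nat \<Rightarrow> (nat \<Rightarrow> int) \<Rightarrow> (nat \<Rightarrow> int) \<Rightarrow> int" where
  "lattice_form r n m = (\<Sum>i = 1..r. n i * m i) - 2 * n 0 * m 0"

lemma lattice_form_sym: "lattice_form r n m = lattice_form r m n"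
  by (simp add: lattice_form_def mult.commute)

lemma lattice_form_diff:
  "lattice_form r (\<lambda>j. n j - x * m j) k = lattice_form r n k - x * lattice_form r m k"
  by (simp add: lattice_form_def sum_subtractf sum_distrib_left algebra_simps)

lemma lattice_form_minus: "lattice_form r (\<lambda>j. - n j) k = - lattice_form r n k"
  by (simp add: lattice_form_def sum_negf)

lemma lattice_form_simple_root:
  assumes "a \<in> generators r" "r \<ge> 8"
  shows "lattice_form r n (simple_root a) = coroot a n"
proof (cases a)
  case (Tau i)
  then have i: "1 \<le> i" "i < r" using assms by (auto simp: generators_def)
  have "(\<Sum>j = 1..r. n j * simple_root a j)
      = (\<Sum>j = 1..r. (if j = Suc i then n j else 0) - (if j = i then n j else 0))"
    by (rule sum.cong) (auto simp: Tau)
  then show ?thesis using i by (simp add: lattice_form_def sum_subtractf Tau)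
next
  case Cr
  have "(\<Sum>j = 1..r. n j * simple_root a j) = (\<Sum>j = 1..4. n j)"
    using assms by (intro sum.mono_neutral_cong_right) (auto simp: Cr)
  then show ?thesis by (simp add: lattice_form_def Cr numeral_eq_Suc)
qed

lemma lattice_form_reflect:
  assumes "a \<in> generators r" "r \<ge> 8"
  shows "lattice_form r (reflect a n) (reflect a m) = lattice_form r n m"
proof -
  have sym: "lattice_form r (simple_root a) k = coroot a k" for k
    using lattice_form_simple_root[OF assms] lattice_form_sym by metis
  have left: "lattice_form r (reflect a k) l = lattice_form r k l - coroot a k * coroot a l" for k l
    unfolding reflect_def lattice_form_diff sym ..
  have "coroot a (reflect a m) = - coroot a m"
    using coroot_simple_root[OF assms(1,1)] by (simp add: reflect_def coroot_diff)
  moreover have "lattice_form r n (reflect a m) = lattice_form r n m - coroot a m * coroot a n"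
    using left lattice_form_sym by metis
  ultimately show ?thesis unfolding left[of n] by simp
qed

lemma lattice_form_action:
  assumes "w \<in> lists (generators r)" "r \<ge> 8"
  shows "lattice_form r (lattice_action w n) (lattice_action w m) = lattice_form r n m"
  using assms by (induction w) (auto simp: lattice_form_reflect)

text \<open>The generator of the radical of the root lattice of the affine subdiagram
  \<open>T\<^sub>2\<^sub>,\<^sub>4\<^sub>,\<^sub>4\<close> with vertices \<open>\<tau>\<^sub>1, \<dots>,
  \<tau>\<^sub>7, s\<close>.\<close>

definition isotropic_vector :: "nat \<Rightarrow> int" where
  "isotropic_vector = (\<lambda>j. if j = 0 then 2 else if j \<le> 8 then 1 else 0)"

text \<open>The pairing is \<open>- 1\<close> at \<open>\<tau>\<^sub>8\<close> and vanishes at all other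
  generators.\<close>

lemma coroot_isotropic_vector:
  assumes "a \<in> generators r"
  shows "coroot a isotropic_vector \<le> 0"
  using assms by (cases a) (auto simp: generators_def isotropic_vector_def)

lemma height_isotropic_vector:
  assumes "r \<ge> 8"
  shows "height r isotropic_vector = 18"
proof -
  have "(\<Sum>j = 1..r. int j * isotropic_vector j) = (\<Sum>j = 1..8. int j)"
    using assms by (intro sum.mono_neutral_cong_right) (auto simp: isotropic_vector_def)
  also have "\<dots> = 36" by (simp add: numeral_eq_Suc)
  finally show ?thesis by (simp add: height_def isotropic_vector_def)
qed

text \<open>Shortening \<open>w\<close> by \<open>b\<close> to \<open>u\<close> gives \<open>w \<delta> = u
  \<delta> - (\<delta>, \<alpha>\<^sub>b) u \<alpha>\<^sub>b\<close>, where \<open>u \<alpha>\<^sub>b\<close> is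
  positive and \<open>(\<delta>, \<alpha>\<^sub>b) \<le> 0\<close>. So passing from \<open>u\<close> to
  \<open>w\<close> never lowers the height of the image of \<open>\<delta>\<close>.\<close>

lemma height_action_isotropic_vector:
  assumes "r \<ge> 8" "w \<in> lists (generators r)"
  shows "height r (lattice_action w isotropic_vector) > 0"
  using assms(2)
proof (induction "coxeter_length r w" arbitrary: w rule: less_induct)
  case less
  show ?case
  proof (cases "(w, []) \<in> word_rel r")
    case True
    then show ?thesis
      using lattice_action_word_rel[OF True] height_isotropic_vector[OF assms(1)] by simp
  next
    case False
    obtain b where b: "b \<in> generators r" "coxeter_length r (w @ [b]) < coxeter_length r w"
      using coxeter_length_descent[OF less.prems False] .
    define u where "u = w @ [b]"
    have u: "u \<in> lists (generators r)" using b less.prems by (auto simp: u_def)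
    have "coxeter_length r u < coxeter_length r (u @ [b])"
      using b coxeter_length_cancel[OF less.prems b(1)] by (simp add: u_def)
    then have "height r (lattice_action u (simple_root b)) > 0"
      using length_increase_imp_root_positive[OF assms(1) u b(1)] by simp
    moreover have "height r (lattice_action u isotropic_vector) > 0"
      using less.hyps[of u] b u by (simp add: u_def)
    moreover have "lattice_action w isotropic_vector
        = lattice_action u (\<lambda>j. 1 * isotropic_vector j
            + (- coroot b isotropic_vector) * simple_root b j)"
      using lattice_action_word_rel[OF word_rel_square[OF b(1) less.prems, of "[]"]]
      by (simp add: u_def reflect_def fun_eq_iff)
    moreover from calculation(1) have
      "(- coroot b isotropic_vector) * height r (lattice_action u (simple_root b)) \<ge> 0"
      using coroot_isotropic_vector[OF b(1)] by (intro mult_nonneg_nonneg) auto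
    ultimately show ?thesis
      by (simp only: lattice_action_linear height_linear)
  qed
qed

text \<open>The coefficients are the marks of the affine diagram. The formula is what shows that an element
  negating all simple roots negates \<open>\<delta>\<close>.\<close>

lemma isotropic_vector_decomposition:
  "isotropic_vector = (\<lambda>j. simple_root (Tau 1) j + 2 * simple_root (Tau 2) j
    + 3 * simple_root (Tau 3) j + 4 * simple_root (Tau 4) j + 3 * simple_root (Tau 5) j
    + 2 * simple_root (Tau 6) j + simple_root (Tau 7) j + 2 * simple_root Cr j)"
proof
  fix j :: nat
  have "j = 0 \<or> j = 1 \<or> j = 2 \<or> j = 3 \<or> j = 4 \<or> j = 5 \<or> j = 6 \<or> j = 7 \<or> j = 8 \<or> j > 8"
    by arith
  then show "isotropic_vector j = simple_root (Tau 1) j + 2 * simple_root (Tau 2) j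
    + 3 * simple_root (Tau 3) j + 4 * simple_root (Tau 4) j + 3 * simple_root (Tau 5) j
    + 2 * simple_root (Tau 6) j + simple_root (Tau 7) j + 2 * simple_root Cr j"
    by (elim disjE) (simp_all add: isotropic_vector_def)
qed

text \<open>A nontrivial \<open>w\<close> negates some simple root by Tits' argument. Adjacent simple roots
  have pairing \<open>- 1 \<noteq> 1\<close>, so the sign propagates along the connected diagram, and
  \<open>w\<close> negates the isotropic vector, whose orbit has positive height.\<close>

theorem word_trivial_if_roots_fixed_up_to_sign:
  assumes r: "r \<ge> 8" and w: "w \<in> lists (generators r)"
    and fixed: "\<And>a. a \<in> generators r \<Longrightarrow>
      lattice_action w (simple_root a) = simple_root a
      \<or> lattice_action w (simple_root a) = (\<lambda>j. - simple_root a j)"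
  shows "(w, []) \<in> word_rel r"
proof (rule ccontr)
  assume nontriv: "(w, []) \<notin> word_rel r"
  define neg where "neg a \<longleftrightarrow> lattice_action w (simple_root a) = (\<lambda>j. - simple_root a j)" for a
  obtain b where b: "b \<in> generators r" "coxeter_length r (w @ [b]) < coxeter_length r w"
    using coxeter_length_descent[OF w nontriv] .
  have "height r (lattice_action (w @ [b]) (simple_root b)) > 0"
    using b coxeter_length_cancel[OF w b(1)] w
    by (intro length_increase_imp_root_positive[OF r _ b(1)]) auto
  then have "height r (lattice_action w (simple_root b)) < 0"
    by (simp add: reflect_simple_root_self[OF b(1)] lattice_action_minus height_minus)
  then have negb: "neg b"
    using fixed[OF b(1)] height_simple_root[OF b(1) r] by (auto simp: neg_def)
  have neg_joined: "neg a \<longleftrightarrow> neg c"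
    if "a \<in> generators r" "c \<in> generators r" "joined a c" for a c
  proof -
    have ac: "lattice_form r (simple_root a) (simple_root c) = -1"
      using lattice_form_simple_root[OF that(2) r] coroot_simple_root[OF that(2,1)] that
        joined_sym[of a c] not_joined_self[of a] by auto
    define x y where "x = simple_root a" and "y = simple_root c"
    have inv: "lattice_form r (lattice_action w x) (lattice_action w y) = -1"
      using lattice_form_action[OF w r] ac by (simp add: x_def y_def)
    have "lattice_form r (\<lambda>j. - x j) y = 1" "lattice_form r x (\<lambda>j. - y j) = 1"
      using ac lattice_form_minus[of r x y] lattice_form_minus[of r y x]
        lattice_form_sym[of r x "\<lambda>j. - y j"] lattice_form_sym[of r y x]
      by (simp_all add: x_def y_def)
    with inv fixed[OF that(1)] fixed[OF that(2)] show ?thesis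
      unfolding neg_def x_def[symmetric] y_def[symmetric] by (metis one_neq_neg_one)
  qed
  have step: "neg (Tau (Suc i)) \<longleftrightarrow> neg (Tau i)" if "1 \<le> i" "Suc i < r" for i
    using neg_joined[of "Tau (Suc i)" "Tau i"] that by (simp add: Tau_in_generators)
  have tau: "neg (Tau i) \<longleftrightarrow> neg (Tau 1)" if "1 \<le> i" "i < r" for i
    using that by (induction i rule: dec_induct) (use step in auto)
  have cr: "neg Cr \<longleftrightarrow> neg (Tau 4)"
    using neg_joined[of Cr "Tau 4"] r by (simp add: Tau_in_generators Cr_in_generators)
  have all: "neg (Tau i)" if "1 \<le> i" "i < r" for i
  proof -
    have "neg (Tau 1)"
    proof (cases b)
      case (Tau j)
      then show ?thesis using negb b(1) tau[of j] by (simp add: Tau_in_generators)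
    next
      case Cr
      then show ?thesis using negb cr tau[of 4] r by simp
    qed
    then show ?thesis using tau[OF that] by simp
  qed
  have "lattice_action w isotropic_vector = (\<lambda>j. - isotropic_vector j)"
    using all[of 1] all[of 2] all[of 3] all[of 4] all[of 5] all[of 6] all[of 7] all[of 4] cr r
    unfolding isotropic_vector_decomposition neg_def
    by (simp add: lattice_action_add lattice_action_scale algebra_simps)
  then show False
    using height_action_isotropic_vector[OF r w] height_isotropic_vector[OF r]
    by (simp add: height_minus)
qed

section \<open>Birational self-maps\<close>

definition local_functions :: "('a, 'k, 'm) fun_space_scheme \<Rightarrow> bool" where
  "local_functions X \<longleftrightarrow>
    (\<forall>V h h'. h \<in> regular X V \<longrightarrow> (\<forall>x\<in>V. h x = h' x) \<longrightarrow> h' \<in> regular X V)"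

lemma local_functionsD:
  assumes "local_functions X" "h \<in> regular X V" "\<And>x. x \<in> V \<Longrightarrow> h x = h' x"
  shows "h' \<in> regular X V"
  using assms unfolding local_functions_def by metis

lemma dense_open_Int:
  assumes "dense_open X U" "dense_open X V"
  shows "dense_open X (U \<inter> V)"
proof -
  have "zariski X closure_of (U \<inter> V) = zariski X closure_of (U \<inter> zariski X closure_of V)"
    using assms(1) unfolding dense_open_def
    by (intro closure_of_openin_Int_closure_of[symmetric]) simp
  also have "U \<inter> zariski X closure_of V = U"
    using assms openin_subset[of "zariski X" U] unfolding dense_open_def by blast
  finally have "zariski X closure_of (U \<inter> V) = zariski X closure_of U" .
  with assms show ?thesis by (simp add: dense_open_def openin_Int)
qed

lemma dense_open_topspace: "dense_open X (topspace (zariski X))"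
  by (simp add: dense_open_def)

lemma dense_open_meets:
  assumes "dense_open X V" "openin (zariski X) W" "W \<noteq> {}"
  shows "V \<inter> W \<noteq> {}"
  using assms unfolding dense_open_def by (metis dense_intersects_open)

lemma dense_openI:
  assumes "openin (zariski X) V" "\<And>W. openin (zariski X) W \<Longrightarrow> W \<noteq> {} \<Longrightarrow> V \<inter> W \<noteq> {}"
  shows "dense_open X V"
  using assms unfolding dense_open_def by (metis dense_intersects_open)

lemma rational_mapD:
  assumes "rational_map X f"
  shows "dense_open X (dom f)" "f x = Some y \<Longrightarrow> y \<in> topspace (zariski X)"
    "f x = Some y \<Longrightarrow> x \<in> topspace (zariski X)"
    "openin (zariski X) W \<Longrightarrow> openin (zariski X) {x \<in> dom f. the (f x) \<in> W}"
    "openin (zariski X) W \<Longrightarrow> h \<in> regular X W \<Longrightarrow>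
      (\<lambda>x. h (the (f x))) \<in> regular X {x \<in> dom f. the (f x) \<in> W}"
  using assms openin_subset[of "zariski X" "dom f"]
  unfolding rational_map_def dense_open_def by (auto intro: ranI)

lemma agree_refl: "dense_open X (dom f) \<Longrightarrow> agree X f f"
  by (auto simp: agree_def)

lemma agree_sym: "agree X f g \<Longrightarrow> agree X g f"
  by (auto simp: agree_def)

lemma agree_trans:
  assumes "agree X f g" "agree X g h"
  shows "agree X f h"
proof -
  obtain D E where "dense_open X D" "D \<subseteq> dom f \<inter> dom g" "\<forall>x\<in>D. f x = g x"
    and "dense_open X E" "E \<subseteq> dom g \<inter> dom h" "\<forall>x\<in>E. g x = h x"
    using assms by (auto simp: agree_def)
  then show ?thesis
    unfolding agree_def by (intro exI[of _ "D \<inter> E"]) (auto intro: dense_open_Int)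
qed

lemma agree_identity_map:
  "agree X f (identity_map X) \<longleftrightarrow>
    (\<exists>D. dense_open X D \<and> D \<subseteq> dom f \<and> (\<forall>x\<in>D. f x = Some x))" (is "?L \<longleftrightarrow> ?R")
proof
  assume ?L
  then obtain D where D: "dense_open X D" "D \<subseteq> dom f" "\<forall>x\<in>D. f x = identity_map X x"
    by (auto simp: agree_def)
  then have "D \<subseteq> topspace (zariski X)" by (auto simp: dense_open_def dest: openin_subset)
  with D show ?R by (intro exI[of _ D]) (auto simp: identity_map_def)
next
  assume ?R
  then obtain D where D: "dense_open X D" "D \<subseteq> dom f" "\<forall>x\<in>D. f x = Some x" by auto
  then have "D \<subseteq> topspace (zariski X)" by (auto simp: dense_open_def dest: openin_subset)
  with D show ?L by (auto simp: agree_def identity_map_def intro!: exI[of _ D])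
qed

lemma rational_map_identity:
  assumes "local_functions X"
  shows "rational_map X (identity_map X)"
proof -
  have dom: "dom (identity_map X) = topspace (zariski X)" by (simp add: identity_map_def)
  have pre: "{x \<in> dom (identity_map X). the (identity_map X x) \<in> W} = W"
    if "openin (zariski X) W" for W
    using openin_subset[OF that] by (auto simp: identity_map_def)
  have "(\<lambda>x. h (the (identity_map X x))) \<in> regular X W"
    if "openin (zariski X) W" "h \<in> regular X W" for h W
  proof -
    show ?thesis
      by (rule local_functionsD[OF assms that(2)])
        (use openin_subset[OF that(1)] in \<open>auto simp: identity_map_def\<close>)
  qed
  then show ?thesis
    unfolding rational_map_def using pre dom dense_open_topspace[of X]
    by (auto simp: identity_map_def ran_restrictD dest!: ran_restrictD)
qed

lemma rational_map_compose:
  assumes "local_functions X" "rational_map X f" "rational_map X g"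
    and "dense_open X {x \<in> dom g. the (g x) \<in> dom f}"
  shows "rational_map X (f \<circ>\<^sub>m g)"
  unfolding rational_map_def
proof (intro conjI allI impI ballI)
  have dom: "dom (f \<circ>\<^sub>m g) = {x \<in> dom g. the (g x) \<in> dom f}"
    by (auto simp: map_comp_def split: option.splits)
  with assms(4) show "dense_open X (dom (f \<circ>\<^sub>m g))" by simp
  show "ran (f \<circ>\<^sub>m g) \<subseteq> topspace (zariski X)"
    using rational_mapD(2)[OF assms(2)]
    by (auto simp: ran_def map_comp_def split: option.splits)
  fix W assume W: "openin (zariski X) W"
  define V where "V = {y \<in> dom f. the (f y) \<in> W}"
  have V: "openin (zariski X) V"
    unfolding V_def by (rule rational_mapD(4)[OF assms(2) W])
  have pre: "{x \<in> dom (f \<circ>\<^sub>m g). the ((f \<circ>\<^sub>m g) x) \<in> W} = {x \<in> dom g. the (g x) \<in> V}"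
    by (auto simp: V_def map_comp_def split: option.splits)
  show "openin (zariski X) {x \<in> dom (f \<circ>\<^sub>m g). the ((f \<circ>\<^sub>m g) x) \<in> W}"
    unfolding pre by (rule rational_mapD(4)[OF assms(3) V])
  fix h assume "h \<in> regular X W"
  then have "(\<lambda>y. h (the (f y))) \<in> regular X V"
    unfolding V_def by (rule rational_mapD(5)[OF assms(2) W])
  from rational_mapD(5)[OF assms(3) V this]
  show "(\<lambda>x. h (the ((f \<circ>\<^sub>m g) x))) \<in> regular X {x \<in> dom (f \<circ>\<^sub>m g). the ((f \<circ>\<^sub>m g) x) \<in> W}"
    unfolding pre by (rule local_functionsD[OF assms(1)]) (auto simp: map_comp_def)
qed

text \<open>A nonempty open \<open>W\<close> is tested with a rational inverse \<open>h\<close> of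
  \<open>g\<close>: the open set \<open>h\<^sup>-\<^sup>1(W)\<close> is nonempty because \<open>h g = 1\<close>
  generically, so it meets \<open>V\<close> in a point \<open>y\<close> with \<open>g (h y) = y\<close>, and
  \<open>h y\<close> lies in \<open>W\<close> and in the preimage of \<open>V\<close>. This density is what
  makes composites of birational maps rational.\<close>

lemma birational_preimage_dense:
  assumes "birational_map X g" "dense_open X V"
  shows "dense_open X {x \<in> dom g. the (g x) \<in> V}"
proof (rule dense_openI)
  obtain h where g: "rational_map X g" and h: "rational_map X h"
    and "agree X (h \<circ>\<^sub>m g) (identity_map X)" "agree X (g \<circ>\<^sub>m h) (identity_map X)"
    using assms(1) by (auto simp: birational_map_def)
  then obtain D E where D: "dense_open X D" "D \<subseteq> dom (h \<circ>\<^sub>m g)" "\<forall>x\<in>D. (h \<circ>\<^sub>m g) x = Some x"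
    and E: "dense_open X E" "E \<subseteq> dom (g \<circ>\<^sub>m h)" "\<forall>x\<in>E. (g \<circ>\<^sub>m h) x = Some x"
    unfolding agree_identity_map by auto
  have V: "openin (zariski X) V" using assms(2) by (simp add: dense_open_def)
  show "openin (zariski X) {x \<in> dom g. the (g x) \<in> V}"
    by (rule rational_mapD(4)[OF g V])
  fix W assume W: "openin (zariski X) W" "W \<noteq> {}"
  define W' where "W' = {y \<in> dom h. the (h y) \<in> W}"
  have "openin (zariski X) W'" unfolding W'_def by (rule rational_mapD(4)[OF h W(1)])
  moreover have "W' \<noteq> {}"
  proof -
    obtain x where x: "x \<in> D" "x \<in> W" using dense_open_meets[OF D(1) W] by auto
    then have "(h \<circ>\<^sub>m g) x = Some x" using D by auto
    then have "the (g x) \<in> W'" using x by (auto simp: W'_def map_comp_Some_iff)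
    then show ?thesis by auto
  qed
  ultimately obtain y where y: "y \<in> E \<inter> V" "y \<in> W'"
    using dense_open_meets[OF dense_open_Int[OF E(1) assms(2)]] by blast
  then have "(g \<circ>\<^sub>m h) y = Some y" using E by auto
  then have "the (h y) \<in> {x \<in> dom g. the (g x) \<in> V} \<inter> W"
    using y by (auto simp: W'_def map_comp_Some_iff)
  then show "{x \<in> dom g. the (g x) \<in> V} \<inter> W \<noteq> {}" by auto
qed

lemma birational_map_rational: "birational_map X f \<Longrightarrow> rational_map X f"
  by (simp add: birational_map_def)

lemma birational_map_dom: "birational_map X f \<Longrightarrow> dense_open X (dom f)"
  by (simp add: birational_map_def rational_map_def)

lemma birational_inverse:
  assumes "birational_map X f"
  obtains g where "birational_map X g" "agree X (g \<circ>\<^sub>m f) (identity_map X)"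
    "agree X (f \<circ>\<^sub>m g) (identity_map X)"
  using assms unfolding birational_map_def by blast

lemma birational_rational_compose:
  assumes "local_functions X" "birational_map X f" "birational_map X g"
  shows "rational_map X (f \<circ>\<^sub>m g)"
  using birational_preimage_dense[OF assms(3) birational_map_dom[OF assms(2)]] assms
  by (intro rational_map_compose) (simp_all add: birational_map_rational)

lemma agree_compose:
  assumes "birational_map X g" "agree X f f'" "agree X g g'"
  shows "agree X (f \<circ>\<^sub>m g) (f' \<circ>\<^sub>m g')"
proof -
  obtain D E where D: "dense_open X D" "D \<subseteq> dom f \<inter> dom f'" "\<forall>x\<in>D. f x = f' x"
    and E: "dense_open X E" "E \<subseteq> dom g \<inter> dom g'" "\<forall>x\<in>E. g x = g' x"
    using assms by (auto simp: agree_def)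
  have "dense_open X (E \<inter> {x \<in> dom g. the (g x) \<in> D})"
    by (rule dense_open_Int[OF E(1) birational_preimage_dense[OF assms(1) D(1)]])
  moreover have "x \<in> dom (f \<circ>\<^sub>m g) \<and> x \<in> dom (f' \<circ>\<^sub>m g') \<and> (f \<circ>\<^sub>m g) x = (f' \<circ>\<^sub>m g') x"
    if x: "x \<in> E \<inter> {x \<in> dom g. the (g x) \<in> D}" for x
  proof -
    obtain y where y: "g x = Some y" "y \<in> D" using x by auto
    moreover obtain z where "f y = Some z" using y D(2) by blast
    moreover have "g' x = Some y" using y x E(3) by force
    moreover have "f' y = f y" using y D(3) by simp
    ultimately show ?thesis by (simp add: map_comp_def dom_def)
  qed
  ultimately show ?thesis unfolding agree_def by (meson IntI subsetI)
qed

lemma map_comp_assoc': "(f \<circ>\<^sub>m g) \<circ>\<^sub>m h = f \<circ>\<^sub>m (g \<circ>\<^sub>m h)"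
  by (auto simp: map_comp_def fun_eq_iff split: option.splits)

lemma rational_map_comp_identity:
  assumes "rational_map X f"
  shows "f \<circ>\<^sub>m identity_map X = f" "identity_map X \<circ>\<^sub>m f = f"
proof -
  show "f \<circ>\<^sub>m identity_map X = f"
  proof
    fix x
    show "(f \<circ>\<^sub>m identity_map X) x = f x"
      using rational_mapD(3)[OF assms, of x]
      by (cases "f x") (auto simp: map_comp_def identity_map_def restrict_map_def)
  qed
  show "identity_map X \<circ>\<^sub>m f = f"
  proof
    fix x
    show "(identity_map X \<circ>\<^sub>m f) x = f x"
      using rational_mapD(2)[OF assms, of x]
      by (cases "f x") (auto simp: map_comp_def identity_map_def restrict_map_def)
  qed
qed

lemma birational_map_identity:
  assumes "local_functions X"
  shows "birational_map X (identity_map X)"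
  using rational_map_identity[OF assms] rational_map_comp_identity(1)[OF rational_map_identity[OF assms]]
  unfolding birational_map_def by (auto intro!: exI[of _ "identity_map X"] agree_refl dest: rational_mapD(1))

lemma birational_map_compose:
  assumes "local_functions X" "birational_map X f" "birational_map X g"
  shows "birational_map X (f \<circ>\<^sub>m g)"
proof -
  obtain f' where f': "birational_map X f'" "agree X (f' \<circ>\<^sub>m f) (identity_map X)"
    "agree X (f \<circ>\<^sub>m f') (identity_map X)" using birational_inverse[OF assms(2)] .
  obtain g' where g': "birational_map X g'" "agree X (g' \<circ>\<^sub>m g) (identity_map X)"
    "agree X (g \<circ>\<^sub>m g') (identity_map X)" using birational_inverse[OF assms(3)] .
  have cancel: "agree X (v' \<circ>\<^sub>m (u' \<circ>\<^sub>m (u \<circ>\<^sub>m v))) (identity_map X)"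
    if "birational_map X u" "birational_map X v" "birational_map X v'"
      "agree X (u' \<circ>\<^sub>m u) (identity_map X)" "agree X (v' \<circ>\<^sub>m v) (identity_map X)" for u v u' v'
  proof -
    have "agree X (u' \<circ>\<^sub>m (u \<circ>\<^sub>m v)) v"
      using agree_compose[OF that(2,4) agree_refl[OF birational_map_dom[OF that(2)]]]
        rational_map_comp_identity(2)[OF birational_map_rational[OF that(2)]]
      by (simp add: map_comp_assoc')
    from agree_compose[OF that(2) agree_refl[OF birational_map_dom[OF that(3)]] agree_sym[OF this]]
    show ?thesis by (rule agree_trans[OF agree_sym that(5)])
  qed
  have "agree X ((g' \<circ>\<^sub>m f') \<circ>\<^sub>m (f \<circ>\<^sub>m g)) (identity_map X)"
    using cancel[OF assms(2,3) g'(1) f'(2) g'(2)] by (simp add: map_comp_assoc')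
  moreover have "agree X ((f \<circ>\<^sub>m g) \<circ>\<^sub>m (g' \<circ>\<^sub>m f')) (identity_map X)"
    using cancel[OF g'(1) f'(1) assms(2) g'(3) f'(3)] by (simp add: map_comp_assoc')
  ultimately show ?thesis
    using birational_rational_compose[OF assms] birational_rational_compose[OF assms(1) g'(1) f'(1)]
    unfolding birational_map_def by blast
qed

lemma equiv_birational_rel: "equiv {f. birational_map X f} (birational_rel X)"
  unfolding equiv_def
proof (intro conjI)
  show "sym (birational_rel X)"
  proof (rule symI)
    fix f g
    assume "(f, g) \<in> birational_rel X"
    then show "(g, f) \<in> birational_rel X"
      using agree_sym[of X f g] by (simp add: birational_rel_def)
  qed
  show "trans (birational_rel X)"
  proof (rule transI)
    fix f g h
    assume "(f, g) \<in> birational_rel X" "(g, h) \<in> birational_rel X"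
    then show "(f, h) \<in> birational_rel X"
      using agree_trans[of X f g h] by (simp add: birational_rel_def)
  qed
qed (auto simp: refl_on_def birational_rel_def intro: agree_refl birational_map_dom)

lemma birational_rel_class_eq:
  assumes "birational_map X f" "birational_map X g"
  shows "birational_rel X `` {f} = birational_rel X `` {g} \<longleftrightarrow> agree X f g"
  using eq_equiv_class_iff[OF equiv_birational_rel, of f X g] assms
  by (simp add: birational_rel_def)

lemma Bir_mult_class:
  assumes "local_functions X" "birational_map X f" "birational_map X g"
  shows "(birational_rel X `` {f}) \<otimes>\<^bsub>Bir X\<^esub> (birational_rel X `` {g}) = birational_rel X `` {f \<circ>\<^sub>m g}"
proof -
  let ?A = "birational_rel X `` {f}" and ?B = "birational_rel X `` {g}"
  have "(\<Union>f'\<in>?A. \<Union>g'\<in>?B. birational_rel X `` {f' \<circ>\<^sub>m g'})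
      = (\<Union>f'\<in>?A. \<Union>g'\<in>?B. birational_rel X `` {f \<circ>\<^sub>m g})"
  proof (intro SUP_cong HOL.refl)
    fix f' g' assume "f' \<in> ?A" "g' \<in> ?B"
    then have *: "birational_map X f'" "birational_map X g'" "agree X f f'" "agree X g g'"
      by (auto simp: birational_rel_def)
    show "birational_rel X `` {f' \<circ>\<^sub>m g'} = birational_rel X `` {f \<circ>\<^sub>m g}"
      unfolding birational_rel_class_eq[OF birational_map_compose[OF assms(1) *(1,2)]
          birational_map_compose[OF assms]]
      by (rule agree_sym[OF agree_compose[OF assms(3) *(3,4)]])
  qed
  also have "f \<in> ?A" "g \<in> ?B"
    using assms by (auto simp: birational_rel_def intro: agree_refl birational_map_dom)
  then have "(\<Union>f'\<in>?A. \<Union>g'\<in>?B. birational_rel X `` {f \<circ>\<^sub>m g}) = birational_rel X `` {f \<circ>\<^sub>m g}"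
    by blast
  finally show ?thesis by (simp add: Bir_def)
qed

section \<open>The Zariski topology of affine space over an infinite field\<close>

lemma poly_fun_uminus: "f \<in> poly_fun r \<Longrightarrow> (\<lambda>c. - f c) \<in> poly_fun r"
  using poly_fun.mult[OF poly_fun.const[of "- 1"]] by simp

lemma poly_fun_diff: "f \<in> poly_fun r \<Longrightarrow> g \<in> poly_fun r \<Longrightarrow> (\<lambda>c. f c - g c) \<in> poly_fun r"
  using poly_fun.add[OF _ poly_fun_uminus] by fastforce

lemma poly_fun_prod:
  assumes "\<And>x. x \<in> A \<Longrightarrow> f x \<in> poly_fun r"
  shows "(\<lambda>c. \<Prod>x\<in>A. f x c) \<in> poly_fun r"
  using assms
proof (induction A rule: infinite_finite_induct)
  case (insert x A)
  then have "f x \<in> poly_fun r" "(\<lambda>c. \<Prod> x\<in>A. f x c) \<in> poly_fun r" by auto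
  from poly_fun.mult[OF this] show ?case using insert by simp
qed (simp_all add: poly_fun.const)

text \<open>Restriction to lines reduces questions about polynomials in many variables to univariate
  polynomials.\<close>

lemma poly_fun_on_line:
  assumes "f \<in> poly_fun r"
  shows "\<exists>p. \<forall>t. f (\<lambda>i. c i + t *s (d i - c i)) = poly p t"
  using assms
proof (induction rule: poly_fun.induct)
  case (const a)
  show ?case by (rule exI[of _ "[:a:]"]) simp
next
  case (coord i j)
  show ?case by (rule exI[of _ "[:c i $ j, d i $ j - c i $ j:]"]) (simp add: algebra_simps)
next
  case (add f g)
  then obtain p q where "\<forall>t. f (\<lambda>i. c i + t *s (d i - c i)) = poly p t"
    "\<forall>t. g (\<lambda>i. c i + t *s (d i - c i)) = poly q t" by auto
  then show ?case by (intro exI[of _ "p + q"]) simp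
next
  case (mult f g)
  then obtain p q where "\<forall>t. f (\<lambda>i. c i + t *s (d i - c i)) = poly p t"
    "\<forall>t. g (\<lambda>i. c i + t *s (d i - c i)) = poly q t" by auto
  then show ?case by (intro exI[of _ "p * q"]) simp
qed

lemma infinite_field_nonroot:
  fixes p :: "'k::field poly"
  assumes "infinite (UNIV :: 'k set)" "p \<noteq> 0"
  obtains t where "poly p t \<noteq> 0"
proof (rule ccontr)
  assume "\<not> thesis"
  then have "{t. poly p t = 0} = UNIV" using that by auto
  then show False using poly_roots_finite[OF assms(2)] assms(1) by simp
qed

text \<open>This is the irreducibility of affine space: on the line joining \<open>c\<close> and
  \<open>d\<close>, both functions restrict to nonzero univariate polynomials, and an infinite field contains a
  common nonroot.\<close>

lemma poly_fun_common_nonzero: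
  fixes f g :: "(nat \<Rightarrow> 'k::field ^ 4) \<Rightarrow> 'k"
  assumes "infinite (UNIV :: 'k set)" "f \<in> poly_fun r" "g \<in> poly_fun r"
    and "c \<in> affine_space r" "f c \<noteq> 0" "d \<in> affine_space r" "g d \<noteq> 0"
  obtains e where "e \<in> affine_space r" "f e \<noteq> 0" "g e \<noteq> 0"
proof -
  define l where "l t = (\<lambda>i. c i + t *s (d i - c i))" for t
  obtain p q where p: "\<And>t. f (l t) = poly p t" and q: "\<And>t. g (l t) = poly q t"
    using poly_fun_on_line[OF assms(2)] poly_fun_on_line[OF assms(3)] unfolding l_def by metis
  have "l 0 = c" "l 1 = d" by (auto simp: l_def)
  then have "p \<noteq> 0" "q \<noteq> 0" using p[of 0] q[of 1] assms by auto
  then obtain t where "poly (p * q) t \<noteq> 0"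
    using infinite_field_nonroot[OF assms(1), of "p * q"] by auto
  then have "f (l t) \<noteq> 0" "g (l t) \<noteq> 0" by (auto simp: p q)
  moreover have "l t \<in> affine_space r"
    using assms(4,6) by (auto simp: affine_space_def l_def PiE_iff extensional_def)
  ultimately show ?thesis using that by blast
qed

lemma openin_affine_basic:
  "f \<in> poly_fun r \<Longrightarrow> openin (affine_zariski r) {c \<in> affine_space r. f c \<noteq> 0}"
  unfolding affine_zariski_def by (rule topology_generated_by_Basis) auto

lemma topspace_affine_zariski: "topspace (affine_zariski r) = affine_space r"
proof -
  have "affine_space r \<in> {{c \<in> affine_space r. f c \<noteq> 0} | f. f \<in> poly_fun r}"
    by (rule CollectI, rule exI[of _ "\<lambda>c. 1"]) (auto intro: poly_fun.const)
  then show ?thesis unfolding affine_zariski_def topology_generated_by_topspace by auto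
qed

text \<open>The generating sets \<open>{f \<noteq> 0}\<close> are closed under intersection, since \<open>f g
  \<noteq> 0\<close> iff \<open>f \<noteq> 0\<close> and \<open>g \<noteq> 0\<close>; so they form a
  basis.\<close>

lemma openin_affine_contains_basic:
  assumes "openin (affine_zariski r) N" "c \<in> N"
  obtains f where "f \<in> poly_fun r" "f c \<noteq> 0" "{d \<in> affine_space r. f d \<noteq> 0} \<subseteq> N"
proof -
  have "generate_topology_on {{c \<in> affine_space r. f c \<noteq> 0} | f. f \<in> poly_fun r} N"
    using assms(1) unfolding affine_zariski_def by (rule openin_topology_generated_by)
  then have "\<exists>f\<in>poly_fun r. f c \<noteq> 0 \<and> {d \<in> affine_space r. f d \<noteq> 0} \<subseteq> N"
    using assms(2)
  proof (induction rule: generate_topology_on.induct)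
    case Empty
    then show ?case by simp
  next
    case (Int a b)
    then obtain f where f: "f \<in> poly_fun r" "f c \<noteq> 0" "{d \<in> affine_space r. f d \<noteq> 0} \<subseteq> a"
      by blast
    obtain g where g: "g \<in> poly_fun r" "g c \<noteq> 0" "{d \<in> affine_space r. g d \<noteq> 0} \<subseteq> b"
      using Int by blast
    have "{d \<in> affine_space r. f d * g d \<noteq> 0} \<subseteq> a \<inter> b" using f(3) g(3) by auto
    then show ?case
      using f(2) g(2) by (intro bexI[OF _ poly_fun.mult[OF f(1) g(1)]]) simp
  next
    case (UN K)
    then obtain k where k: "k \<in> K" "c \<in> k" by auto
    then obtain f where "f \<in> poly_fun r" "f c \<noteq> 0" "{d \<in> affine_space r. f d \<noteq> 0} \<subseteq> k"
      using UN.IH by blast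
    moreover have "k \<subseteq> \<Union>K" using k by auto
    ultimately show ?case by (meson order_trans)
  next
    case (Basis s)
    then obtain f where f: "f \<in> poly_fun r" "s = {d \<in> affine_space r. f d \<noteq> 0}" by auto
    with Basis.prems show ?case by (intro bexI[OF _ f(1)]) simp
  qed
  with that show ?thesis by blast
qed

lemma openin_affineI:
  assumes "N \<subseteq> affine_space r"
    and "\<And>c. c \<in> N \<Longrightarrow> \<exists>f\<in>poly_fun r. f c \<noteq> 0 \<and> {d \<in> affine_space r. f d \<noteq> 0} \<subseteq> N"
  shows "openin (affine_zariski r) N"
proof (subst openin_subopen, intro ballI)
  fix c assume c: "c \<in> N"
  with assms(2) obtain f where f: "f \<in> poly_fun r" "f c \<noteq> 0" "{d \<in> affine_space r. f d \<noteq> 0} \<subseteq> N"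
    by blast
  then show "\<exists>T. openin (affine_zariski r) T \<and> c \<in> T \<and> T \<subseteq> N"
    using openin_affine_basic[OF f(1)] c assms(1) by blast
qed

lemma openin_affine_subset: "openin (affine_zariski r) N \<Longrightarrow> N \<subseteq> affine_space r"
  using openin_subset topspace_affine_zariski by metis

lemma affine_opens_meet:
  assumes "infinite (UNIV :: 'k set)"
    and "openin (affine_zariski r) M" "openin (affine_zariski r) N" "M \<noteq> {}" "N \<noteq> {}"
  shows "M \<inter> (N :: (nat \<Rightarrow> 'k::field ^ 4) set) \<noteq> {}"
proof -
  obtain c d where c: "c \<in> M" and d: "d \<in> N" using assms by auto
  obtain f where f: "f \<in> poly_fun r" "f c \<noteq> 0" "{e \<in> affine_space r. f e \<noteq> 0} \<subseteq> M"
    using openin_affine_contains_basic[OF assms(2) c] .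
  obtain g where g: "g \<in> poly_fun r" "g d \<noteq> 0" "{e \<in> affine_space r. g e \<noteq> 0} \<subseteq> N"
    using openin_affine_contains_basic[OF assms(3) d] .
  have "c \<in> affine_space r" "d \<in> affine_space r"
    using c d assms(2,3) openin_affine_subset by blast+
  with poly_fun_common_nonzero[OF assms(1) f(1) g(1) _ f(2) _ g(2)]
  obtain e where "e \<in> affine_space r" "f e \<noteq> 0" "g e \<noteq> 0" by blast
  with f g show ?thesis by blast
qed

definition polynomial_map :: "nat \<Rightarrow> ((nat \<Rightarrow> 'k::field ^ 4) \<Rightarrow> nat \<Rightarrow> 'k ^ 4) \<Rightarrow> bool" where
  "polynomial_map r \<phi> \<longleftrightarrow> (\<forall>c\<in>affine_space r. \<phi> c \<in> affine_space r) \<and>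
    (\<forall>i\<in>{1..r}. \<forall>j. (\<lambda>c. \<phi> c i $ j) \<in> poly_fun r)"

lemma poly_fun_polynomial_map:
  assumes "polynomial_map r \<phi>" "f \<in> poly_fun r"
  shows "(\<lambda>c. f (\<phi> c)) \<in> poly_fun r"
  using assms(2)
proof (induction rule: poly_fun.induct)
  case (const a)
  show ?case by (rule poly_fun.const)
next
  case (coord i j)
  then show ?case using assms(1) by (auto simp: polynomial_map_def)
next
  case (add f g)
  from poly_fun.add[OF add.IH] show ?case .
next
  case (mult f g)
  from poly_fun.mult[OF mult.IH] show ?case .
qed

lemma openin_polynomial_preimage:
  assumes "polynomial_map r \<phi>" "openin (affine_zariski r) N"
  shows "openin (affine_zariski r) {c \<in> affine_space r. \<phi> c \<in> N}"
proof (rule openin_affineI)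
  fix c assume "c \<in> {c \<in> affine_space r. \<phi> c \<in> N}"
  then have c: "\<phi> c \<in> N" by simp
  obtain f where f: "f \<in> poly_fun r" "f (\<phi> c) \<noteq> 0" "{d \<in> affine_space r. f d \<noteq> 0} \<subseteq> N"
    using openin_affine_contains_basic[OF assms(2) c] .
  have "\<phi> d \<in> affine_space r" if "d \<in> affine_space r" for d
    using assms(1) that by (simp add: polynomial_map_def)
  with f(3) have "{d \<in> affine_space r. f (\<phi> d) \<noteq> 0} \<subseteq> {c \<in> affine_space r. \<phi> c \<in> N}"
    by blast
  with f(2) show "\<exists>f\<in>poly_fun r. f c \<noteq> 0 \<and>
      {d \<in> affine_space r. f d \<noteq> 0} \<subseteq> {c \<in> affine_space r. \<phi> c \<in> N}"
    by (intro bexI[OF _ poly_fun_polynomial_map[OF assms(1) f(1)]] conjI)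
qed (rule Collect_restrict)

lemma affine_regular_polynomial_map:
  assumes "polynomial_map r \<phi>" "h \<in> affine_regular r V" "openin (affine_zariski r) L"
  shows "(\<lambda>c. h (\<phi> c)) \<in> affine_regular r {c \<in> L. \<phi> c \<in> V}"
  unfolding affine_regular_def
proof (intro CollectI ballI)
  fix c assume "c \<in> {c \<in> L. \<phi> c \<in> V}"
  then have c: "c \<in> L" "\<phi> c \<in> V" by auto
  then obtain N f g where N: "openin (affine_zariski r) N" "\<phi> c \<in> N" "N \<subseteq> V"
    and fg: "f \<in> poly_fun r" "g \<in> poly_fun r" "\<forall>d\<in>N. g d \<noteq> 0 \<and> h d = f d / g d"
    using assms(2) unfolding affine_regular_def by blast
  let ?M = "{c \<in> affine_space r. \<phi> c \<in> N} \<inter> L"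
  have "openin (affine_zariski r) ?M"
    using openin_polynomial_preimage[OF assms(1) N(1)] assms(3) by (rule openin_Int)
  moreover have "c \<in> ?M" "?M \<subseteq> {c \<in> L. \<phi> c \<in> V}"
    using c N openin_affine_subset[OF assms(3)] by auto
  moreover have "\<forall>d\<in>?M. g (\<phi> d) \<noteq> 0 \<and> h (\<phi> d) = f (\<phi> d) / g (\<phi> d)"
    using fg by auto
  ultimately show "\<exists>N. openin (affine_zariski r) N \<and> c \<in> N \<and> N \<subseteq> {c \<in> L. \<phi> c \<in> V} \<and>
      (\<exists>f\<in>poly_fun r. \<exists>g\<in>poly_fun r. \<forall>d\<in>N. g d \<noteq> 0 \<and> h (\<phi> d) = f d / g d)"
    by (intro exI[of _ ?M] conjI bexI[OF _ poly_fun_polynomial_map[OF assms(1) fg(1)]]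
        bexI[OF _ poly_fun_polynomial_map[OF assms(1) fg(2)]])
qed

lemma affine_regular_cong:
  assumes "h \<in> affine_regular r V" "\<And>c. c \<in> V \<Longrightarrow> h c = h' c"
  shows "h' \<in> affine_regular r V"
  unfolding affine_regular_def
proof (intro CollectI ballI)
  fix c assume "c \<in> V"
  then obtain N f g where N: "openin (affine_zariski r) N" "c \<in> N" "N \<subseteq> V"
    and fg: "f \<in> poly_fun r" "g \<in> poly_fun r" "\<forall>d\<in>N. g d \<noteq> 0 \<and> h d = f d / g d"
    using assms(1) unfolding affine_regular_def by blast
  have "\<forall>d\<in>N. g d \<noteq> 0 \<and> h' d = f d / g d" using fg(3) N(3) assms(2) by fastforce
  with N fg(1,2) show "\<exists>N. openin (affine_zariski r) N \<and> c \<in> N \<and> N \<subseteq> V \<and>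
      (\<exists>f\<in>poly_fun r. \<exists>g\<in>poly_fun r. \<forall>d\<in>N. g d \<noteq> 0 \<and> h' d = f d / g d)" by blast
qed

lemma affine_regular_quotient:
  assumes "openin (affine_zariski r) V" "f \<in> poly_fun r" "g \<in> poly_fun r" "\<And>c. c \<in> V \<Longrightarrow> g c \<noteq> 0"
  shows "(\<lambda>c. f c / g c) \<in> affine_regular r V"
  unfolding affine_regular_def using assms by blast

text \<open>The identity principle, in the form that makes maps into \<open>U\<^sub>r\<close> comparable
  outside the dense set where they are known to agree: near \<open>c\<close> the two functions are quotients
  \<open>f / g\<close> and \<open>f' / g'\<close>, and \<open>f g' - f' g\<close> vanishes on a nonempty open
  set, hence everywhere.\<close>

lemma affine_regular_identity:
  fixes h h' :: "(nat \<Rightarrow> 'k::field ^ 4) \<Rightarrow> 'k"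
  assumes "infinite (UNIV :: 'k set)"
    and "h \<in> affine_regular r V" "h' \<in> affine_regular r V"
    and "openin (affine_zariski r) D" "D \<noteq> {}" "\<And>c. c \<in> D \<Longrightarrow> c \<in> V \<Longrightarrow> h c = h' c"
    and c: "c \<in> V"
  shows "h c = h' c"
proof (rule ccontr)
  assume ne: "h c \<noteq> h' c"
  obtain N f g where N: "openin (affine_zariski r) N" "c \<in> N" "N \<subseteq> V"
    and fg: "f \<in> poly_fun r" "g \<in> poly_fun r" "\<forall>d\<in>N. g d \<noteq> 0 \<and> h d = f d / g d"
    using assms(2) c unfolding affine_regular_def by blast
  obtain N' f' g' where N': "openin (affine_zariski r) N'" "c \<in> N'" "N' \<subseteq> V"
    and fg': "f' \<in> poly_fun r" "g' \<in> poly_fun r" "\<forall>d\<in>N'. g' d \<noteq> 0 \<and> h' d = f' d / g' d"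
    using assms(3) c unfolding affine_regular_def by blast
  define F where "F = (\<lambda>d. f d * g' d - f' d * g d)"
  have F: "F \<in> poly_fun r" 
    unfolding F_def
    by (rule poly_fun_diff[OF poly_fun.mult[OF fg(1) fg'(2)] poly_fun.mult[OF fg'(1) fg(2)]])
  have *: "F d = (h d - h' d) * (g d * g' d)" if "d \<in> N" "d \<in> N'" for d
  proof -
    have "g d \<noteq> 0" "g' d \<noteq> 0" "h d = f d / g d" "h' d = f' d / g' d"
      using that fg(3) fg'(3) by auto
    then show ?thesis by (simp add: F_def field_simps)
  qed
  define M where "M = {d \<in> affine_space r. F d \<noteq> 0} \<inter> (N \<inter> N')"
  have "openin (affine_zariski r) M"
    unfolding M_def using openin_affine_basic[OF F] N N' by blast
  moreover have "c \<in> M"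
  proof -
    have "g c \<noteq> 0" "g' c \<noteq> 0" "c \<in> affine_space r"
      using fg(3) fg'(3) N(2) N'(2) openin_affine_subset[OF N(1)] by blast+
    with *[OF N(2) N'(2)] ne N(2) N'(2) show ?thesis by (simp add: M_def)
  qed
  ultimately obtain d where "d \<in> M" "d \<in> D"
    using affine_opens_meet[OF assms(1) _ assms(4) _ assms(5)] by blast
  then show False using *[of d] assms(6)[of d] N(3) by (auto simp: M_def)
qed

section \<open>Brackets and point configurations\<close>

definition mat4 :: "'a ^ 4 \<Rightarrow> 'a ^ 4 \<Rightarrow> 'a ^ 4 \<Rightarrow> 'a ^ 4 \<Rightarrow> 'a ^ 4 ^ 4" where
  "mat4 u v w x = (\<chi> i j. (if j = 1 then u else if j = 2 then v else if j = 3 then w else x) $ i)"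

definition bracket :: "(nat \<Rightarrow> 'k::comm_ring_1 ^ 4) \<Rightarrow> nat \<Rightarrow> nat \<Rightarrow> nat \<Rightarrow> nat \<Rightarrow> 'k" where
  "bracket c i j k l = det (mat4 (c i) (c j) (c k) (c l))"

lemma mat4_component:
  "mat4 u v w x $ i $ 1 = u $ i" "mat4 u v w x $ i $ 2 = v $ i"
  "mat4 u v w x $ i $ 3 = w $ i" "mat4 u v w x $ i $ 4 = x $ i"
  by (simp_all add: mat4_def)

lemma det_4:
  "det (A :: 'a::comm_ring_1 ^ 4 ^ 4) =
    A$1$1 * (A$2$2 * A$3$3 * A$4$4 + A$2$3 * A$3$4 * A$4$2 + A$2$4 * A$3$2 * A$4$3
      - A$2$2 * A$3$4 * A$4$3 - A$2$3 * A$3$2 * A$4$4 - A$2$4 * A$3$3 * A$4$2)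
  - A$1$2 * (A$2$1 * A$3$3 * A$4$4 + A$2$3 * A$3$4 * A$4$1 + A$2$4 * A$3$1 * A$4$3
      - A$2$1 * A$3$4 * A$4$3 - A$2$3 * A$3$1 * A$4$4 - A$2$4 * A$3$3 * A$4$1)
  + A$1$3 * (A$2$1 * A$3$2 * A$4$4 + A$2$2 * A$3$4 * A$4$1 + A$2$4 * A$3$1 * A$4$2
      - A$2$1 * A$3$4 * A$4$2 - A$2$2 * A$3$1 * A$4$4 - A$2$4 * A$3$2 * A$4$1)
  - A$1$4 * (A$2$1 * A$3$2 * A$4$3 + A$2$2 * A$3$3 * A$4$1 + A$2$3 * A$3$1 * A$4$2
      - A$2$1 * A$3$3 * A$4$2 - A$2$2 * A$3$1 * A$4$3 - A$2$3 * A$3$2 * A$4$1)"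
proof -
  have f1: "finite {2::4, 3, 4}" "1 \<notin> {2::4, 3, 4}"
    and f2: "finite {3::4, 4}" "2 \<notin> {3::4, 4}"
    and f3: "finite {4::4}" "3 \<notin> {4::4}"
    by auto
  show ?thesis
    unfolding det_def UNIV_4
    unfolding sum_over_permutations_insert[OF f1]
    unfolding sum_over_permutations_insert[OF f2]
    unfolding sum_over_permutations_insert[OF f3]
    unfolding permutes_sing
    by (simp add: sign_swap_id permutation_swap_id permutation_compose sign_compose sign_id
        swap_id_eq algebra_simps)
qed

lemma mat4_matrix_mult:
  "A ** mat4 u v w x = mat4 (A *v u) (A *v v) (A *v w) (A *v x)"
  by (simp add: vec_eq_iff mat4_def matrix_matrix_mult_def matrix_vector_mult_def)

lemma mat4_scale:
  fixes a b c d :: "'k::comm_ring_1"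
  shows "det (mat4 (a *s u) (b *s v) (c *s w) (d *s x)) = a * b * c * d * det (mat4 u v w x)"
  by (simp add: det_4 mat4_component algebra_simps)

lemma mat4_vector_mult:
  "mat4 u v w x *v (y :: 'k::comm_ring_1 ^ 4) = y $ 1 *s u + y $ 2 *s v + y $ 3 *s w + y $ 4 *s x"
  by (simp add: vec_eq_iff matrix_vector_mult_def sum_4 mat4_component mult.commute)

lemma columns_mat4: "columns (mat4 u v w x) = {u, v, w, x}"
proof -
  have "column 1 (mat4 u v w x) = u" "column 2 (mat4 u v w x) = v"
    "column 3 (mat4 u v w x) = w" "column 4 (mat4 u v w x) = x"
    by (simp_all add: column_def mat4_component vec_eq_iff)
  moreover have "columns M = {column 1 M, column 2 M, column 3 M, column 4 M}" for M :: "'a ^ 4 ^ 4"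
    unfolding columns_def by auto (metis exhaust_4)
  ultimately show ?thesis by simp
qed

text \<open>If the determinant is nonzero, the vectors span the whole space. Otherwise a basis of their span
  has at most three elements and can be enlarged to three elements of a basis of the whole space.\<close>

lemma coplanar_iff_det_zero:
  fixes u v w x :: "'k::field ^ 4"
  shows "(\<exists>H\<in>planes. u \<in> H \<and> v \<in> H \<and> w \<in> H \<and> x \<in> H) \<longleftrightarrow> det (mat4 u v w x) = 0"
proof -
  have full: "det (mat4 u v w x) \<noteq> 0 \<longleftrightarrow> vec.span {u, v, w, x} = UNIV"
    unfolding invertible_det_nz[symmetric] invertible_right_inverse
      matrix_right_invertible_span_columns columns_mat4 ..
  have dim4: "vec.dim (UNIV :: ('k ^ 4) set) = 4"
    unfolding vec_dim_card by simp
  show ?thesis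
  proof
    assume "\<exists>H\<in>planes. u \<in> H \<and> v \<in> H \<and> w \<in> H \<and> x \<in> H"
    then obtain H where H: "vec.subspace H" "vec.dim H = 3" "{u, v, w, x} \<subseteq> H"
      by (auto simp: planes_def)
    then have "vec.span {u, v, w, x} \<subseteq> H" by (simp add: vec.span_minimal)
    moreover have "H \<noteq> UNIV" using H(2) dim4 by auto
    ultimately have "vec.span {u, v, w, x} \<noteq> UNIV" by blast
    then show "det (mat4 u v w x) = 0" using full by blast
  next
    assume "det (mat4 u v w x) = 0"
    then have "vec.span {u, v, w, x} \<noteq> UNIV" using full by blast
    moreover obtain B where B: "B \<subseteq> {u, v, w, x}" "vec.independent B" "{u, v, w, x} \<subseteq> vec.span B"
      using vec.maximal_independent_subset by blast
    ultimately have spanB: "vec.span B \<noteq> UNIV"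
      using vec.span_mono[OF B(1)] by auto
    define B' where "B' = vec.extend_basis B"
    have B': "B \<subseteq> B'" "vec.independent B'" "vec.span B' = UNIV"
      using vec.extend_basis_superset[OF B(2)] vec.independent_extend_basis[OF B(2)]
        vec.span_extend_basis[OF B(2)] by (auto simp: B'_def)
    have finB': "finite B'" using B'(2) by (rule vec.finiteI_independent)
    have "card B' = 4"
      using vec.dim_span_eq_card_independent[OF B'(2)] B'(3) dim4 by simp
    moreover have "B \<noteq> B'" using spanB B'(3) by auto
    then have "B \<subset> B'" using B'(1) by blast
    then have "card B < card B'" by (rule psubset_card_mono[OF finB'])
    ultimately have "card B \<le> 3" by simp
    then obtain T where T: "B \<subseteq> T" "T \<subseteq> B'" "card T = 3"
      using exists_subset_between[OF _ _ B'(1) finB', of 3] \<open>card B' = 4\<close> by auto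
    have "vec.independent T" using B'(2) T(2) by (rule vec.independent_mono)
    then have "vec.span T \<in> planes"
      using vec.dim_span_eq_card_independent[of T] T(3)
      unfolding planes_def by (simp add: vec.subspace_span del: vec.dim_span)
    moreover have "{u, v, w, x} \<subseteq> vec.span T" using B(3) vec.span_mono[OF T(1)] by blast
    ultimately show "\<exists>H\<in>planes. u \<in> H \<and> v \<in> H \<and> w \<in> H \<and> x \<in> H" by blast
  qed
qed

lemma span_singleton_eq:
  fixes u v :: "'k::field ^ 4"
  assumes "vec.span {u} = vec.span {v}" "v \<noteq> 0"
  obtains \<mu> where "\<mu> \<noteq> 0" "u = \<mu> *s v"
proof -
  have "u \<in> vec.span {v}" "v \<in> vec.span {u}" using assms(1) vec.span_base by blast+
  then obtain a b where ab: "u = a *s v" "v = b *s u"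
    unfolding vec.span_singleton by blast
  then have "a \<noteq> 0" using assms(2) by (metis vec.scale_zero_left vec.scale_zero_right)
  then show ?thesis using ab that by blast
qed

lemma span_singleton_scale:
  fixes v :: "'k::field ^ 4"
  assumes "\<mu> \<noteq> 0"
  shows "vec.span {\<mu> *s v} = vec.span {v}"
proof -
  have "v = inverse \<mu> *s (\<mu> *s v)" using assms by simp
  then have "v \<in> vec.span {\<mu> *s v}" by (metis vec.span_base vec.span_scale singletonI)
  moreover have "\<mu> *s v \<in> vec.span {v}" by (simp add: vec.span_base vec.span_scale)
  ultimately show ?thesis by (simp add: vec.span_eq)
qed

lemma transform_span: "transform A (vec.span {v}) = vec.span {A *v v}"
  unfolding transform_def vec.span_singleton by (auto simp: vec.scale image_iff matrix_vector_mult_scaleR vector_scalar_commute)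

lemma card_4_obtain:
  fixes S :: "nat set"
  assumes "card S = 4"
  obtains i j k l where "S = {i, j, k, l}" "distinct [i, j, k, l]"
proof -
  have "card S = Suc 3" using assms by simp
  then obtain i T where i: "S = insert i T" "i \<notin> T" "card T = 3"
    unfolding card_Suc_eq by blast
  then obtain j k l where "T = {j, k, l}" "j \<noteq> k" "k \<noteq> l" "j \<noteq> l"
    unfolding card_3_iff by blast
  with i that[of i j k l] show ?thesis by auto
qed

lemma extend_to_four:
  fixes i j :: nat
  assumes "r \<ge> 4" "i \<in> {1..r}" "j \<in> {1..r}" "i \<noteq> j"
  obtains k l where "k \<in> {1..r}" "l \<in> {1..r}" "distinct [i, j, k, l]"
proof -
  have "card ({1..r} - {i, j}) = r - 2" using assms by (simp add: card_Diff_subset)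
  then have "2 \<le> card ({1..r} - {i, j})" using assms(1) by simp
  then obtain T where T: "T \<subseteq> {1..r} - {i, j}" "card T = 2"
    by (rule obtain_subset_with_card_n)
  obtain k l where kl: "T = {k, l}" "k \<noteq> l" using T(2) unfolding card_2_iff by blast
  have "k \<in> {1..r} - {i, j}" "l \<in> {1..r} - {i, j}" using T(1) unfolding kl(1) by blast+
  with kl(2) assms(4) show ?thesis by (intro that[of k l]) simp_all
qed

text \<open>Two proportional vectors, or a zero vector, can be completed to four vectors with vanishing
  bracket. So the brackets alone decide whether the points are well-defined, distinct and in general
  position.\<close>

lemma lifts_iff:
  fixes c :: "nat \<Rightarrow> 'k::field ^ 4"
  assumes "r \<ge> 4"
  shows "c \<in> lifts r \<longleftrightarrow> c \<in> affine_space r \<and>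
    (\<forall>i\<in>{1..r}. \<forall>j\<in>{1..r}. \<forall>k\<in>{1..r}. \<forall>l\<in>{1..r}. distinct [i, j, k, l] \<longrightarrow> bracket c i j k l \<noteq> 0)"
    (is "_ \<longleftrightarrow> _ \<and> ?R")
proof -
  let ?p = "\<lambda>i\<in>{1..r}. vec.span {c i}"
  have planes: "(\<forall>S\<subseteq>{1..r}. card S = 4 \<longrightarrow> \<not> (\<exists>H\<in>planes. \<forall>i\<in>S. ?p i \<subseteq> H)) \<longleftrightarrow> ?R"
  proof -
    have mem: "?p i \<subseteq> H \<longleftrightarrow> c i \<in> H" if "H \<in> planes" "i \<in> {1..r}" for H i
    proof -
      have "vec.subspace H" using that(1) by (simp add: planes_def)
      then have "vec.span {c i} \<subseteq> H \<longleftrightarrow> c i \<in> H"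
        using vec.span_minimal[of "{c i}" H] vec.span_base[of "c i" "{c i}"] by blast
      with that(2) show ?thesis by simp
    qed
    have one: "(\<exists>H\<in>planes. \<forall>a\<in>{i, j, k, l}. ?p a \<subseteq> H) \<longleftrightarrow> bracket c i j k l = 0"
      if "i \<in> {1..r}" "j \<in> {1..r}" "k \<in> {1..r}" "l \<in> {1..r}" for i j k l
    proof -
      have "(\<exists>H\<in>planes. \<forall>a\<in>{i, j, k, l}. ?p a \<subseteq> H)
          \<longleftrightarrow> (\<exists>H\<in>planes. c i \<in> H \<and> c j \<in> H \<and> c k \<in> H \<and> c l \<in> H)"
      proof (rule bex_cong[OF HOL.refl])
        fix H :: "('k ^ 4) set" assume H: "H \<in> planes"
        show "(\<forall>a\<in>{i, j, k, l}. ?p a \<subseteq> H) \<longleftrightarrow> (c i \<in> H \<and> c j \<in> H \<and> c k \<in> H \<and> c l \<in> H)"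
          unfolding ball_simps mem[OF H that(1)] mem[OF H that(2)] mem[OF H that(3)]
            mem[OF H that(4)] by blast
      qed
      then show ?thesis unfolding coplanar_iff_det_zero bracket_def .
    qed
    show ?thesis
    proof (intro iffI ballI impI allI)
      fix i j k l
      assume *: "\<forall>S\<subseteq>{1..r}. card S = 4 \<longrightarrow> \<not> (\<exists>H\<in>planes. \<forall>i\<in>S. ?p i \<subseteq> H)"
        and ijkl: "i \<in> {1..r}" "j \<in> {1..r}" "k \<in> {1..r}" "l \<in> {1..r}" "distinct [i, j, k, l]"
      have "card {i, j, k, l} = 4" using ijkl(5) by simp
      moreover have "{i, j, k, l} \<subseteq> {1..r}" using ijkl by simp
      ultimately have "\<not> (\<exists>H\<in>planes. \<forall>a\<in>{i, j, k, l}. ?p a \<subseteq> H)" using * by blast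
      then show "bracket c i j k l \<noteq> 0" using one ijkl by blast
    next
      fix S assume *: ?R and S: "S \<subseteq> {1..r}" "card S = 4"
      obtain i j k l where ijkl: "S = {i, j, k, l}" "distinct [i, j, k, l]"
        using card_4_obtain[OF S(2)] .
      then have mem: "i \<in> {1..r}" "j \<in> {1..r}" "k \<in> {1..r}" "l \<in> {1..r}" using S(1) by blast+
      then have "bracket c i j k l \<noteq> 0" using * ijkl(2) by blast
      then show "\<not> (\<exists>H\<in>planes. \<forall>i\<in>S. ?p i \<subseteq> H)"
        using one[OF mem] unfolding ijkl(1) by blast
    qed
  qed
  have degenerate: "bracket c i j k l = 0" if "c j = a *s c i" for i j k l a
    unfolding bracket_def that by (simp add: det_4 mat4_component algebra_simps)
  have inj: "inj_on ?p {1..r}" if ?R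
  proof (rule inj_onI, rule ccontr)
    fix i j assume ij: "i \<in> {1..r}" "j \<in> {1..r}" "?p i = ?p j" "i \<noteq> j"
    obtain k l where kl: "k \<in> {1..r}" "l \<in> {1..r}" "distinct [i, j, k, l]"
      using extend_to_four[OF assms ij(1,2,4)] .
    have "c j \<in> vec.span {c i}" using ij vec.span_base[of "c j" "{c j}"] by simp
    then obtain a where "c j = a *s c i" unfolding vec.span_singleton by blast
    then have "bracket c i j k l = 0" by (rule degenerate)
    then show False using that ij kl by blast
  qed
  have nz: "c j \<noteq> 0" if R: ?R and j: "j \<in> {1..r}" for j
  proof
    assume "c j = 0"
    define i where "i = (if j = 1 then 2 else 1 :: nat)"
    have i: "i \<in> {1..r}" "i \<noteq> j" using assms by (auto simp: i_def)
    obtain k l where kl: "k \<in> {1..r}" "l \<in> {1..r}" "distinct [i, j, k, l]"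
      using extend_to_four[OF assms i(1) j i(2)] .
    have "bracket c i j k l = 0" using degenerate[of j 0 i] \<open>c j = 0\<close> by simp
    then show False using R j i kl by blast
  qed
  have P3: "?p \<in> {1..r} \<rightarrow>\<^sub>E P3" if "\<forall>i\<in>{1..r}. c i \<noteq> 0"
    using that by (auto simp: P3_def)
  show ?thesis
    unfolding lifts_def lin_indep_tuples_def mem_Collect_eq planes
    using inj nz P3 by blast
qed

lemma lifts_nonzero: "c \<in> lifts r \<Longrightarrow> i \<in> {1..r} \<Longrightarrow> c i \<noteq> 0"
  by (simp add: lifts_def)

lemma lifts_affine: "c \<in> lifts r \<Longrightarrow> c \<in> affine_space r"
  by (simp add: lifts_def)

lemma lifts_bracket:
  assumes "c \<in> lifts r" "r \<ge> 4" "i \<in> {1..r}" "j \<in> {1..r}" "k \<in> {1..r}" "l \<in> {1..r}" "distinct [i, j, k, l]"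
  shows "bracket c i j k l \<noteq> 0"
  using assms lifts_iff by blast

definition proj_equiv :: "nat \<Rightarrow> (nat \<Rightarrow> 'k::field ^ 4) \<Rightarrow> (nat \<Rightarrow> 'k ^ 4) \<Rightarrow> bool" where
  "proj_equiv r c d \<longleftrightarrow>
    (\<exists>A \<mu>. invertible A \<and> (\<forall>i\<in>{1..r}. \<mu> i \<noteq> 0 \<and> d i = \<mu> i *s (A *v c i)))"

lemma proj_class_transform:
  assumes "invertible A"
  shows "proj_class r (\<lambda>i\<in>{1..r}. transform A (p i)) = proj_class r p"
proof -
  have comp: "transform B (transform A L) = transform (B ** A) L" for B L
    by (simp add: transform_def image_image matrix_vector_mul_assoc)
  obtain A' where A': "A ** A' = mat 1" "A' ** A = mat 1"
    using assms by (auto simp: invertible_def)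
  have inv: "invertible A'" using A' by (auto simp: invertible_def)
  show ?thesis
  proof (intro equalityI subsetI)
    fix q assume "q \<in> proj_class r (\<lambda>i\<in>{1..r}. transform A (p i))"
    then obtain B where B: "invertible B"
      "q = (\<lambda>i\<in>{1..r}. transform B ((\<lambda>i\<in>{1..r}. transform A (p i)) i))"
      by (auto simp: proj_class_def)
    then have "q = (\<lambda>i\<in>{1..r}. transform (B ** A) (p i))"
      by (auto simp: comp restrict_def fun_eq_iff)
    then show "q \<in> proj_class r p"
      using invertible_mult[OF B(1) assms] by (auto simp: proj_class_def)
  next
    fix q assume "q \<in> proj_class r p"
    then obtain B where B: "invertible B" "q = (\<lambda>i\<in>{1..r}. transform B (p i))"
      by (auto simp: proj_class_def)
    have "(B ** A') ** A = B" by (simp add: matrix_mul_assoc[symmetric] A')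
    then have "q = (\<lambda>i\<in>{1..r}. transform (B ** A') ((\<lambda>i\<in>{1..r}. transform A (p i)) i))"
      by (auto simp: B(2) comp restrict_def fun_eq_iff)
    then show "q \<in> proj_class r (\<lambda>i\<in>{1..r}. transform A (p i))"
      using invertible_mult[OF B(1) inv] unfolding proj_class_def by blast
  qed
qed

lemma proj_class_cong: "(\<And>i. i \<in> {1..r} \<Longrightarrow> p i = q i) \<Longrightarrow> proj_class r p = proj_class r q"
  unfolding proj_class_def by (metis (no_types, lifting) restrict_ext)

lemma proj_equiv_lift_class:
  assumes "proj_equiv r c d"
  shows "lift_class r c = lift_class r d"
proof -
  obtain A \<mu> where A: "invertible A" "\<And>i. i \<in> {1..r} \<Longrightarrow> \<mu> i \<noteq> 0 \<and> d i = \<mu> i *s (A *v c i)"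
    using assms unfolding proj_equiv_def by blast
  have "lift_class r c = proj_class r (\<lambda>i\<in>{1..r}. transform A ((\<lambda>i\<in>{1..r}. vec.span {c i}) i))"
    unfolding lift_class_def using proj_class_transform[OF A(1)] by metis
  also have "\<dots> = lift_class r d"
    unfolding lift_class_def using A(2)
    by (intro proj_class_cong) (simp add: transform_span span_singleton_scale)
  finally show ?thesis .
qed

lemma lift_class_member: "(\<lambda>i\<in>{1..r}. vec.span {c i}) \<in> lift_class r c"
proof -
  have "transform (mat 1) L = L" for L :: "'a point" by (simp add: transform_def)
  then have "(\<lambda>i\<in>{1..r}. vec.span {c i})
      = (\<lambda>i\<in>{1..r}. transform (mat 1) ((\<lambda>i\<in>{1..r}. vec.span {c i}) i))"
    by (simp add: fun_eq_iff)
  moreover have "invertible (mat 1 :: 'a ^ 4 ^ 4)" by (simp add: invertible_det_nz)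
  ultimately show ?thesis unfolding lift_class_def proj_class_def by blast
qed

lemma invertible_vector_nonzero:
  fixes A :: "'k::field ^ 4 ^ 4"
  assumes "invertible A" "v \<noteq> 0"
  shows "A *v v \<noteq> 0"
  using assms by (metis invertible_def matrix_vector_mul_assoc matrix_vector_mul_lid matrix_vector_mult_0_right)

lemma lift_class_proj_equiv:
  assumes "lift_class r c = lift_class r d" "\<And>i. i \<in> {1..r} \<Longrightarrow> c i \<noteq> 0"
  shows "proj_equiv r c d"
proof -
  have "(\<lambda>i\<in>{1..r}. vec.span {d i}) \<in> lift_class r c"
    using assms(1) lift_class_member by metis
  then obtain A where A: "invertible A"
    "(\<lambda>i\<in>{1..r}. vec.span {d i}) = (\<lambda>i\<in>{1..r}. transform A ((\<lambda>i\<in>{1..r}. vec.span {c i}) i))"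
    unfolding lift_class_def proj_class_def by blast
  have "\<exists>\<mu>. \<mu> \<noteq> 0 \<and> d i = \<mu> *s (A *v c i)" if i: "i \<in> {1..r}" for i
  proof -
    have "vec.span {d i} = vec.span {A *v c i}"
      using fun_cong[OF A(2), of i] i by (simp add: transform_span)
    then show ?thesis
      using span_singleton_eq invertible_vector_nonzero[OF A(1) assms(2)[OF i]] by metis
  qed
  then show ?thesis using A(1) unfolding proj_equiv_def by metis
qed

lemma bracket_transform:
  fixes c :: "nat \<Rightarrow> 'k::field ^ 4"
  assumes "\<And>i. i \<in> {1..r} \<Longrightarrow> d i = \<mu> i *s (A *v c i)"
    and "i \<in> {1..r}" "j \<in> {1..r}" "k \<in> {1..r}" "l \<in> {1..r}"
  shows "bracket d i j k l = \<mu> i * \<mu> j * \<mu> k * \<mu> l * det A * bracket c i j k l"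
  unfolding bracket_def assms(1)[OF assms(2)] assms(1)[OF assms(3)] assms(1)[OF assms(4)]
    assms(1)[OF assms(5)] mat4_scale mat4_matrix_mult[symmetric] det_mul
  by (simp add: mult.assoc)

lemma proj_equiv_sym:
  assumes "proj_equiv r c d"
  shows "proj_equiv r d c"
proof -
  obtain A \<mu> where A: "invertible A" "\<And>i. i \<in> {1..r} \<Longrightarrow> \<mu> i \<noteq> 0 \<and> d i = \<mu> i *s (A *v c i)"
    using assms unfolding proj_equiv_def by blast
  obtain A' where A': "A ** A' = mat 1" "A' ** A = mat 1"
    using A(1) by (auto simp: invertible_def)
  have "c i = inverse (\<mu> i) *s (A' *v d i)" if "i \<in> {1..r}" for i
  proof -
    have d: "d i = \<mu> i *s (A *v c i)" and \<mu>: "\<mu> i \<noteq> 0" using A(2)[OF that] by auto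
    have "A' *v d i = \<mu> i *s ((A' ** A) *v c i)"
      unfolding d vector_scalar_commute[symmetric] matrix_vector_mul_assoc ..
    then show ?thesis using \<mu> by (simp add: A'(2))
  qed
  moreover have "invertible A'" using A' by (auto simp: invertible_def)
  ultimately show ?thesis
    unfolding proj_equiv_def using A(2) by (intro exI[of _ A'] exI[of _ "\<lambda>i. inverse (\<mu> i)"]) simp
qed

lemma proj_equiv_lifts:
  assumes "r \<ge> 4" "proj_equiv r c d" "c \<in> lifts r" "d \<in> affine_space r"
  shows "d \<in> lifts r"
proof -
  obtain A \<mu> where A: "invertible A" "\<And>i. i \<in> {1..r} \<Longrightarrow> \<mu> i \<noteq> 0 \<and> d i = \<mu> i *s (A *v c i)"
    using assms unfolding proj_equiv_def by blast
  have "bracket d i j k l \<noteq> 0"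
    if "i \<in> {1..r}" "j \<in> {1..r}" "k \<in> {1..r}" "l \<in> {1..r}" "distinct [i, j, k, l]" for i j k l
    using bracket_transform[of r d \<mu> A c i j k l] lifts_bracket[OF assms(3,1) that] A that
    by (simp add: invertible_det_nz)
  then show ?thesis using assms(1,4) lifts_iff by blast
qed

lemma U_set_eq: "U_set r = lift_class r ` lifts r"
proof (intro equalityI subsetI)
  fix x :: "'a tuple set" assume "x \<in> U_set r"
  then obtain p where p: "p \<in> lin_indep_tuples r" "x = proj_class r p"
    by (auto simp: U_set_def)
  have pP3: "p \<in> {1..r} \<rightarrow>\<^sub>E P3" using p(1) unfolding lin_indep_tuples_def by blast
  have "\<forall>i\<in>{1..r}. \<exists>v. v \<noteq> 0 \<and> p i = vec.span {v}"
  proof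
    fix i assume "i \<in> {1..r}"
    then have "p i \<in> P3" using pP3 by (rule PiE_mem[rotated])
    then show "\<exists>v. v \<noteq> 0 \<and> p i = vec.span {v}" unfolding P3_def by blast
  qed
  from bchoice[OF this]
  obtain v where v: "\<forall>i\<in>{1..r}. v i \<noteq> 0 \<and> p i = vec.span {v i}" ..
  define c where "c = (\<lambda>i\<in>{1..r}. v i)"
  have pc: "(\<lambda>i\<in>{1..r}. vec.span {c i}) = p"
  proof
    fix i
    show "(\<lambda>i\<in>{1..r}. vec.span {c i}) i = p i"
    proof (cases "i \<in> {1..r}")
      case True
      then show ?thesis using v by (simp add: c_def)
    next
      case False
      then show ?thesis by (simp only: restrict_apply if_False PiE_arb[OF pP3 False])
    qed
  qed
  have "c \<in> affine_space r" by (simp add: c_def affine_space_def)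
  moreover have "\<forall>i\<in>{1..r}. c i \<noteq> 0" using v by (simp add: c_def)
  ultimately have "c \<in> lifts r"
    using p(1) by (simp only: lifts_def mem_Collect_eq pc)
  then show "x \<in> lift_class r ` lifts r"
    using p(2) pc by (auto simp: lift_class_def)
next
  fix x assume "x \<in> lift_class r ` lifts r"
  then show "x \<in> U_set r" by (auto simp: lift_class_def U_set_def lifts_def)
qed

text \<open>General position is a property of the class, as brackets are only multiplied by nonzero factors
  under projective equivalence.\<close>

lemma lift_class_in_U_set_iff:
  assumes "r \<ge> 4" "d \<in> affine_space r"
  shows "lift_class r d \<in> U_set r \<longleftrightarrow> d \<in> lifts r"
proof
  assume "lift_class r d \<in> U_set r"
  then obtain c where c: "c \<in> lifts r" "lift_class r d = lift_class r c" by (auto simp: U_set_eq)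
  then have "proj_equiv r c d" by (intro lift_class_proj_equiv) (auto dest: lifts_nonzero)
  then show "d \<in> lifts r" using proj_equiv_lifts assms c by blast
qed (auto simp: U_set_eq)

lemma poly_fun_bracket:
  assumes "i \<in> {1..r}" "j \<in> {1..r}" "k \<in> {1..r}" "l \<in> {1..r}"
  shows "(\<lambda>c. bracket c i j k l) \<in> poly_fun r"
  unfolding bracket_def det_4 mat4_component
  by (intro poly_fun_diff poly_fun.add poly_fun.mult poly_fun.coord assms)

text \<open>The lifts are the nonvanishing locus of the product of all brackets of distinct points.\<close>

lemma openin_lifts:
  assumes "r \<ge> 4"
  shows "openin (affine_zariski r) (lifts r :: (nat \<Rightarrow> 'k::field ^ 4) set)"
proof -
  define Q where "Q = {q \<in> {1..r} \<times> {1..r} \<times> {1..r} \<times> {1..r}.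
    case q of (i, j, k, l) \<Rightarrow> distinct [i, j, k, l]}"
  define F where "F = (\<lambda>c :: nat \<Rightarrow> 'k ^ 4. \<Prod>q\<in>Q. case q of (i, j, k, l) \<Rightarrow> bracket c i j k l)"
  have fin: "finite Q" by (simp add: Q_def)
  have "F \<in> poly_fun r"
    unfolding F_def
  proof (rule poly_fun_prod)
    fix q assume "q \<in> Q"
    then obtain i j k l where "q = (i, j, k, l)"
      "i \<in> {1..r}" "j \<in> {1..r}" "k \<in> {1..r}" "l \<in> {1..r}" by (cases q) (auto simp: Q_def)
    then show "(\<lambda>c :: nat \<Rightarrow> 'k ^ 4. case q of (i, j, k, l) \<Rightarrow> bracket c i j k l) \<in> poly_fun r"
      using poly_fun_bracket[of i r j k l] by simp
  qed
  moreover have "lifts r = {c \<in> affine_space r. F c \<noteq> 0}"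
  proof (rule Set.set_eqI)
    fix c :: "nat \<Rightarrow> 'k ^ 4"
    have "F c \<noteq> 0 \<longleftrightarrow> (\<forall>q\<in>Q. (case q of (i, j, k, l) \<Rightarrow> bracket c i j k l) \<noteq> 0)"
      unfolding F_def by (simp only: prod_zero_iff[OF fin]) blast
    also have "\<dots> \<longleftrightarrow> (\<forall>i\<in>{1..r}. \<forall>j\<in>{1..r}. \<forall>k\<in>{1..r}. \<forall>l\<in>{1..r}.
        distinct [i, j, k, l] \<longrightarrow> bracket c i j k l \<noteq> 0)"
    proof (intro iffI ballI impI)
      fix i j k l
      assume *: "\<forall>q\<in>Q. (case q of (i, j, k, l) \<Rightarrow> bracket c i j k l) \<noteq> 0"
        and "i \<in> {1..r}" "j \<in> {1..r}" "k \<in> {1..r}" "l \<in> {1..r}" "distinct [i, j, k, l]"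
      then have "(i, j, k, l) \<in> Q" by (simp add: Q_def)
      from bspec[OF * this] show "bracket c i j k l \<noteq> 0" by simp
    next
      fix q
      assume *: "\<forall>i\<in>{1..r}. \<forall>j\<in>{1..r}. \<forall>k\<in>{1..r}. \<forall>l\<in>{1..r}.
        distinct [i, j, k, l] \<longrightarrow> bracket c i j k l \<noteq> 0" and "q \<in> Q"
      then obtain i j k l where "q = (i, j, k, l)" "distinct [i, j, k, l]"
        "i \<in> {1..r}" "j \<in> {1..r}" "k \<in> {1..r}" "l \<in> {1..r}" by (cases q) (auto simp: Q_def)
      with * show "(case q of (i, j, k, l) \<Rightarrow> bracket c i j k l) \<noteq> 0" by simp
    qed
    finally show "c \<in> lifts r \<longleftrightarrow> c \<in> {c \<in> affine_space r. F c \<noteq> 0}"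
      using lifts_iff[OF assms, of c] by blast
  qed
  ultimately show ?thesis using openin_affine_basic[of F r] by (simp only:)
qed

section \<open>The generators acting on lifts\<close>

lemma topspace_U_zariski:
  assumes "r \<ge> 4"
  shows "topspace (U_zariski r) = (U_set r :: 'k::field tuple set set)"
proof -
  have "{c \<in> lifts r. lift_class r c \<in> (U_set r :: 'k tuple set set)} = lifts r"
    by (auto simp: U_set_eq)
  then have "openin (U_zariski r) (U_set r :: 'k tuple set set)"
    using openin_lifts[OF assms] by (simp add: openin_U_zariski)
  then have "U_set r \<subseteq> topspace (U_zariski r :: 'k tuple set topology)" by (rule openin_subset)
  moreover have "topspace (U_zariski r :: 'k tuple set topology) \<subseteq> U_set r"
    using openin_topspace openin_U_zariski by blast
  ultimately show ?thesis by blast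
qed

lemma U_space_simps:
  "zariski (U_space r) = U_zariski r"
  "h \<in> regular (U_space r) V \<longleftrightarrow>
    (\<lambda>c. h (lift_class r c)) \<in> affine_regular r {c \<in> lifts r. lift_class r c \<in> V}"
  by (simp_all add: U_space_def)

lemma local_functions_U_space: "local_functions (U_space r)"
  unfolding local_functions_def U_space_simps
proof (intro allI impI)
  fix V and h h' :: "'a tuple set \<Rightarrow> 'a"
  assume h: "(\<lambda>c. h (lift_class r c)) \<in> affine_regular r {c \<in> lifts r. lift_class r c \<in> V}"
    and "\<forall>x\<in>V. h x = h' x"
  then show "(\<lambda>c. h' (lift_class r c)) \<in> affine_regular r {c \<in> lifts r. lift_class r c \<in> V}"
    by (intro affine_regular_cong[OF h]) simp
qed

text \<open>Irreducibility of \<open>U\<^sub>r\<close>, inherited from affine space.\<close>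

lemma dense_open_U_space:
  fixes V :: "'k::field tuple set set"
  assumes "infinite (UNIV :: 'k set)" "openin (U_zariski r) V" "V \<noteq> {}"
  shows "dense_open (U_space r) V"
proof (rule dense_openI)
  show "openin (zariski (U_space r)) V" using assms(2) by (simp add: U_space_simps)
  fix W :: "'k tuple set set"
  assume "openin (zariski (U_space r)) W" "W \<noteq> {}"
  then have W: "openin (U_zariski r) W" "W \<noteq> {}" by (simp_all add: U_space_simps)
  let ?P = "\<lambda>V :: 'k tuple set set. {c \<in> lifts r. lift_class r c \<in> V}"
  have "openin (affine_zariski r) (?P V)" "openin (affine_zariski r) (?P W)"
    using assms(2) W(1) unfolding openin_U_zariski by auto
  moreover have ne: "?P X \<noteq> {}" if "openin (U_zariski r) X" "X \<noteq> {}" for X :: "'k tuple set set"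
    using that unfolding openin_U_zariski U_set_eq by blast
  ultimately have "?P V \<inter> ?P W \<noteq> {}"
    using affine_opens_meet[OF assms(1) _ _ ne[OF assms(2,3)] ne[OF W]] by blast
  then show "V \<inter> W \<noteq> {}" by blast
qed

lemma dense_open_U_space_openin: "dense_open (U_space r) V \<Longrightarrow> openin (U_zariski r) V"
  by (simp add: dense_open_def U_space_simps)

text \<open>Openness and regularity on \<open>U\<^sub>r\<close> are defined by pulling back to the lifts,
  where the map is given by a polynomial map \<open>\<phi>\<close>.\<close>

lemma rational_map_from_lift:
  fixes F :: "'k::field tuple set \<rightharpoonup> 'k tuple set"
  assumes "infinite (UNIV :: 'k set)" "r \<ge> 4" "polynomial_map r \<phi>"
    and F: "\<And>c. c \<in> lifts r \<Longrightarrow>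
      F (lift_class r c) = (if \<phi> c \<in> lifts r then Some (lift_class r (\<phi> c)) else None)"
    and dom: "dom F \<subseteq> U_set r"
    and "\<exists>c\<in>lifts r. \<phi> c \<in> lifts r"
  shows "rational_map (U_space r) F"
proof -
  let ?P = "\<lambda>V :: 'k tuple set set. {c \<in> lifts r. lift_class r c \<in> V}"
  have preimage: "?P {x \<in> dom F. the (F x) \<in> W} = {c \<in> lifts r. \<phi> c \<in> ?P W}" for W
    using F by (auto simp: dom_def split: if_splits)
  have "?P (dom F) = {c \<in> affine_space r. \<phi> c \<in> lifts r} \<inter> lifts r"
    using F by (auto simp: dom_def lifts_affine split: if_splits)
  then have "openin (affine_zariski r) (?P (dom F))"
    using openin_Int[OF openin_polynomial_preimage[OF assms(3) openin_lifts[OF assms(2)]]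
        openin_lifts[OF assms(2)]] by simp
  then have "openin (U_zariski r) (dom F)" using dom by (simp add: openin_U_zariski)
  moreover have "dom F \<noteq> {}" using assms(6) F by fastforce
  ultimately have 1: "dense_open (U_space r) (dom F)" by (rule dense_open_U_space[OF assms(1)])
  have 2: "ran F \<subseteq> U_set r"
  proof
    fix y assume "y \<in> ran F"
    then obtain x where x: "F x = Some y" by (auto simp: ran_def)
    then have "x \<in> U_set r" using dom by auto
    then obtain c where "c \<in> lifts r" "x = lift_class r c" by (auto simp: U_set_eq)
    then show "y \<in> U_set r" using F[of c] x by (auto simp: U_set_eq split: if_splits)
  qed
  have 3: "openin (U_zariski r) {x \<in> dom F. the (F x) \<in> W}" if W: "openin (U_zariski r) W" for W
  proof -
    have "openin (affine_zariski r) (?P W)" using W by (simp add: openin_U_zariski)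
    from openin_polynomial_preimage[OF assms(3) this]
    have "openin (affine_zariski r) ({c \<in> affine_space r. \<phi> c \<in> ?P W} \<inter> lifts r)"
      using openin_lifts[OF assms(2)] by (rule openin_Int)
    moreover have "{c \<in> affine_space r. \<phi> c \<in> ?P W} \<inter> lifts r = {c \<in> lifts r. \<phi> c \<in> ?P W}"
      using lifts_affine by blast
    ultimately have "openin (affine_zariski r) (?P {x \<in> dom F. the (F x) \<in> W})"
      unfolding preimage by simp
    moreover have "{x \<in> dom F. the (F x) \<in> W} \<subseteq> U_set r" using dom by blast
    ultimately show ?thesis by (simp add: openin_U_zariski)
  qed
  have 4: "(\<lambda>x. h (the (F x))) \<in> regular (U_space r) {x \<in> dom F. the (F x) \<in> W}"
    if h: "h \<in> regular (U_space r) W" for h W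
    unfolding U_space_simps preimage
  proof (rule affine_regular_cong)
    show "(\<lambda>c. h (lift_class r (\<phi> c))) \<in> affine_regular r {c \<in> lifts r. \<phi> c \<in> ?P W}"
      using affine_regular_polynomial_map[OF assms(3) h[unfolded U_space_simps] openin_lifts[OF assms(2)]] .
    fix c assume "c \<in> {c \<in> lifts r. \<phi> c \<in> ?P W}"
    then show "h (lift_class r (\<phi> c)) = h (the (F (lift_class r c)))" using F by simp
  qed
  show ?thesis
    unfolding rational_map_def U_space_simps(1) topspace_U_zariski[OF assms(2)]
    using 1 2 3 4 by blast
qed

lemma involution_birational:
  assumes "rational_map X F" "\<And>x y. F x = Some y \<Longrightarrow> F y = Some x"
  shows "birational_map X F"
proof -
  have "\<forall>x\<in>dom F. (F \<circ>\<^sub>m F) x = Some x"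
  proof
    fix x assume "x \<in> dom F"
    then obtain y where y: "F x = Some y" by auto
    from assms(2)[OF this] y show "(F \<circ>\<^sub>m F) x = Some x" by (simp add: map_comp_def)
  qed
  moreover have "dom F \<subseteq> dom (F \<circ>\<^sub>m F)"
    using calculation by (auto simp: dom_def)
  ultimately have "agree X (F \<circ>\<^sub>m F) (identity_map X)"
    unfolding agree_identity_map using rational_mapD(1)[OF assms(1)] by blast
  then show ?thesis using assms(1) unfolding birational_map_def by blast
qed

subsection \<open>Exchanging two points\<close>

definition swap_lift :: "nat \<Rightarrow> (nat \<Rightarrow> 'a) \<Rightarrow> nat \<Rightarrow> 'a" where
  "swap_lift i c = c(i := c (Suc i), Suc i := c i)"

lemma swap_lift_twice [simp]: "swap_lift i (swap_lift i c) = c"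
  by (auto simp: swap_lift_def)

lemma swap_lift_eq: "swap_lift i c j = c (if j = i then Suc i else if j = Suc i then i else j)"
  by (auto simp: swap_lift_def)

lemma swap_lift_lifts:
  assumes "r \<ge> 4" "1 \<le> i" "i < r" "c \<in> lifts r"
  shows "swap_lift i c \<in> lifts r"
proof -
  define \<sigma> where "\<sigma> j = (if j = i then Suc i else if j = Suc i then i else j)" for j
  have s: "swap_lift i c j = c (\<sigma> j)" for j by (simp add: swap_lift_eq \<sigma>_def)
  have \<sigma>r: "\<sigma> j \<in> {1..r}" if "j \<in> {1..r}" for j using that assms by (auto simp: \<sigma>_def)
  have \<sigma>i: "\<sigma> j = \<sigma> k \<longleftrightarrow> j = k" for j k by (auto simp: \<sigma>_def)
  have "swap_lift i c \<in> affine_space r"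
    using lifts_affine[OF assms(4)] assms(2,3)
    by (auto simp: affine_space_def swap_lift_def PiE_iff extensional_def)
  moreover have "bracket (swap_lift i c) j k l m \<noteq> 0"
    if "j \<in> {1..r}" "k \<in> {1..r}" "l \<in> {1..r}" "m \<in> {1..r}" "distinct [j, k, l, m]" for j k l m
  proof -
    have "bracket (swap_lift i c) j k l m = bracket c (\<sigma> j) (\<sigma> k) (\<sigma> l) (\<sigma> m)"
      by (simp add: bracket_def s)
    then show ?thesis
      using lifts_bracket[OF assms(4,1) \<sigma>r[OF that(1)] \<sigma>r[OF that(2)] \<sigma>r[OF that(3)] \<sigma>r[OF that(4)]]
        that(5) \<sigma>i by simp
  qed
  ultimately show ?thesis using lifts_iff[OF assms(1)] by blast
qed

lemma swap_map_lift:
  assumes "1 \<le> i" "i < r" "c \<in> lifts r"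
  shows "swap_map r i (lift_class r c) = Some (lift_class r (swap_lift i c))"
proof -
  let ?p = "\<lambda>c. \<lambda>j\<in>{1..r}. vec.span {c j}"
  have upd: "swap_lift i (\<lambda>j\<in>{1..r}. transform A (?p c j)) = (\<lambda>j\<in>{1..r}. transform A (?p (swap_lift i c) j))" for A
    using assms(1,2) by (auto simp: swap_lift_eq fun_eq_iff)
  have "(\<lambda>p. swap_lift i p) ` lift_class r c = lift_class r (swap_lift i c)"
    unfolding lift_class_def proj_class_def using upd by (force simp: image_iff)
  moreover have "lift_class r c \<in> U_set r" using assms(3) by (simp add: U_set_eq)
  ultimately show ?thesis by (simp add: swap_map_def swap_lift_def)
qed

lemma polynomial_map_swap_lift:
  assumes "1 \<le> i" "i < r"
  shows "polynomial_map r (swap_lift i)"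
  unfolding polynomial_map_def
proof (intro conjI ballI allI)
  fix c :: "nat \<Rightarrow> 'a ^ 4" assume "c \<in> affine_space r"
  then show "swap_lift i c \<in> affine_space r"
    using assms by (auto simp: affine_space_def swap_lift_def PiE_iff extensional_def)
next
  fix j k assume "j \<in> {1..r}"
  then show "(\<lambda>c. swap_lift i c j $ k) \<in> poly_fun r"
    unfolding swap_lift_eq using assms by (intro poly_fun.coord) auto
qed

subsection \<open>The Cremona transformation\<close>

definition frame :: "(nat \<Rightarrow> 'k::field ^ 4) \<Rightarrow> 'k ^ 4 ^ 4" where
  "frame c = mat4 (c 1) (c 2) (c 3) (c 4)"

text \<open>Cramer's rule: up to the common factor \<open>det (frame c)\<close>, these are the coordinates of
  the \<open>m\<close>-th vector with respect to the first four. Avoiding the division keeps them polynomial in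
  \<open>c\<close>.\<close>

definition coords :: "(nat \<Rightarrow> 'k::field ^ 4) \<Rightarrow> nat \<Rightarrow> 'k ^ 4" where
  "coords c m = (\<chi> k. if k = 1 then bracket c m 2 3 4 else if k = 2 then bracket c 1 m 3 4
    else if k = 3 then bracket c 1 2 m 4 else bracket c 1 2 3 m)"

lemma coords_component:
  "coords c m $ 1 = bracket c m 2 3 4" "coords c m $ 2 = bracket c 1 m 3 4"
  "coords c m $ 3 = bracket c 1 2 m 4" "coords c m $ 4 = bracket c 1 2 3 m"
  by (simp_all add: coords_def)

lemma le_4_cases:
  fixes i :: nat
  assumes "1 \<le> i" "i \<le> 4"
  obtains "i = 1" | "i = 2" | "i = 3" | "i = 4"
  using assms by linarith

lemma frame_coords:
  assumes "det (frame c) \<noteq> 0"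
  shows "frame c *v coords c m = det (frame c) *s c m"
proof -
  have "(\<chi> i j. if j = 1 then c m $ i else frame c $ i $ j) = mat4 (c m) (c 2) (c 3) (c 4)"
    "(\<chi> i j. if j = 2 then c m $ i else frame c $ i $ j) = mat4 (c 1) (c m) (c 3) (c 4)"
    "(\<chi> i j. if j = 3 then c m $ i else frame c $ i $ j) = mat4 (c 1) (c 2) (c m) (c 4)"
    "(\<chi> i j. if j = 4 then c m $ i else frame c $ i $ j) = mat4 (c 1) (c 2) (c 3) (c m)"
    by (simp_all add: vec_eq_iff forall_4 frame_def mat4_component)
  then have "\<forall>k. coords c m $ k = det (\<chi> i j. if j = k then c m $ i else frame c $ i $ j)"
    unfolding forall_4 coords_component bracket_def by simp
  then have "coords c m = (\<chi> k. det (\<chi> i j. if j = k then c m $ i else frame c $ i $ j))"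
    by (simp add: vec_eq_iff)
  then have "coords c m = det (frame c) *s (\<chi> k. det (\<chi> i j. if j = k then c m $ i else frame c $ i $ j) / det (frame c))"
    using assms by (simp add: vec_eq_iff)
  then show ?thesis
    using cramer[OF assms, of _ "c m"] by (simp add: vector_scalar_commute)
qed

lemma frame_axis:
  assumes "1 \<le> i" "i \<le> 4"
  shows "frame c *v axis (of_nat i) 1 = c i"
  using assms
  by (cases i rule: le_4_cases)
    (simp_all add: frame_def mat4_vector_mult axis_def vec_eq_iff)

lemma lifts_frame:
  assumes "c \<in> lifts r" "r \<ge> 4"
  shows "det (frame c) \<noteq> 0"
  using lifts_bracket[OF assms, of 1 2 3 4] assms(2) by (simp add: frame_def bracket_def)

lemma lifts_coords_nonzero:
  assumes "c \<in> lifts r" "m \<in> {5..r}"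
  shows "coords c m $ k \<noteq> 0"
proof -
  have r: "r \<ge> 4" using assms(2) by simp
  have "bracket c m 2 3 4 \<noteq> 0" "bracket c 1 m 3 4 \<noteq> 0" "bracket c 1 2 m 4 \<noteq> 0" "bracket c 1 2 3 m \<noteq> 0"
    using assms(2) by (intro lifts_bracket[OF assms(1) r]; simp)+
  then show ?thesis using exhaust_4[of k] by (auto simp: coords_component)
qed

definition diagonal :: "(4 \<Rightarrow> 'k::field) \<Rightarrow> 'k ^ 4 ^ 4" where
  "diagonal \<nu> = (\<chi> i j. if i = j then \<nu> i else 0)"

lemma diagonal_mult: "diagonal \<nu> *v y = (\<chi> k. \<nu> k * y $ k)"
  by (simp add: vec_eq_iff matrix_vector_mult_def diagonal_def if_distrib[of "\<lambda>x. x * _"] cong: if_cong)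

lemma invertible_diagonal: "(\<And>k. \<nu> k \<noteq> 0) \<Longrightarrow> invertible (diagonal \<nu>)"
  unfolding invertible_det_nz by (subst det_diagonal) (auto simp: diagonal_def)

text \<open>The image configuration in the coordinates of the first four points. The inverses of the
  coordinates are multiplied by the product of all coordinates, which gives a polynomial map.\<close>

definition cremona_lift :: "nat \<Rightarrow> (nat \<Rightarrow> 'k::field ^ 4) \<Rightarrow> nat \<Rightarrow> 'k ^ 4" where
  "cremona_lift r c = (\<lambda>i\<in>{1..r}. if i \<le> 4 then axis (of_nat i) 1
    else (\<chi> k. \<Prod>j\<in>UNIV - {k}. coords c i $ j))"

lemma cremona_lift_affine: "cremona_lift r c \<in> affine_space r"
  by (simp add: cremona_lift_def affine_space_def)

lemma cremona_lift_eq: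
  "1 \<le> i \<Longrightarrow> i \<le> 4 \<Longrightarrow> i \<le> r \<Longrightarrow> cremona_lift r c i = axis (of_nat i) 1"
  "m \<in> {5..r} \<Longrightarrow> cremona_lift r c m = (\<chi> k. \<Prod>j\<in>UNIV - {k}. coords c m $ j)"
  by (simp_all add: cremona_lift_def)

lemma poly_fun_coords:
  assumes "m \<in> {1..r}" "r \<ge> 4"
  shows "(\<lambda>c. coords c m $ k) \<in> poly_fun r"
proof -
  have *: "1 \<in> {1..r}" "2 \<in> {1..r}" "3 \<in> {1..r}" "4 \<in> {1..r}" using assms(2) by auto
  note poly_fun_bracket[OF assms(1) *(2,3,4)] poly_fun_bracket[OF *(1) assms(1) *(3,4)]
    poly_fun_bracket[OF *(1,2) assms(1) *(4)] poly_fun_bracket[OF *(1,2,3) assms(1)]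
  then show ?thesis using exhaust_4[of k] by (elim disjE) (simp_all only: coords_component)
qed

lemma polynomial_map_cremona_lift:
  assumes "r \<ge> 4"
  shows "polynomial_map r (cremona_lift r :: (nat \<Rightarrow> 'k::field ^ 4) \<Rightarrow> _)"
  unfolding polynomial_map_def
proof (intro conjI ballI allI)
  fix i and k :: 4 assume i: "i \<in> {1..r}"
  show "(\<lambda>c :: nat \<Rightarrow> 'k ^ 4. cremona_lift r c i $ k) \<in> poly_fun r"
  proof (cases "i \<le> 4")
    case True
    then show ?thesis using i by (simp add: cremona_lift_def poly_fun.const)
  next
    case False
    then have "(\<lambda>c :: nat \<Rightarrow> 'k ^ 4. cremona_lift r c i $ k) = (\<lambda>c. \<Prod>j\<in>UNIV - {k}. coords c i $ j)"
      using i by (simp add: cremona_lift_def)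
    then show ?thesis
      using poly_fun_prod[of "UNIV - {k}" "\<lambda>j c. coords c i $ j", OF poly_fun_coords[OF i assms]]
      by (simp only:)
  qed
qed (rule cremona_lift_affine)

lemma standard_cremona_span:
  assumes "\<And>k. v $ k \<noteq> 0"
  shows "standard_cremona (vec.span {v}) = vec.span {\<chi> k. inverse (v $ k)}"
proof (intro equalityI subsetI)
  fix x assume "x \<in> standard_cremona (vec.span {v})"
  then obtain a where "x = (\<chi> k. inverse ((a *s v) $ k))"
    unfolding standard_cremona_def vec.span_singleton by blast
  then have "x = inverse a *s (\<chi> k. inverse (v $ k))" by (simp add: vec_eq_iff)
  then show "x \<in> vec.span {\<chi> k. inverse (v $ k)}" unfolding vec.span_singleton by blast
next
  fix x assume "x \<in> vec.span {\<chi> k. inverse (v $ k)}"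
  then obtain a where "x = a *s (\<chi> k. inverse (v $ k))"
    unfolding vec.span_singleton by blast
  then have "x = (\<chi> k. inverse ((inverse a *s v) $ k))" by (simp add: vec_eq_iff)
  then show "x \<in> standard_cremona (vec.span {v})"
    unfolding standard_cremona_def vec.span_singleton by blast
qed

lemma prod_remove_coord:
  fixes x :: "'k::field ^ 4"
  assumes "x $ k \<noteq> 0"
  shows "(\<Prod>j\<in>UNIV - {k}. x $ j) = (\<Prod>j\<in>UNIV. x $ j) * inverse (x $ k)"
  using assms by (simp add: prod.remove[of UNIV k])

lemma matrix_inv_mult:
  assumes "invertible A"
  shows "A ** matrix_inv A = mat 1" "matrix_inv A ** A = mat 1"
proof -
  have "\<exists>A'. A ** A' = mat 1 \<and> A' ** A = mat 1" using assms by (simp add: invertible_def)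
  from someI_ex[OF this] show "A ** matrix_inv A = mat 1" "matrix_inv A ** A = mat 1"
    unfolding matrix_inv_def by blast+
qed

text \<open>Let \<open>A\<close> send the first four points to the coordinate points, and let \<open>p\<close>
  be the transform by \<open>B\<close> of the points spanned by \<open>c\<close>. Then \<open>A B\<close> maps
  the \<open>i\<close>-th vector to a multiple \<open>\<nu>\<^sub>i\<close> of the \<open>i\<close>-th
  coordinate vector. So the coordinates seen by the standard Cremona transformation are \<open>\<nu>\<^sub>k
  x\<^sub>k\<close> with \<open>x = coords c m\<close>, and the inverses \<open>\<nu>\<^sub>k\<^sup>-\<^sup>1
  x\<^sub>k\<^sup>-\<^sup>1\<close> differ from those of \<open>cremona_lift\<close> by a diagonal matrix and
  rescalings.\<close>

lemma cremona_tuple_class: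
  fixes c :: "nat \<Rightarrow> 'k::field ^ 4"
  assumes c: "c \<in> lifts r" and r: "r \<ge> 4"
    and p: "p \<in> lift_class r c" and A: "sends_to_coordinate_points A p"
  shows "proj_class r (cremona_tuple r A p) = lift_class r (cremona_lift r c)"
proof -
  obtain B where B: "invertible B" and pB: "p = (\<lambda>i\<in>{1..r}. transform B ((\<lambda>i\<in>{1..r}. vec.span {c i}) i))"
    using p unfolding lift_class_def proj_class_def by blast
  have p_eq: "p i = vec.span {B *v c i}" if "i \<in> {1..r}" for i
    using that by (simp add: pB transform_span)
  have A_inv: "invertible A" using A by (simp add: sends_to_coordinate_points_def)
  have A1: "matrix_inv A ** A = mat 1" "A ** matrix_inv A = mat 1"
    using A_inv by (simp_all add: matrix_inv_mult)
  have A': "matrix_inv A *v (A *v v) = v" for v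
    by (simp add: matrix_vector_mul_assoc A1)
  have A'_inv: "invertible (matrix_inv A)" using A1 by (auto simp: invertible_def)
  have "\<exists>\<mu>. \<mu> \<noteq> 0 \<and> A *v (B *v c i) = \<mu> *s axis (of_nat i) 1" if i: "1 \<le> i" "i \<le> 4" for i
  proof -
    have "vec.span {A *v (B *v c i)} = vec.span {axis (of_nat i) 1}"
    proof -
      have "transform A (p i) = vec.span {axis (of_nat i) 1}"
        using A i unfolding sends_to_coordinate_points_def by simp
      moreover have "p i = vec.span {B *v c i}" using i r by (intro p_eq) simp
      ultimately show ?thesis by (simp add: transform_span)
    qed
    then show ?thesis
      by (rule span_singleton_eq) (auto simp: axis_eq_0_iff)
  qed
  then obtain \<mu> where \<mu>: "\<And>i. 1 \<le> i \<Longrightarrow> i \<le> 4 \<Longrightarrow> \<mu> i \<noteq> 0 \<and> A *v (B *v c i) = \<mu> i *s axis (of_nat i) 1"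
    by metis
  define \<nu> :: "4 \<Rightarrow> 'k" where "\<nu> k = (if k = 1 then \<mu> 1 else if k = 2 then \<mu> 2 else if k = 3 then \<mu> 3 else \<mu> 4)" for k
  have \<nu>_nz: "\<nu> k \<noteq> 0" for k using \<mu>[of 1] \<mu>[of 2] \<mu>[of 3] \<mu>[of 4] by (simp add: \<nu>_def)
  have \<mu>_\<nu>: "\<mu> i = \<nu> (of_nat i)" if "1 \<le> i" "i \<le> 4" for i
    using that by (cases i rule: le_4_cases) (simp_all add: \<nu>_def)
  have Mframe: "A *v (B *v (frame c *v y)) = (\<chi> k. \<nu> k * y $ k)" for y
  proof -
    have "A *v (B *v (frame c *v y)) = y $ 1 *s (A *v (B *v c 1)) + y $ 2 *s (A *v (B *v c 2))
        + y $ 3 *s (A *v (B *v c 3)) + y $ 4 *s (A *v (B *v c 4))"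
      by (simp add: frame_def mat4_vector_mult matrix_vector_right_distrib vector_scalar_commute)
    also have "\<dots> = (\<chi> k. \<nu> k * y $ k)"
      using \<mu>[of 1] \<mu>[of 2] \<mu>[of 3] \<mu>[of 4]
      by (simp add: vec_eq_iff forall_4 axis_def \<nu>_def mult.commute)
    finally show ?thesis .
  qed
  define w where "w m = (\<chi> k. inverse (\<nu> k) * inverse (coords c m $ k))" for m
  have cr: "centered_cremona A (p m) = vec.span {matrix_inv A *v w m}" if m: "m \<in> {5..r}" for m
  proof -
    have nz: "coords c m $ k \<noteq> 0" for k using lifts_coords_nonzero[OF c m] .
    have "det (frame c) *s (A *v (B *v c m)) = (\<chi> k. \<nu> k * coords c m $ k)"
      using Mframe[of "coords c m"] frame_coords[OF lifts_frame[OF c r], of m]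
      by (simp add: vector_scalar_commute)
    then have "vec.span {A *v (B *v c m)} = vec.span {\<chi> k. \<nu> k * coords c m $ k}"
      using span_singleton_scale[OF lifts_frame[OF c r]] by metis
    then have "transform A (p m) = vec.span {\<chi> k. \<nu> k * coords c m $ k}"
      using p_eq[of m] m by (simp add: transform_span)
    moreover have "standard_cremona (vec.span {\<chi> k. \<nu> k * coords c m $ k}) = vec.span {w m}"
      using \<nu>_nz nz by (subst standard_cremona_span) (simp_all add: w_def)
    ultimately show ?thesis by (simp add: centered_cremona_def transform_span)
  qed
  define e where "e i = (if i \<le> 4 then B *v c i else matrix_inv A *v w i)" for i
  have "proj_class r (cremona_tuple r A p) = lift_class r e"
    unfolding lift_class_def
  proof (rule proj_class_cong)
    fix i assume i: "i \<in> {1..r}"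
    show "cremona_tuple r A p i = (\<lambda>i\<in>{1..r}. vec.span {e i}) i"
    proof (cases "i \<le> 4")
      case True
      then show ?thesis using i p_eq[OF i] by (simp add: cremona_tuple_def e_def)
    next
      case False
      then show ?thesis using i cr[of i] by (simp add: cremona_tuple_def e_def)
    qed
  qed
  also have "proj_equiv r (cremona_lift r c) e"
    unfolding proj_equiv_def
  proof (intro exI conjI ballI)
    let ?D = "diagonal (\<lambda>k. inverse (\<nu> k))"
    show "invertible (matrix_inv A ** ?D)"
      using A'_inv \<nu>_nz by (intro invertible_mult invertible_diagonal) auto
    \<comment> \<open>One factor \<open>\<nu>\<^sub>i\<close> comes from the matrix, one from \<open>B c\<^sub>i = \<nu>\<^sub>i A\<^sup>-\<^sup>1 e\<^sub>i\<close>.\<close>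
    let ?s = "\<lambda>i. if i \<le> 4 then \<nu> (of_nat i) * \<nu> (of_nat i) else inverse (\<Prod>j\<in>UNIV. coords c i $ j)"
    fix i assume i: "i \<in> {1..r}"
    show "?s i \<noteq> 0" using i lifts_coords_nonzero[OF c, of i] \<nu>_nz by simp
    show "e i = ?s i *s ((matrix_inv A ** ?D) *v cremona_lift r c i)"
    proof (cases "i \<le> 4")
      case True
      have "?D *v axis (of_nat i) 1 = inverse (\<nu> (of_nat i)) *s axis (of_nat i) 1"
        by (simp add: diagonal_mult vec_eq_iff axis_def)
      moreover have "A *v (B *v c i) = \<nu> (of_nat i) *s axis (of_nat i) 1"
        using \<mu>[of i] \<mu>_\<nu>[of i] True i by simp
      then have "B *v c i = \<nu> (of_nat i) *s (matrix_inv A *v axis (of_nat i) 1)"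
        using A'[of "B *v c i"] by (simp add: vector_scalar_commute)
      ultimately show ?thesis
        using True i \<nu>_nz[of "of_nat i"]
        by (simp add: e_def cremona_lift_eq matrix_vector_mul_assoc[symmetric] vector_scalar_commute)
    next
      case False
      then have m: "i \<in> {5..r}" using i by simp
      have nz: "coords c i $ k \<noteq> 0" for k using lifts_coords_nonzero[OF c m] .
      have "?D *v cremona_lift r c i = (\<Prod>j\<in>UNIV. coords c i $ j) *s w i"
        unfolding cremona_lift_eq(2)[OF m] diagonal_mult w_def
        by (simp add: vec_eq_iff prod_remove_coord[OF nz] mult.commute mult.left_commute)
      then show ?thesis
        using False nz by (simp add: e_def matrix_vector_mul_assoc[symmetric] vector_scalar_commute)
    qed
  qed
  then have "lift_class r e = lift_class r (cremona_lift r c)"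
    using proj_equiv_lift_class by metis
  finally show ?thesis .
qed

lemma cremona_map_lift:
  fixes c :: "nat \<Rightarrow> 'k::field ^ 4"
  assumes c: "c \<in> lifts r" and r: "r \<ge> 4"
  shows "cremona_map r (lift_class r c) =
    (if cremona_lift r c \<in> lifts r then Some (lift_class r (cremona_lift r c)) else None)"
proof -
  let ?S = "{proj_class r (cremona_tuple r A p) | A p.
    p \<in> lift_class r c \<and> sends_to_coordinate_points A p}"
  let ?A = "matrix_inv (frame c)" and ?p = "\<lambda>i\<in>{1..r}. vec.span {c i}"
  have inv: "invertible (frame c)" using lifts_frame[OF c r] by (simp add: invertible_det_nz)
  have inv': "?A ** frame c = mat 1" "frame c ** ?A = mat 1" 
    using inv by (simp_all add: matrix_inv_mult)
  have "?A *v c i = axis (of_nat i) 1" if "1 \<le> i" "i \<le> 4" for i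
    using frame_axis[OF that, of c, symmetric] by (simp add: matrix_vector_mul_assoc inv')
  moreover have "invertible ?A" using inv' by (auto simp: invertible_def)
  ultimately have "sends_to_coordinate_points ?A ?p"
    using r by (auto simp: sends_to_coordinate_points_def transform_span)
  then have "?S = {lift_class r (cremona_lift r c)}"
    using cremona_tuple_class[OF c r] lift_class_member[of c r] by blast
  then show ?thesis
    using c lift_class_in_U_set_iff[OF r cremona_lift_affine, of c]
    by (simp add: cremona_map_def U_set_eq)
qed

text \<open>For lifts in general position this says that the Cremona transformation maps the class of
  \<open>c\<close> to that of \<open>d\<close>: the coordinates of each point \<open>m \<ge> 5\<close> are
  inverse to each other, up to the choice of the frame vectors (\<open>\<nu>\<close>) and of the vector spanning
  the \<open>m\<close>-th point (\<open>\<mu>\<close>). In this form the relation is visibly symmetric.\<close>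

definition cremona_related :: "nat \<Rightarrow> (nat \<Rightarrow> 'k::field ^ 4) \<Rightarrow> (nat \<Rightarrow> 'k ^ 4) \<Rightarrow> bool" where
  "cremona_related r c d \<longleftrightarrow> (\<exists>\<nu> \<mu>. (\<forall>k. \<nu> k \<noteq> 0) \<and>
    (\<forall>m\<in>{5..r}. \<forall>k. coords c m $ k * coords d m $ k = \<nu> k * \<mu> m))"

lemma cremona_related_sym: "cremona_related r c d \<Longrightarrow> cremona_related r d c"
  unfolding cremona_related_def by (simp add: mult.commute)

lemma cremona_related_imp_map:
  fixes c :: "nat \<Rightarrow> 'k::field ^ 4"
  assumes c: "c \<in> lifts r" and d: "d \<in> lifts r" and r: "r \<ge> 4" and rel: "cremona_related r c d"
  shows "cremona_map r (lift_class r c) = Some (lift_class r d)"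
proof -
  obtain \<nu> \<mu> where \<nu>: "\<And>k. \<nu> k \<noteq> 0"
    and \<nu>\<mu>: "\<And>m k. m \<in> {5..r} \<Longrightarrow> coords c m $ k * coords d m $ k = \<nu> k * \<mu> m"
    using rel unfolding cremona_related_def by blast
  note fd = lifts_frame[OF d r]
  have equiv: "proj_equiv r (cremona_lift r c) d"
    unfolding proj_equiv_def
  proof (intro exI conjI ballI)
    let ?P = "\<lambda>i. \<Prod>j\<in>UNIV. coords c i $ j"
    let ?s = "\<lambda>i. if i \<le> 4 then inverse (\<nu> (of_nat i)) else \<mu> i * inverse (?P i * det (frame d))"
    show "invertible (frame d ** diagonal \<nu>)"
      using fd \<nu> by (intro invertible_mult invertible_diagonal) (auto simp: invertible_det_nz)
    fix i assume i: "i \<in> {1..r}"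
    show "?s i \<noteq> 0 "
    proof (cases "i \<le> 4")
      case False
      then have m: "i \<in> {5..r}" using i by simp
      have "\<mu> i \<noteq> 0"
        using \<nu>\<mu>[OF m, of 1] lifts_coords_nonzero[OF c m] lifts_coords_nonzero[OF d m] by fastforce
      then show ?thesis using False fd lifts_coords_nonzero[OF c m] by simp
    qed (use \<nu> in simp)
    show "d i = ?s i *s ((frame d ** diagonal \<nu>) *v cremona_lift r c i)"
    proof (cases "i \<le> 4")
      case True
      have "diagonal \<nu> *v axis (of_nat i) 1 = \<nu> (of_nat i) *s axis (of_nat i) 1"
        by (simp add: diagonal_mult vec_eq_iff axis_def)
      then show ?thesis
        using True i \<nu>[of "of_nat i"] frame_axis[of i d]
        by (simp add: cremona_lift_eq matrix_vector_mul_assoc[symmetric] vector_scalar_commute)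
    next
      case False
      then have m: "i \<in> {5..r}" using i by simp
      have nz: "coords c i $ k \<noteq> 0" "coords d i $ k \<noteq> 0" for k
        using lifts_coords_nonzero[OF c m] lifts_coords_nonzero[OF d m] by blast+
      have \<mu>: "\<mu> i \<noteq> 0" using \<nu>\<mu>[OF m, of 1] nz by fastforce
      have "diagonal \<nu> *v cremona_lift r c i = (?P i * inverse (\<mu> i)) *s coords d i"
        unfolding cremona_lift_eq(2)[OF m] diagonal_mult vec_eq_iff
      proof
        fix k
        have "\<nu> k * inverse (coords c i $ k) = inverse (\<mu> i) * coords d i $ k"
          using \<nu>\<mu>[OF m, of k] nz(1)[of k] \<mu> by (simp add: field_simps)
        then show "(\<chi> k. \<nu> k * (\<chi> k. \<Prod>j\<in>UNIV - {k}. coords c i $ j) $ k) $ k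
            = ((?P i * inverse (\<mu> i)) *s coords d i) $ k"
          by (simp add: prod_remove_coord[OF nz(1)] mult.assoc mult.left_commute)
      qed
      then have "(frame d ** diagonal \<nu>) *v cremona_lift r c i
          = (?P i * inverse (\<mu> i) * det (frame d)) *s d i"
        by (simp add: matrix_vector_mul_assoc[symmetric] vector_scalar_commute frame_coords[OF fd])
      moreover have "(\<mu> i * inverse (?P i * det (frame d))) * (?P i * inverse (\<mu> i) * det (frame d)) = 1"
      proof -
        have "?P i \<noteq> 0" using nz(1) by simp
        then show ?thesis using \<mu> fd by (simp add: field_simps)
      qed
      ultimately show ?thesis using False by (simp only: if_False vec.scale_scale) simp
    qed
  qed
  then have "cremona_lift r c \<in> lifts r"
    using proj_equiv_lifts[OF r proj_equiv_sym[OF equiv] d cremona_lift_affine] by blast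
  then show ?thesis
    using cremona_map_lift[OF c r] proj_equiv_lift_class[OF equiv] by simp
qed

lemma cremona_map_imp_related:
  fixes c :: "nat \<Rightarrow> 'k::field ^ 4"
  assumes c: "c \<in> lifts r" and r: "r \<ge> 4" and y: "cremona_map r (lift_class r c) = Some y"
  obtains d where "d \<in> lifts r" "y = lift_class r d" "cremona_related r c d"
proof (rule that)
  let ?d = "cremona_lift r c"
  show "?d \<in> lifts r" "y = lift_class r ?d"
    using y cremona_map_lift[OF c r] by (auto split: if_splits)
  have "coords ?d m = ?d m" for m
    using r by (simp add: vec_eq_iff forall_4 coords_component bracket_def det_4 mat4_component
        cremona_lift_eq(1) axis_def)
  then have "coords c m $ k * coords ?d m $ k = 1 * (\<Prod>j\<in>UNIV. coords c m $ j)"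
    if "m \<in> {5..r}" for m k
    using that by (simp add: cremona_lift_eq(2) prod.remove[of UNIV k])
  then show "cremona_related r c ?d"
    unfolding cremona_related_def by (intro exI[of _ "\<lambda>_. 1"] exI conjI ballI allI) simp_all
qed

lemma cremona_map_involution:
  assumes "r \<ge> 4" "cremona_map r x = Some y"
  shows "cremona_map r y = Some x"
proof -
  have "x \<in> U_set r" using assms(2) by (auto simp: cremona_map_def Let_def split: if_splits)
  then obtain c where c: "c \<in> lifts r" "x = lift_class r c" by (auto simp: U_set_eq)
  obtain d where d: "d \<in> lifts r" "y = lift_class r d" "cremona_related r c d"
    using cremona_map_imp_related[OF c(1) assms(1)] assms(2) c(2) by metis
  then show ?thesis
    using cremona_related_imp_map[OF d(1) c(1) assms(1) cremona_related_sym] c(2) by simp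
qed

section \<open>Configurations on nodal quartic curves\<close>

definition nodal_point :: "'k::field \<Rightarrow> 'k \<Rightarrow> 'k ^ 4" where
  "nodal_point l z = (\<chi> k. if k = 1 then z else if k = 2 then z ^ 2 else if k = 3 then z ^ 3
    else 1 + l * z ^ 4)"

definition nodal :: "nat \<Rightarrow> (nat \<Rightarrow> 'k::field) \<Rightarrow> nat \<Rightarrow> 'k ^ 4" where
  "nodal r X = (\<lambda>i\<in>{1..r}. nodal_point (X 0) (X i))"

definition nodal_bracket :: "'k::field \<Rightarrow> 'k \<Rightarrow> 'k \<Rightarrow> 'k \<Rightarrow> 'k \<Rightarrow> 'k" where
  "nodal_bracket l p q s t =
    (q - p) * (s - p) * (t - p) * (s - q) * (t - q) * (t - s) * (l * p * q * s * t - 1)"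

text \<open>The curve is embedded by the polynomials \<open>f\<close> of degree at most \<open>4\<close> whose
  coefficients of \<open>1\<close> and \<open>z\<^sup>4\<close> are related by \<open>a\<^sub>4 = \<lambda>
  a\<^sub>0\<close>, so that \<open>0\<close> and \<open>\<infinity>\<close> are glued to a node. A plane meets
  it in four parameters with product \<open>a\<^sub>0 / a\<^sub>4 = 1 / \<lambda>\<close>. This explains the
  last factor; the other factors form the Vandermonde determinant.\<close>

lemma det_nodal_points:
  "det (mat4 (nodal_point l p) (nodal_point l q) (nodal_point l s) (nodal_point l t))
    = nodal_bracket l p q s t"
  by (simp add: det_4 mat4_component nodal_point_def nodal_bracket_def) algebra

lemma bracket_nodal:
  assumes "i \<in> {1..r}" "j \<in> {1..r}" "k \<in> {1..r}" "l \<in> {1..r}"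
  shows "bracket (nodal r X) i j k l = nodal_bracket (X 0) (X i) (X j) (X k) (X l)"
  using assms by (simp add: bracket_def nodal_def det_nodal_points)

definition difference_root :: "nat \<Rightarrow> nat \<Rightarrow> nat \<Rightarrow> int" where
  "difference_root i j = (\<lambda>m. (if m = i then 1 else 0) - (if m = j then 1 else 0))"

definition plane_root :: "nat \<Rightarrow> nat \<Rightarrow> nat \<Rightarrow> nat \<Rightarrow> nat \<Rightarrow> int" where
  "plane_root i j k l = (\<lambda>m. if m \<in> {0, i, j, k, l} then 1 else 0)"

text \<open>The characters that take the value \<open>1\<close> when two points of the nodal configuration
  collide, or when four of them become coplanar.\<close>

definition degeneracy_roots :: "nat \<Rightarrow> (nat \<Rightarrow> int) set" where
  "degeneracy_roots r = {difference_root i j | i j. i \<in> {1..r} \<and> j \<in> {1..r} \<and> i \<noteq> j}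
    \<union> {plane_root i j k l | i j k l. i \<in> {1..r} \<and> j \<in> {1..r} \<and> k \<in> {1..r} \<and> l \<in> {1..r}
        \<and> distinct [i, j, k, l]}"

definition torus :: "(nat \<Rightarrow> 'k::field) set" where
  "torus = {X. \<forall>i. X i \<noteq> 0}"

definition character :: "nat \<Rightarrow> (nat \<Rightarrow> int) \<Rightarrow> (nat \<Rightarrow> 'k::field) \<Rightarrow> 'k" where
  "character r n X = (\<Prod>i = 0..r. X i powi n i)"

lemma finite_degeneracy_roots: "finite (degeneracy_roots r)"
proof -
  have "degeneracy_roots r \<subseteq> (\<lambda>(i, j). difference_root i j) ` ({1..r} \<times> {1..r})
      \<union> (\<lambda>(i, j, k, l). plane_root i j k l) ` ({1..r} \<times> {1..r} \<times> {1..r} \<times> {1..r})"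
  proof
    fix n assume "n \<in> degeneracy_roots r"
    then show "n \<in> (\<lambda>(i, j). difference_root i j) ` ({1..r} \<times> {1..r})
      \<union> (\<lambda>(i, j, k, l). plane_root i j k l) ` ({1..r} \<times> {1..r} \<times> {1..r} \<times> {1..r})"
      unfolding degeneracy_roots_def
    proof (elim UnE CollectE exE conjE)
      fix i j assume "n = difference_root i j" "i \<in> {1..r}" "j \<in> {1..r}"
      then show ?thesis by (intro UnI1 image_eqI[of _ _ "(i, j)"]) simp_all
    next
      fix i j k l
      assume "n = plane_root i j k l" "i \<in> {1..r}" "j \<in> {1..r}" "k \<in> {1..r}" "l \<in> {1..r}"
      then show ?thesis by (intro UnI2 image_eqI[of _ _ "(i, j, k, l)"]) simp_all
    qed
  qed
  then show ?thesis by (rule finite_subset) auto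
qed

lemma character_difference_root:
  assumes "X \<in> torus" "i \<in> {1..r}" "j \<in> {1..r}" "i \<noteq> j"
  shows "character r (difference_root i j) X = X i / X j"
proof -
  have "character r (difference_root i j) X
      = (\<Prod>m = 0..r. (if m = i then X m else 1) * (if m = j then inverse (X m) else 1))"
    unfolding character_def using assms(4)
    by (intro prod.cong) (auto simp: difference_root_def power_int_minus)
  also have "\<dots> = X i * inverse (X j)"
    using assms(2,3) by (subst prod.distrib) (simp add: prod.delta)
  finally show ?thesis by (simp add: divide_inverse)
qed

lemma character_plane_root:
  assumes "i \<in> {1..r}" "j \<in> {1..r}" "k \<in> {1..r}" "l \<in> {1..r}" "distinct [i, j, k, l]"
  shows "character r (plane_root i j k l) X = X 0 * X i * X j * X k * X l"
proof -
  have "character r (plane_root i j k l) X = (\<Prod>m\<in>{0, i, j, k, l}. X m)"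
    unfolding character_def using assms
    by (intro prod.mono_neutral_cong_right) (auto simp: plane_root_def)
  then show ?thesis using assms by (simp add: mult.assoc)
qed

lemma nodal_lifts:
  assumes "r \<ge> 4" "X \<in> torus" and generic: "\<And>n. n \<in> degeneracy_roots r \<Longrightarrow> character r n X \<noteq> 1"
  shows "nodal r X \<in> lifts r"
proof -
  have ne: "X i \<noteq> X j" if "i \<in> {1..r}" "j \<in> {1..r}" "i \<noteq> j" for i j
  proof -
    have "difference_root i j \<in> degeneracy_roots r"
      using that unfolding degeneracy_roots_def by blast
    then have "X i / X j \<noteq> 1"
      using generic character_difference_root[OF assms(2) that] by metis
    moreover have "X j \<noteq> 0" using assms(2) by (simp add: torus_def)
    ultimately show ?thesis by auto
  qed
  have "bracket (nodal r X) i j k l \<noteq> 0"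
    if "i \<in> {1..r}" "j \<in> {1..r}" "k \<in> {1..r}" "l \<in> {1..r}" "distinct [i, j, k, l]" for i j k l
  proof -
    have "plane_root i j k l \<in> degeneracy_roots r"
      using that unfolding degeneracy_roots_def by blast
    then have "X 0 * X i * X j * X k * X l \<noteq> 1"
      using generic character_plane_root[OF that, of X] by metis
    then show ?thesis
      using that ne unfolding bracket_nodal[OF that(1-4)] nodal_bracket_def by simp
  qed
  moreover have "nodal r X \<in> affine_space r" by (simp add: nodal_def affine_space_def)
  ultimately show ?thesis using lifts_iff[OF assms(1)] by blast
qed

subsection \<open>The action of the generators on the torus of parameters\<close>

text \<open>With \<open>a = \<lambda> z\<^sub>1 z\<^sub>2 z\<^sub>3 z\<^sub>4\<close>, the linear form on the
  curve vanishing at the points \<open>j \<noteq> i\<close> among the first four has its fourth zero at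
  \<open>z\<^sub>i / a\<close>. Inverting the coordinates exchanges \<open>z\<^sub>i\<close> with
  \<open>z\<^sub>i / a\<close> and hence \<open>a\<close> with \<open>1 / a\<close>, which forces the new value
  \<open>\<lambda> a\<^sup>2\<close> of \<open>\<lambda>\<close>.\<close>

fun torus_map :: "generator \<Rightarrow> (nat \<Rightarrow> 'k::field) \<Rightarrow> nat \<Rightarrow> 'k" where
  "torus_map (Tau i) X = swap_lift i X"
| "torus_map Cr X = (\<lambda>i. if i = 0 then X 0 * (X 0 * X 1 * X 2 * X 3 * X 4) ^ 2
    else if i \<le> 4 then X i / (X 0 * X 1 * X 2 * X 3 * X 4) else X i)"

lemma torus_map_torus: "X \<in> torus \<Longrightarrow> torus_map a X \<in> torus"
  by (cases a) (auto simp: torus_def swap_lift_eq)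

lemma character_split:
  assumes "r \<ge> 4"
  shows "character r n X = X 0 powi n 0 * X 1 powi n 1 * X 2 powi n 2 * X 3 powi n 3 * X 4 powi n 4
    * (\<Prod>i = 5..r. X i powi n i)"
proof -
  have "{0..r} = {0, 1, 2, 3, 4} \<union> {5..r}" using assms by auto
  then have "character r n X = (\<Prod>i\<in>{0, 1, 2, 3, 4}. X i powi n i) * (\<Prod>i = 5..r. X i powi n i)"
    unfolding character_def by (simp only:) (rule prod.union_disjoint; auto)
  then show ?thesis by (simp add: mult.assoc)
qed

text \<open>The action of the generators on the parameters is dual to the reflection representation.\<close>

lemma character_torus_map:
  assumes "X \<in> torus" "a \<in> generators r" "r \<ge> 4"
  shows "character r n (torus_map a X) = character r (reflect a n) X"
proof (cases a)
  case (Tau i)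
  then have i: "1 \<le> i" "i < r" using assms(2) by (auto simp: generators_def)
  define \<sigma> where "\<sigma> j = (if j = i then Suc i else if j = Suc i then i else j)" for j
  have inv: "\<sigma> (\<sigma> j) = j" for j by (simp add: \<sigma>_def)
  have "\<sigma> ` {0..r} \<subseteq> {0..r}" using i by (auto simp: \<sigma>_def)
  then have bij: "bij_betw \<sigma> {0..r} {0..r}"
    by (intro bij_betwI[of _ _ _ \<sigma>]) (auto simp: inv)
  have "character r n (torus_map a X) = (\<Prod>j = 0..r. X (\<sigma> j) powi n j)"
    by (simp add: character_def Tau swap_lift_eq \<sigma>_def)
  also have "\<dots> = (\<Prod>j = 0..r. X (\<sigma> j) powi n (\<sigma> (\<sigma> j)))" by (simp add: inv)
  also have "\<dots> = (\<Prod>j = 0..r. X j powi n (\<sigma> j))"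
    using prod.reindex_bij_betw[OF bij, of "\<lambda>j. X j powi n (\<sigma> j)"] .
  also have "\<dots> = character r (reflect a n) X"
    unfolding character_def
    by (intro prod.cong) (auto simp: Tau reflect_def \<sigma>_def)
  finally show ?thesis .
next
  case Cr
  let ?a = "X 0 * X 1 * X 2 * X 3 * X 4" and ?c = "n 1 + n 2 + n 3 + n 4 - 2 * n 0"
  have nz: "X 0 \<noteq> 0" "X 1 \<noteq> 0" "X 2 \<noteq> 0" "X 3 \<noteq> 0" "X 4 \<noteq> 0" and a: "?a \<noteq> 0"
    using assms(1) by (auto simp: torus_def)
  have tail: "(\<Prod>i = 5..r. torus_map Cr X i powi n i) = (\<Prod>i = 5..r. X i powi reflect Cr n i)"
    by (intro prod.cong) (auto simp: reflect_def)
  have "character r n (torus_map Cr X)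
      = (X 0 * ?a ^ 2) powi n 0 * (X 1 / ?a) powi n 1 * (X 2 / ?a) powi n 2 * (X 3 / ?a) powi n 3
        * (X 4 / ?a) powi n 4 * (\<Prod>i = 5..r. X i powi reflect Cr n i)"
    unfolding character_split[OF assms(3)] tail by simp
  also have "(X 0 * ?a ^ 2) powi n 0 * (X 1 / ?a) powi n 1 * (X 2 / ?a) powi n 2 * (X 3 / ?a) powi n 3
        * (X 4 / ?a) powi n 4 = X 0 powi n 0 * X 1 powi n 1 * X 2 powi n 2 * X 3 powi n 3
        * X 4 powi n 4 * (?a powi (2 * n 0) * ?a powi (- n 1) * ?a powi (- n 2) * ?a powi (- n 3) * ?a powi (- n 4))"
  proof -
    have "(X 0 * ?a ^ 2) powi n 0 = X 0 powi n 0 * ?a powi (2 * n 0)"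
      by (simp only: power_int_mult_distrib power_int_mult power_int_numeral)
    moreover have "(x / ?a) powi k = x powi k * ?a powi (- k)" for x k
      
      by (simp only: divide_inverse power_int_mult_distrib[of x "inverse ?a"] power_int_inverse
          power_int_minus)
    ultimately show ?thesis by (simp only: mult.assoc mult.left_commute mult.commute)
  qed
  also have "?a powi (2 * n 0) * ?a powi (- n 1) * ?a powi (- n 2) * ?a powi (- n 3) * ?a powi (- n 4) = ?a powi (- ?c)"
    using a by (simp only: power_int_add[symmetric] simp_thms) (simp add: algebra_simps)
  also have "?a powi (- ?c) = X 0 powi (- ?c) * X 1 powi (- ?c) * X 2 powi (- ?c) * X 3 powi (- ?c) * X 4 powi (- ?c)"
    by (simp only: power_int_mult_distrib)
  also have "X 0 powi n 0 * X 1 powi n 1 * X 2 powi n 2 * X 3 powi n 3 * X 4 powi n 4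
      * (X 0 powi (- ?c) * X 1 powi (- ?c) * X 2 powi (- ?c) * X 3 powi (- ?c) * X 4 powi (- ?c))
      = X 0 powi (n 0 - ?c) * X 1 powi (n 1 - ?c) * X 2 powi (n 2 - ?c) * X 3 powi (n 3 - ?c) * X 4 powi (n 4 - ?c)"
    using nz by (simp only: diff_conv_add_uminus power_int_add simp_thms) (simp only: mult.assoc mult.left_commute mult.commute)
  also have "\<dots> * (\<Prod>i = 5..r. X i powi reflect Cr n i) = character r (reflect Cr n) X"
    unfolding character_split[OF assms(3)] by (simp add: reflect_def)
  finally show ?thesis by (simp only: Cr)
qed

definition torus_action :: "generator list \<Rightarrow> (nat \<Rightarrow> 'k::field) \<Rightarrow> nat \<Rightarrow> 'k" where
  "torus_action w = foldr torus_map w"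

lemma torus_action_simps [simp]:
  "torus_action [] X = X" "torus_action (a # w) X = torus_map a (torus_action w X)"
  by (simp_all add: torus_action_def)

lemma torus_action_torus: "X \<in> torus \<Longrightarrow> torus_action w X \<in> torus"
  by (induction w) (auto intro: torus_map_torus)

lemma character_torus_action:
  assumes "X \<in> torus" "w \<in> lists (generators r)" "r \<ge> 4"
  shows "character r n (torus_action w X) = character r (lattice_action (rev w) n) X"
  using assms(2)
proof (induction w arbitrary: n)
  case (Cons a w)
  then have "character r n (torus_action (a # w) X) = character r (reflect a n) (torus_action w X)"
    using character_torus_map[OF torus_action_torus[OF assms(1)] _ assms(3)] by simp
  with Cons show ?case by simp
qed simp

text \<open>Here \<open>z\<close> is the parameter of the frame point that is replaced by \<open>m\<close>,
  and \<open>x\<close>, \<open>y\<close>, \<open>w\<close> are those of the other three. The brackets before and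
  after the Cremona transformation multiply to a factor that does not depend on \<open>m\<close>, times one that
  is symmetric in the four frame points; this is the relation \<open>cremona_related\<close>.\<close>

lemma nodal_bracket_cremona:
  fixes l x y w z m a :: "'k::field"
  assumes "l * x * y * w * z = a" "a \<noteq> 0" "z \<noteq> 0"
  shows "nodal_bracket l m x y w * nodal_bracket (l * a ^ 2) m (x / a) (y / a) (w / a)
    = ((y - x) * (w - x) * (w - y)) ^ 2 / (a ^ 6 * z ^ 2)
      * ((x - m) * (x - a * m) * ((y - m) * (y - a * m)) * ((w - m) * (w - a * m)) * ((z - m) * (z - a * m)))"
proof -
  have l: "l * x * y * w = a / z" using assms by (simp add: field_simps)
  have 1: "l * m * x * y * w - 1 = - (z - a * m) / z"
  proof -
    have "l * m * x * y * w = m * (l * x * y * w)" by (simp add: mult_ac)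
    then show ?thesis unfolding l using assms by (simp add: field_simps)
  qed
  have 2: "l * a ^ 2 * m * (x / a) * (y / a) * (w / a) - 1 = - (z - m) / z"
  proof -
    have "l * a ^ 2 * m * (x / a) * (y / a) * (w / a) = (l * x * y * w) * m * (a ^ 2 / (a * a * a))"
      by (simp add: mult_ac)
    also have "\<dots> = m / z" unfolding l using assms by (simp add: power2_eq_square)
    finally show ?thesis using assms by (simp add: field_simps)
  qed
  have 3: "u / a - m = (u - a * m) / a" "u / a - v / a = (u - v) / a" for u v
    using assms by (simp_all add: field_simps)
  show ?thesis
    unfolding nodal_bracket_def 1 2 3 using assms(2,3)
    by (simp add: divide_simps) algebra
qed

lemma nodal_bracket_swaps:
  "nodal_bracket l x m y w = - nodal_bracket l m x y w"
  "nodal_bracket l x y m w = nodal_bracket l m x y w"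
  "nodal_bracket l x y w m = - nodal_bracket l m x y w"
  unfolding nodal_bracket_def by algebra+

lemma nodal_cremona_related:
  fixes X :: "nat \<Rightarrow> 'k::field"
  assumes r: "r \<ge> 4" and X: "X \<in> torus"
    and generic: "nodal r X \<in> lifts r"
  shows "cremona_related r (nodal r X) (nodal r (torus_map Cr X))"
proof -
  define a where "a = X 0 * X 1 * X 2 * X 3 * X 4"
  have nz: "X i \<noteq> 0" for i using X by (simp add: torus_def)
  have a: "a \<noteq> 0" using nz by (simp add: a_def)
  define v where "v x y w z = ((y - x) * (w - x) * (w - y)) ^ 2 / (a ^ 6 * z ^ 2)" for x y w z :: 'k
  define \<nu> where "\<nu> k = (if k = 1 then v (X 2) (X 3) (X 4) (X 1) else if k = 2 then v (X 1) (X 3) (X 4) (X 2)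
    else if k = 3 then v (X 1) (X 2) (X 4) (X 3) else v (X 1) (X 2) (X 3) (X 4))" for k :: 4
  define f where "f i m = (X i - X m) * (X i - a * X m)" for i m
  define \<mu> where "\<mu> m = f 1 m * f 2 m * f 3 m * f 4 m" for m
  have ne: "X i \<noteq> X j" if ij: "i \<in> {1..4}" "j \<in> {1..4}" "i \<noteq> j" for i j
  proof
    assume "X i = X j"
    obtain k l where kl: "k \<in> {1..4}" "l \<in> {1..4}" "distinct [i, j, k, l]"
      using extend_to_four[of 4 i j] ij by auto
    have "bracket (nodal r X) i j k l = 0"
      using ij kl r \<open>X i = X j\<close> by (subst bracket_nodal) (auto simp: nodal_bracket_def)
    then show False using lifts_bracket[OF generic r] ij kl r by auto
  qed
  have v: "v x y w z \<noteq> 0" if "x \<noteq> y" "x \<noteq> w" "y \<noteq> w" "z \<noteq> 0" for x y w z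
    using that a by (simp add: v_def)
  have "X 1 \<noteq> X 2" "X 1 \<noteq> X 3" "X 1 \<noteq> X 4" "X 2 \<noteq> X 3" "X 2 \<noteq> X 4" "X 3 \<noteq> X 4"
    by (rule ne; simp)+
  then have "\<nu> k \<noteq> 0" for k unfolding \<nu>_def using nz v by presburger
  moreover have "coords (nodal r X) m $ k * coords (nodal r (torus_map Cr X)) m $ k = \<nu> k * \<mu> m"
    if m: "m \<in> {5..r}" for m k
  proof -
    have in_r: "1 \<in> {1..r}" "2 \<in> {1..r}" "3 \<in> {1..r}" "4 \<in> {1..r}" "m \<in> {1..r}" using m by auto
    let ?Y = "torus_map Cr X"
    have Y: "?Y 0 = X 0 * a ^ 2" "?Y 1 = X 1 / a" "?Y 2 = X 2 / a" "?Y 3 = X 3 / a" "?Y 4 = X 4 / a"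
      "?Y m = X m" using m by (simp_all add: a_def)
    have 1: "coords (nodal r X) m $ 1 * coords (nodal r ?Y) m $ 1 = \<nu> 1 * \<mu> m"
      unfolding coords_component bracket_nodal[OF in_r(5,2,3,4)] Y \<nu>_def v_def \<mu>_def f_def
      by (subst nodal_bracket_cremona[of _ _ _ _ "X 1"]) (use a nz in \<open>simp_all add: a_def mult_ac\<close>)
    have 2: "coords (nodal r X) m $ 2 * coords (nodal r ?Y) m $ 2 = \<nu> 2 * \<mu> m"
      unfolding coords_component bracket_nodal[OF in_r(1,5,3,4)] Y \<nu>_def v_def \<mu>_def f_def
        nodal_bracket_swaps(1)[of _ _ "X m"] minus_mult_minus
      by (subst nodal_bracket_cremona[of _ _ _ _ "X 2"]) (use a nz in \<open>simp_all add: a_def mult_ac\<close>)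
    have 3: "coords (nodal r X) m $ 3 * coords (nodal r ?Y) m $ 3 = \<nu> 3 * \<mu> m"
      unfolding coords_component bracket_nodal[OF in_r(1,2,5,4)] Y \<nu>_def v_def \<mu>_def f_def
        nodal_bracket_swaps(2)[of _ _ _ "X m"]
      by (subst nodal_bracket_cremona[of _ _ _ _ "X 3"]) (use a nz in \<open>simp_all add: a_def mult_ac\<close>)
    have 4: "coords (nodal r X) m $ 4 * coords (nodal r ?Y) m $ 4 = \<nu> 4 * \<mu> m"
      unfolding coords_component bracket_nodal[OF in_r(1,2,3,5)] Y \<nu>_def v_def \<mu>_def f_def
        nodal_bracket_swaps(3)[of _ _ _ _ "X m"] minus_mult_minus
      by (subst nodal_bracket_cremona[of _ _ _ _ "X 4"]) (use a nz in \<open>simp_all add: a_def mult_ac\<close>)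
    show ?thesis using exhaust_4[of k] 1 2 3 4 by metis
  qed
  ultimately show ?thesis unfolding cremona_related_def by blast
qed

lemma generator_map_nodal:
  assumes "r \<ge> 4" "a \<in> generators r" "X \<in> torus"
    and "nodal r X \<in> lifts r" "nodal r (torus_map a X) \<in> lifts r"
  shows "generator_map r a (lift_class r (nodal r X)) = Some (lift_class r (nodal r (torus_map a X)))"
proof (cases a)
  case (Tau i)
  then have i: "1 \<le> i" "i < r" using assms(2) by (auto simp: generators_def)
  have "nodal r (torus_map a X) = swap_lift i (nodal r X)"
    using i by (auto simp: Tau nodal_def swap_lift_eq fun_eq_iff)
  then show ?thesis using swap_map_lift[OF i assms(4)] by (simp add: Tau)
next
  case Cr
  then show ?thesis
    using cremona_related_imp_map[OF assms(4) assms(5) assms(1)]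
      nodal_cremona_related[OF assms(1,3,4)] by simp
qed

subsection \<open>Points of the torus avoiding finitely many characters\<close>

definition dot :: "nat \<Rightarrow> (nat \<Rightarrow> int) \<Rightarrow> (nat \<Rightarrow> int) \<Rightarrow> int" where
  "dot r v n = (\<Sum>i = 0..r. v i * n i)"

lemma dot_linear: "dot r (\<lambda>i. v i + k * u i) n = dot r v n + k * dot r u n"
  by (simp add: dot_def sum.distrib sum_distrib_left algebra_simps)

text \<open>Two cocharacters can be combined to \<open>v + k u\<close>, which fails for each of the vectors
  for at most one integer \<open>k\<close>.\<close>

lemma common_cocharacter:
  assumes "finite S" "\<And>n. n \<in> S \<Longrightarrow> \<exists>v. dot r v \<alpha> = 0 \<and> dot r v n \<noteq> 0"
  shows "\<exists>v. dot r v \<alpha> = 0 \<and> (\<forall>n\<in>S. dot r v n \<noteq> 0)"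
  using assms
proof (induction S rule: finite_induct)
  case empty
  show ?case by (intro exI[of _ "\<lambda>_. 0"]) (simp add: dot_def)
next
  case (insert n S)
  obtain v where v: "dot r v \<alpha> = 0" "\<forall>n\<in>S. dot r v n \<noteq> 0" using insert by blast
  obtain u where u: "dot r u \<alpha> = 0" "dot r u n \<noteq> 0" using insert.prems by blast
  have "finite {k. dot r v n' + k * dot r u n' = 0}" if "n' \<in> insert n S" for n'
  proof (cases "dot r u n' = 0")
    case True
    then have "dot r v n' \<noteq> 0" using that u v by auto
    then show ?thesis using True by simp
  next
    case False
    have "{k. dot r v n' + k * dot r u n' = 0} \<subseteq> {- dot r v n' div dot r u n'}"
    proof
      fix k assume "k \<in> {k. dot r v n' + k * dot r u n' = 0}"
      then have "- dot r v n' = k * dot r u n'" by simp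
      then show "k \<in> {- dot r v n' div dot r u n'}" using False by simp
    qed
    then show ?thesis by (rule finite_subset) simp
  qed
  then have "finite (\<Union>n'\<in>insert n S. {k. dot r v n' + k * dot r u n' = 0})"
    using insert.hyps(1) by (intro finite_UN_I) auto
  then obtain k where k: "k \<notin> (\<Union>n'\<in>insert n S. {k. dot r v n' + k * dot r u n' = 0})"
    using ex_new_if_finite[OF infinite_UNIV_int] by blast
  show ?case
    using k u(1) v(1) by (intro exI[of _ "\<lambda>i. v i + k * u i"]) (auto simp: dot_linear)
qed

lemma finite_roots_of_unity:
  assumes "n \<noteq> (0 :: int)"
  shows "finite {t :: 'k::field. t powi n = 1}"
proof -
  define m where "m = nat \<bar>n\<bar>"
  have m: "m > 0" using assms by (simp add: m_def)
  have "{t :: 'k. t powi n = 1} \<subseteq> {t. poly (monom 1 m - 1) t = 0}"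
  proof
    fix t :: 'k assume "t \<in> {t. t powi n = 1}"
    then have t: "t powi n = 1" by simp
    have "t ^ m = 1"
    proof (cases "n \<ge> 0")
      case True
      then show ?thesis using t by (simp add: m_def power_int_def)
    next
      case False
      then have "inverse t ^ m = 1" using t by (simp add: m_def power_int_def)
      then show ?thesis by (simp add: power_inverse)
    qed
    then show "t \<in> {t. poly (monom 1 m - 1) t = 0}" by (simp add: poly_monom)
  qed
  moreover have "monom (1 :: 'k) m - 1 \<noteq> 0"
  proof
    assume "monom (1 :: 'k) m - 1 = 0"
    then have "coeff (monom (1 :: 'k) m - 1) m = 0" by simp
    then show False using m by (simp add: coeff_1)
  qed
  ultimately show ?thesis using poly_roots_finite finite_subset by blast
qed

lemma generic_scalar:
  assumes "infinite (UNIV :: 'k::field set)" "finite M" "0 \<notin> M"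
  obtains t :: "'k::field" where "t \<noteq> 0" "\<And>n. n \<in> M \<Longrightarrow> t powi n \<noteq> 1"
proof -
  have "finite (\<Union>n\<in>M. {t :: 'k. t powi n = 1})"
    using assms(2,3) by (intro finite_UN_I finite_roots_of_unity) auto
  then have "finite (insert 0 (\<Union>n\<in>M. {t :: 'k. t powi n = 1}))" by simp
  then obtain t where "t \<notin> insert 0 (\<Union>n\<in>M. {t :: 'k. t powi n = 1})"
    using ex_new_if_finite[OF assms(1)] by blast
  then show ?thesis using that by blast
qed

lemma prod_power_int:
  assumes "t \<noteq> (0 :: 'k::field)"
  shows "(\<Prod>i\<in>A. t powi f i) = t powi (\<Sum>i\<in>A. f i)"
  by (induction A rule: infinite_finite_induct) (simp_all add: assms power_int_add)

lemma character_one_parameter: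
  assumes "t \<noteq> (0 :: 'k::field)"
  shows "character r n (\<lambda>i. t powi v i) = t powi dot r v n"
  unfolding character_def dot_def
  by (simp add: power_int_mult[symmetric] prod_power_int[OF assms])

lemma root_nonzero:
  assumes "lattice_form r n n = 2"
  shows "\<exists>i\<in>{0..r}. n i \<noteq> 0"
proof (rule ccontr)
  assume "\<not> ?thesis"
  then have "lattice_form r n n = 0" unfolding lattice_form_def by simp
  then show False using assms by simp
qed

lemma generic_cocharacter:
  assumes "finite S" "\<And>n. n \<in> S \<Longrightarrow> lattice_form r n n = 2"
  obtains v where "\<And>n. n \<in> S \<Longrightarrow> dot r v n \<noteq> 0"
proof -
  have "\<exists>v. dot r v (\<lambda>_. 0) = 0 \<and> dot r v n \<noteq> 0" if n: "n \<in> S" for n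
  proof -
    obtain i where i: "i \<in> {0..r}" "n i \<noteq> 0" using root_nonzero[OF assms(2)[OF n]] by blast
    have "dot r (\<lambda>j. if j = i then 1 else 0) n = (\<Sum>j = 0..r. if j = i then n j else 0)"
      unfolding dot_def by (intro sum.cong) auto
    also have "\<dots> = n i" using i(1) by simp
    finally have "dot r (\<lambda>j. if j = i then 1 else 0) n \<noteq> 0" using i(2) by simp
    moreover have "dot r (\<lambda>j. if j = i then 1 else 0) (\<lambda>_. 0) = 0" by (simp add: dot_def)
    ultimately show ?thesis by blast
  qed
  from common_cocharacter[OF assms(1) this] that show ?thesis by blast
qed

text \<open>Only finitely many roots matter for a given word, so a generic one-parameter subgroup
  \<open>X\<^sub>i = t\<^bsup>v i\<^esup>\<close> and a parameter \<open>t\<close> outside finitely many roots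
  of unity suffice.\<close>

lemma generic_torus_point:
  assumes "infinite (UNIV :: 'k::field set)" "finite S" "\<And>n. n \<in> S \<Longrightarrow> lattice_form r n n = 2"
  shows "\<exists>X :: nat \<Rightarrow> 'k. X \<in> torus \<and> (\<forall>n\<in>S. character r n X \<noteq> 1)"
proof -
  obtain v where v: "\<And>n. n \<in> S \<Longrightarrow> dot r v n \<noteq> 0" using generic_cocharacter[OF assms(2,3)] by blast
  have "finite (dot r v ` S)" "0 \<notin> dot r v ` S" using assms(2) v by auto
  then obtain t :: 'k where t: "t \<noteq> 0" "\<And>n. n \<in> dot r v ` S \<Longrightarrow> t powi n \<noteq> 1"
    using generic_scalar[OF assms(1)] by blast
  have "(\<lambda>i. t powi v i) \<in> torus" using t(1) by (simp add: torus_def)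
  moreover have "character r n (\<lambda>i. t powi v i) \<noteq> 1" if "n \<in> S" for n
    using t(2) that unfolding character_one_parameter[OF t(1)] by blast
  ultimately show ?thesis by blast
qed

lemma degeneracy_roots_norm:
  assumes "n \<in> degeneracy_roots r"
  shows "lattice_form r n n = 2"
  using assms unfolding degeneracy_roots_def
proof (elim UnE CollectE exE conjE)
  fix i j assume n: "n = difference_root i j" and ij: "i \<in> {1..r}" "j \<in> {1..r}" "i \<noteq> j"
  have "(\<Sum>m = 1..r. n m * n m) = (\<Sum>m = 1..r. (if m = i then 1 else 0) + (if m = j then 1 else 0))"
    using ij(3) by (intro sum.cong) (auto simp: n difference_root_def)
  also have "\<dots> = 2" using ij by (simp add: sum.distrib)
  finally show ?thesis using ij by (simp add: lattice_form_def n difference_root_def)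
next
  fix i j k l assume n: "n = plane_root i j k l"
    and *: "i \<in> {1..r}" "j \<in> {1..r}" "k \<in> {1..r}" "l \<in> {1..r}" "distinct [i, j, k, l]"
  have "(\<Sum>m = 1..r. n m * n m) = (\<Sum>m\<in>{i, j, k, l}. 1)"
    using * by (intro sum.mono_neutral_cong_right) (auto simp: n plane_root_def)
  also have "\<dots> = 4" using *(5) by simp
  finally show ?thesis by (simp add: lattice_form_def n plane_root_def)
qed

section \<open>The Coxeter relations\<close>

text \<open>Witnessed by a generic nodal configuration.\<close>

lemma cremona_domain_nonempty:
  assumes "infinite (UNIV :: 'k::field set)" "r \<ge> 8"
  shows "\<exists>c :: nat \<Rightarrow> 'k ^ 4. c \<in> lifts r \<and> cremona_lift r c \<in> lifts r"
proof -
  have r: "r \<ge> 4" using assms(2) by simp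
  let ?S = "degeneracy_roots r \<union> reflect Cr ` degeneracy_roots r"
  have fin: "finite ?S" using finite_degeneracy_roots by blast
  have norm: "lattice_form r n n = 2" if "n \<in> ?S" for n
    using that degeneracy_roots_norm lattice_form_reflect[OF Cr_in_generators assms(2)] by auto
  obtain X :: "nat \<Rightarrow> 'k" where X: "X \<in> torus" "\<And>n. n \<in> ?S \<Longrightarrow> character r n X \<noteq> 1"
    using generic_torus_point[OF assms(1) fin norm] by blast
  have 1: "nodal r X \<in> lifts r" using X by (intro nodal_lifts[OF r]) auto
  have 2: "nodal r (torus_map Cr X) \<in> lifts r"
  proof (rule nodal_lifts[OF r torus_map_torus[OF X(1)]])
    fix n assume "n \<in> degeneracy_roots r"
    then have "reflect Cr n \<in> ?S" by blast
    then show "character r n (torus_map Cr X) \<noteq> 1"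
      unfolding character_torus_map[OF X(1) Cr_in_generators r] by (rule X(2))
  qed
  have "cremona_map r (lift_class r (nodal r X)) \<noteq> None"
    using generator_map_nodal[OF r Cr_in_generators X(1) 1 2] by simp
  then have "cremona_lift r (nodal r X) \<in> lifts r"
    unfolding cremona_map_lift[OF 1 r] by (auto split: if_splits)
  with 1 show ?thesis by blast
qed

lemma generator_map_U_set:
  "generator_map r a x = Some y \<Longrightarrow> x \<in> U_set r"
  by (cases a) (auto simp: swap_map_def cremona_map_def Let_def split: if_splits)

lemma generator_map_involution:
  assumes "r \<ge> 4" "a \<in> generators r" "generator_map r a x = Some y"
  shows "generator_map r a y = Some x"
proof (cases a)
  case (Tau i)
  then have i: "1 \<le> i" "i < r" using assms(2) by (auto simp: generators_def)
  obtain c where c: "c \<in> lifts r" "x = lift_class r c"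
    using generator_map_U_set[OF assms(3)] by (auto simp: U_set_eq)
  then have "y = lift_class r (swap_lift i c)"
    using assms(3) swap_map_lift[OF i c(1)] by (simp add: Tau)
  then show ?thesis
    using swap_map_lift[OF i swap_lift_lifts[OF assms(1) i c(1)]] c(2) by (simp add: Tau)
next
  case Cr
  then show ?thesis using cremona_map_involution[OF assms(1)] assms(3) by simp
qed

lemma birational_generator_map:
  assumes "infinite (UNIV :: 'k::field set)" "r \<ge> 8" "a \<in> generators r"
  shows "birational_map (U_space r) (generator_map r a :: 'k tuple set \<rightharpoonup> 'k tuple set)"
proof (rule involution_birational)
  have r: "r \<ge> 4" using assms(2) by simp
  obtain c :: "nat \<Rightarrow> 'k ^ 4" where c: "c \<in> lifts r" "cremona_lift r c \<in> lifts r"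
    using cremona_domain_nonempty[OF assms(1,2)] by blast
  have dom: "dom (generator_map r a :: 'k tuple set \<rightharpoonup> 'k tuple set) \<subseteq> U_set r"
    using generator_map_U_set by blast
  show "rational_map (U_space r) (generator_map r a :: 'k tuple set \<rightharpoonup> 'k tuple set)"
  proof (cases a)
    case (Tau i)
    then have i: "1 \<le> i" "i < r" using assms(3) by (auto simp: generators_def)
    show ?thesis
    proof (rule rational_map_from_lift[OF assms(1) r polynomial_map_swap_lift[OF i] _ dom])
      fix c :: "nat \<Rightarrow> 'k ^ 4" assume c: "c \<in> lifts r"
      show "generator_map r a (lift_class r c) = (if swap_lift i c \<in> lifts r
          then Some (lift_class r (swap_lift i c)) else None)"
        using swap_map_lift[OF i c] swap_lift_lifts[OF r i c] by (simp add: Tau)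
    next
      show "\<exists>c :: nat \<Rightarrow> 'k ^ 4 \<in> lifts r. swap_lift i c \<in> lifts r"
        using c(1) swap_lift_lifts[OF r i] by blast
    qed
  next
    case Cr
    show ?thesis
    proof (rule rational_map_from_lift[OF assms(1) r polynomial_map_cremona_lift[OF r] _ dom])
      fix c :: "nat \<Rightarrow> 'k ^ 4" assume c: "c \<in> lifts r"
      show "generator_map r a (lift_class r c) = (if cremona_lift r c \<in> lifts r
          then Some (lift_class r (cremona_lift r c)) else None)"
        using cremona_map_lift[OF c r] by (simp add: Cr)
    next
      show "\<exists>c :: nat \<Rightarrow> 'k ^ 4 \<in> lifts r. cremona_lift r c \<in> lifts r"
        using c by blast
    qed
  qed
qed (use assms generator_map_involution[of r a] in simp)

subsection \<open>Commuting generators\<close>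

text \<open>For \<open>i \<le> 3\<close> the four frame coordinates are permuted (up to sign), for \<open>i
  \<ge> 5\<close> the remaining points.\<close>

lemma cremona_related_swap:
  assumes "1 \<le> i" "i < r" "i \<noteq> 4" "cremona_related r c d"
  shows "cremona_related r (swap_lift i c) (swap_lift i d)"
proof -
  obtain \<nu> \<mu> where \<nu>: "\<And>k. \<nu> k \<noteq> 0"
    and \<nu>\<mu>: "\<And>m k. m \<in> {5..r} \<Longrightarrow> coords c m $ k * coords d m $ k = \<nu> k * \<mu> m"
    using assms(4) unfolding cremona_related_def by blast
  show ?thesis
  proof (cases "i \<le> 3")
    case True
    \<comment> \<open>The transposition of the frame indices \<open>i\<close> and \<open>i + 1\<close>.\<close>
    define \<pi> :: "4 \<Rightarrow> 4" where "\<pi> k = (if k = of_nat i then of_nat (Suc i)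
      else if k = of_nat (Suc i) then of_nat i else k)" for k
    have "i = 1 \<or> i = 2 \<or> i = 3" using True assms(1) by auto
    then have sw: "coords (swap_lift i e) m $ k = - coords e m $ \<pi> k"
      if "m \<in> {5..r}" for e :: "nat \<Rightarrow> 'a ^ 4" and m k
      using that exhaust_4[of k]
      by (elim disjE)
        (simp_all add: \<pi>_def coords_component bracket_def swap_lift_eq det_4 mat4_component algebra_simps numeral_2_eq_2[symmetric])
    have "coords (swap_lift i c) m $ k * coords (swap_lift i d) m $ k = \<nu> (\<pi> k) * \<mu> m"
      if m: "m \<in> {5..r}" for m k
      unfolding sw[OF m] minus_mult_minus by (rule \<nu>\<mu>[OF m])
    then show ?thesis
      unfolding cremona_related_def using \<nu> by (intro exI[of _ "\<lambda>k. \<nu> (\<pi> k)"] exI[of _ \<mu>]) blast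
  next
    case False
    define \<sigma> where "\<sigma> m = (if m = i then Suc i else if m = Suc i then i else m)" for m
    have i: "i \<ge> 5" using False assms(3) by simp
    have sw: "coords (swap_lift i e) m = coords e (\<sigma> m)" for e :: "nat \<Rightarrow> 'a ^ 4" and m
      using i by (simp add: vec_eq_iff forall_4 coords_component bracket_def swap_lift_eq \<sigma>_def)
    have "\<sigma> m \<in> {5..r}" if "m \<in> {5..r}" for m using that i assms(2) by (auto simp: \<sigma>_def)
    then have "coords (swap_lift i c) m $ k * coords (swap_lift i d) m $ k = \<nu> k * \<mu> (\<sigma> m)"
      if m: "m \<in> {5..r}" for m k
      unfolding sw using \<nu>\<mu> m by blast
    then show ?thesis
      unfolding cremona_related_def using \<nu> by (intro exI[of _ \<nu>] exI[of _ "\<lambda>m. \<mu> (\<sigma> m)"]) blast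
  qed
qed

lemma swap_map_cremona_map:
  assumes "r \<ge> 4" "1 \<le> i" "i < r" "i \<noteq> 4" "cremona_map r x = Some y"
  shows "\<exists>x' y'. swap_map r i x = Some x' \<and> swap_map r i y = Some y' \<and> cremona_map r x' = Some y'"
proof -
  have "x \<in> U_set r" using generator_map_U_set[of r Cr x y] assms(5) by simp
  then obtain c where c: "c \<in> lifts r" "x = lift_class r c" by (auto simp: U_set_eq)
  obtain d where d: "d \<in> lifts r" "y = lift_class r d" "cremona_related r c d"
    using cremona_map_imp_related[OF c(1) assms(1)] assms(5) c(2) by metis
  note sw = swap_lift_lifts[OF assms(1,2,3)]
  show ?thesis
    using swap_map_lift[OF assms(2,3) c(1)] swap_map_lift[OF assms(2,3) d(1)]
      cremona_related_imp_map[OF sw[OF c(1)] sw[OF d(1)] assms(1)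
        cremona_related_swap[OF assms(2,3,4) d(3)]] c(2) d(2) by blast
qed

subsection \<open>The braid relation between the Cremona transformation and the fourth transposition\<close>

text \<open>The first five points form the standard projective frame.\<close>

definition normalized :: "nat \<Rightarrow> (nat \<Rightarrow> 'k::field ^ 4) \<Rightarrow> bool" where
  "normalized r c \<longleftrightarrow> c \<in> lifts r \<and> (\<forall>i\<in>{1..4}. c i = axis (of_nat i) 1) \<and> c 5 = (\<chi> k. 1)"

lemma le_5_cases:
  fixes i :: nat
  assumes "i \<in> {1..r}"
  obtains "i \<in> {1..4}" | "i = 5" | "i \<in> {6..r}"
  using assms by fastforce

lemma normalized_representative:
  fixes x :: "'k::field tuple set"
  assumes "r \<ge> 5" "x \<in> U_set r"
  obtains c where "normalized r c" "x = lift_class r c"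
proof -
  have r: "r \<ge> 4" using assms(1) by simp
  obtain c where c: "c \<in> lifts r" "x = lift_class r c" using assms(2) by (auto simp: U_set_eq)
  have nz: "coords c 5 $ k \<noteq> 0" for k using lifts_coords_nonzero[OF c(1)] assms(1) by simp
  define d where "d = (\<lambda>i\<in>{1..r}. if i \<le> 4 then axis (of_nat i) 1
    else (\<chi> k. inverse (coords c 5 $ k) * coords c i $ k))"
  let ?D = "diagonal (\<lambda>k. inverse (coords c 5 $ k))"
  have fr: "invertible (frame c)" using lifts_frame[OF c(1) r] by (simp add: invertible_det_nz)
  have inv: "matrix_inv (frame c) *v (frame c *v v) = v" for v
    using matrix_inv_mult[OF fr] by (simp add: matrix_vector_mul_assoc)
  have equiv: "proj_equiv r c d"
    unfolding proj_equiv_def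
  proof (intro exI conjI ballI)
    have "invertible (matrix_inv (frame c))"
      using matrix_inv_mult[OF fr] by (auto simp: invertible_def)
    then show "invertible (?D ** matrix_inv (frame c))"
      using nz by (intro invertible_mult invertible_diagonal) auto
    let ?s = "\<lambda>i. if i \<le> 4 then coords c 5 $ of_nat i else det (frame c)"
    fix i assume i: "i \<in> {1..r}"
    show "?s i \<noteq> 0" using nz lifts_frame[OF c(1) r] by simp
    show "d i = ?s i *s ((?D ** matrix_inv (frame c)) *v c i)"
    proof (cases "i \<le> 4")
      case True
      have "matrix_inv (frame c) *v c i = axis (of_nat i) 1"
        using frame_axis[of i c] True i inv[of "axis (of_nat i) 1"] by simp
      then have "(?D ** matrix_inv (frame c)) *v c i = inverse (coords c 5 $ of_nat i) *s axis (of_nat i) 1"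
        by (simp add: matrix_vector_mul_assoc[symmetric] diagonal_mult vec_eq_iff axis_def)
      then show ?thesis using True i nz by (simp add: d_def)
    next
      case False
      have "matrix_inv (frame c) *v (det (frame c) *s c i) = coords c i"
        using frame_coords[OF lifts_frame[OF c(1) r], of i] inv[of "coords c i"] by simp
      then have "det (frame c) *s ((?D ** matrix_inv (frame c)) *v c i) = ?D *v coords c i"
        by (simp add: matrix_vector_mul_assoc[symmetric] vector_scalar_commute[symmetric])
      then show ?thesis using False i by (simp add: d_def diagonal_mult)
    qed
  qed
  have "d \<in> affine_space r" by (simp add: d_def affine_space_def)
  then have "d \<in> lifts r" by (rule proj_equiv_lifts[OF r equiv c(1)])
  then have "normalized r d"
    using nz assms(1) by (auto simp: normalized_def d_def vec_eq_iff)
  with that proj_equiv_lift_class[OF equiv] c(2) show ?thesis by blast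
qed

lemma normalized_coords:
  assumes "normalized r c"
  shows "coords c m = c m"
  using assms unfolding normalized_def
  by (simp add: vec_eq_iff forall_4 coords_component bracket_def det_4 mat4_component axis_def)

lemma normalized_nonzero:
  assumes "normalized r c" "m \<in> {5..r}"
  shows "c m $ k \<noteq> 0"
  using lifts_coords_nonzero[of c r m k] assms normalized_coords[OF assms(1), of m]
  by (simp add: normalized_def)

definition invert_coords :: "nat \<Rightarrow> (nat \<Rightarrow> 'k::field ^ 4) \<Rightarrow> nat \<Rightarrow> 'k ^ 4" where
  "invert_coords r c = (\<lambda>i\<in>{1..r}. if i \<le> 5 then c i else (\<chi> k. inverse (c i $ k)))"

text \<open>After the transposition \<open>\<tau>\<^sub>4\<close>, the fourth point is the unit point and the
  fifth one is the last coordinate point. This matrix exchanges these two and fixes the first three coordinate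
  points.\<close>

definition exchange_matrix :: "'k::field ^ 4 ^ 4" where
  "exchange_matrix = (\<chi> k j. if j = 4 then 1 else if j = k then - 1 else 0)"

definition exchange_coords :: "nat \<Rightarrow> (nat \<Rightarrow> 'k::field ^ 4) \<Rightarrow> nat \<Rightarrow> 'k ^ 4" where
  "exchange_coords r c = (\<lambda>i\<in>{1..r}. if i \<le> 5 then c i else exchange_matrix *v c i)"

lemma exchange_matrix_mult:
  "(exchange_matrix *v x) $ 1 = x $ 4 - x $ 1" "(exchange_matrix *v x) $ 2 = x $ 4 - x $ 2"
  "(exchange_matrix *v x) $ 3 = x $ 4 - x $ 3" "(exchange_matrix *v x) $ 4 = x $ 4"
  by (simp_all add: exchange_matrix_def matrix_vector_mult_def sum_4)

lemma normalized_cremona: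
  fixes c :: "nat \<Rightarrow> 'k::field ^ 4"
  assumes "r \<ge> 5" "normalized r c" "cremona_map r (lift_class r c) = Some y"
  shows "normalized r (invert_coords r c) \<and> y = lift_class r (invert_coords r c)"
proof -
  have r: "r \<ge> 4" and c: "c \<in> lifts r" using assms by (simp_all add: normalized_def)
  let ?d = "cremona_lift r c"
  have d: "?d \<in> lifts r" "y = lift_class r ?d"
    using assms(3) cremona_map_lift[OF c r] by (auto split: if_splits)
  have equiv: "proj_equiv r ?d (invert_coords r c)"
    unfolding proj_equiv_def
  proof (intro exI conjI ballI)
    show "invertible (mat 1 :: 'k ^ 4 ^ 4)" by (simp add: invertible_det_nz)
    let ?s = "\<lambda>i. if i \<le> 4 then 1 else inverse (\<Prod>j\<in>UNIV. c i $ j)"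
    fix i assume i: "i \<in> {1..r}"
    have nz: "c i $ k \<noteq> 0" if "\<not> i \<le> 4" for k
      using normalized_nonzero[OF assms(2)] that i by simp
    then show "?s i \<noteq> 0" by simp
    show "invert_coords r c i = ?s i *s (mat 1 *v ?d i)"
      using i
    proof (cases rule: le_5_cases)
      case 1
      then show ?thesis using assms(2) i by (simp add: invert_coords_def cremona_lift_eq(1) normalized_def)
    next
      case 2
      then show ?thesis
        using assms(2) i normalized_coords[OF assms(2), of 5]
        by (simp add: invert_coords_def cremona_lift_eq(2) normalized_def vec_eq_iff)
    next
      case 3
      then have nz: "c i $ k \<noteq> 0" for k using nz by simp
      have "i \<in> {5..r}" using 3 by simp
      then show ?thesis
        using 3 i nz normalized_coords[OF assms(2), of i]
        by (simp add: invert_coords_def cremona_lift_eq(2) vec_eq_iff prod_remove_coord[OF nz])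
    qed
  qed
  have "invert_coords r c \<in> affine_space r" by (simp add: invert_coords_def affine_space_def)
  then have "invert_coords r c \<in> lifts r" by (rule proj_equiv_lifts[OF r equiv d(1)])
  then have "normalized r (invert_coords r c)"
    using assms(1,2) by (simp add: normalized_def invert_coords_def)
  then show ?thesis using d(2) proj_equiv_lift_class[OF equiv] by simp
qed

lemma normalized_exchange:
  fixes c :: "nat \<Rightarrow> 'k::field ^ 4"
  assumes "r \<ge> 5" "normalized r c"
  shows "normalized r (exchange_coords r c)
    \<and> swap_map r 4 (lift_class r c) = Some (lift_class r (exchange_coords r c))"
proof -
  have r: "r \<ge> 4" and c: "c \<in> lifts r" and i4: "1 \<le> (4 :: nat)" "4 < r"
    using assms by (simp_all add: normalized_def)
  have cax: "c i = axis (of_nat i) 1" if "i \<in> {1..4}" for i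
    using assms(2) that by (simp add: normalized_def)
  have c5: "c 5 = (\<chi> k. 1)" using assms(2) by (simp add: normalized_def)
  let ?d = "swap_lift 4 c"
  have d: "?d \<in> lifts r" by (rule swap_lift_lifts[OF r i4 c])
  have equiv: "proj_equiv r ?d (exchange_coords r c)"
    unfolding proj_equiv_def
  proof (intro exI conjI ballI)
    have "exchange_matrix ** exchange_matrix = (mat 1 :: 'k ^ 4 ^ 4)"
      by (simp add: vec_eq_iff forall_4 exchange_matrix_def matrix_matrix_mult_def sum_4 mat_def)
    then show "invertible (exchange_matrix :: 'k ^ 4 ^ 4)" by (auto simp: invertible_def)
    let ?s = "\<lambda>i. if i \<le> 3 then - 1 else 1 :: 'k"
    fix i assume i: "i \<in> {1..r}"
    show "?s i \<noteq> 0" by simp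
    show "exchange_coords r c i = ?s i *s (exchange_matrix *v ?d i)"
      using i
    proof (cases rule: le_5_cases)
      case 1
      then have "1 \<le> i" "i \<le> 4" by simp_all
      then show ?thesis
      proof (cases rule: le_4_cases)
        case 4
        then show ?thesis using i c5 cax[of 4]
          by (simp add: exchange_coords_def swap_lift_eq vec_eq_iff forall_4 exchange_matrix_mult axis_def)
      qed (use i cax[of i] in \<open>simp_all add: exchange_coords_def swap_lift_eq vec_eq_iff forall_4
            exchange_matrix_mult axis_def\<close>)
    next
      case 2
      then show ?thesis using i c5 cax[of 4]
        by (simp add: exchange_coords_def swap_lift_eq vec_eq_iff forall_4 exchange_matrix_mult axis_def)
    next
      case 3
      then show ?thesis using i by (simp add: exchange_coords_def swap_lift_eq)
    qed
  qed
  have "exchange_coords r c \<in> affine_space r" by (simp add: exchange_coords_def affine_space_def)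
  then have "exchange_coords r c \<in> lifts r" by (rule proj_equiv_lifts[OF r equiv d])
  then have "normalized r (exchange_coords r c)"
    using assms(1,2) by (simp add: normalized_def exchange_coords_def)
  then show ?thesis
    using swap_map_lift[OF i4 c] proj_equiv_lift_class[OF equiv] by simp
qed

lemma lift_class_scaled:
  fixes c :: "nat \<Rightarrow> 'k::field ^ 4"
  assumes "\<And>i. i \<in> {1..r} \<Longrightarrow> \<exists>s. s \<noteq> 0 \<and> d i = s *s c i"
  shows "lift_class r c = lift_class r d"
proof (rule proj_equiv_lift_class)
  obtain s where s: "\<And>i. i \<in> {1..r} \<Longrightarrow> s i \<noteq> 0 \<and> d i = s i *s c i" using assms by metis
  have "invertible (mat 1 :: 'k ^ 4 ^ 4)" by (simp add: invertible_det_nz)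
  with s show "proj_equiv r c d"
    unfolding proj_equiv_def by (intro exI[of _ "mat 1"] exI[of _ s]) simp
qed

text \<open>In the coordinates \<open>x\<^sub>k / x\<^sub>4\<close> the two maps are \<open>t \<mapsto> 1 /
  t\<close> and \<open>t \<mapsto> 1 - t\<close>, whose composite has order three. On vectors this leaves the
  scalar \<open>x\<^sub>4\<^sup>-\<^sup>2\<close>.\<close>

lemma braid_cremona_exchange:
  fixes c :: "nat \<Rightarrow> 'k::field ^ 4"
  assumes "normalized r c" "normalized r (exchange_coords r c)"
  shows "lift_class r (exchange_coords r (invert_coords r (exchange_coords r (invert_coords r
      (exchange_coords r (invert_coords r c)))))) = lift_class r c"
    and "lift_class r (invert_coords r (exchange_coords r (invert_coords r (exchange_coords r
      (invert_coords r (exchange_coords r c)))))) = lift_class r c"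
proof -
  have nz: "c i $ k \<noteq> 0" "k \<noteq> 4 \<longrightarrow> c i $ 4 \<noteq> c i $ k" if "i \<in> {6..r}" for i k
  proof -
    have i: "i \<in> {1..r}" "i \<in> {5..r}" "\<not> i \<le> 5" using that by simp_all
    show "c i $ k \<noteq> 0" by (rule normalized_nonzero[OF assms(1) i(2)])
    have "(exchange_matrix *v c i) $ k \<noteq> 0"
      using normalized_nonzero[OF assms(2) i(2), of k] i by (simp add: exchange_coords_def)
    then show "k \<noteq> 4 \<longrightarrow> c i $ 4 \<noteq> c i $ k"
      using exhaust_4[of k] by (auto simp: exchange_matrix_mult)
  qed
  have inv: "invert_coords r e i = (\<chi> k. inverse (e i $ k))" "exchange_coords r e i = exchange_matrix *v e i"
    if "i \<in> {6..r}" for e :: "nat \<Rightarrow> 'k ^ 4" and i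
    using that by (simp_all add: invert_coords_def exchange_coords_def)
  have small: "invert_coords r e i = e i" "exchange_coords r e i = e i"
    if "i \<in> {1..r}" "i \<le> 5" for e :: "nat \<Rightarrow> 'k ^ 4" and i
    using that by (simp_all add: invert_coords_def exchange_coords_def)
  have 1: "inverse (inverse (inverse z)) - inverse (inverse (inverse z) - inverse (inverse z - inverse x))
      = inverse (z * z) * x" if "x \<noteq> 0" "z \<noteq> 0" "z \<noteq> x" for x z :: 'k
  proof -
    have a: "inverse z - inverse x = (x - z) / (z * x)" using that by (simp add: field_simps)
    have b: "inverse (inverse z) - inverse ((x - z) / (z * x)) = - (z * z) / (x - z)"
      using that by (simp add: field_simps)
    show ?thesis unfolding a b using that by (simp add: field_simps)
  qed
  have 2: "inverse (inverse (inverse z) - inverse (inverse z - inverse (z - x))) = inverse (z * z) * x"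
    if "x \<noteq> 0" "z \<noteq> 0" "z \<noteq> x" for x z :: 'k
  proof -
    have a: "inverse z - inverse (z - x) = - x / (z * (z - x))" using that by (simp add: field_simps)
    have b: "inverse (inverse z) - inverse (- x / (z * (z - x))) = z * z / x"
      using that by (simp add: field_simps)
    show ?thesis unfolding a b using that by (simp add: field_simps)
  qed
  show "lift_class r (exchange_coords r (invert_coords r (exchange_coords r (invert_coords r
      (exchange_coords r (invert_coords r c)))))) = lift_class r c"
  proof (rule lift_class_scaled[symmetric])
    fix i assume i: "i \<in> {1..r}"
    show "\<exists>s. s \<noteq> 0 \<and> exchange_coords r (invert_coords r (exchange_coords r (invert_coords r
      (exchange_coords r (invert_coords r c))))) i = s *s c i"
    proof (cases "i \<le> 5")
      case True
      then show ?thesis using small[OF i] by (intro exI[of _ 1]) simp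
    next
      case False
      then have "i \<in> {6..r}" using i by simp
      then show ?thesis
        using nz[of i] 1[of "c i $ 1" "c i $ 4"] 1[of "c i $ 2" "c i $ 4"] 1[of "c i $ 3" "c i $ 4"]
        by (intro exI[of _ "inverse (c i $ 4 * c i $ 4)"])
          (simp add: inv vec_eq_iff forall_4 exchange_matrix_mult)
    qed
  qed
  show "lift_class r (invert_coords r (exchange_coords r (invert_coords r (exchange_coords r
      (invert_coords r (exchange_coords r c)))))) = lift_class r c"
  proof (rule lift_class_scaled[symmetric])
    fix i assume i: "i \<in> {1..r}"
    show "\<exists>s. s \<noteq> 0 \<and> invert_coords r (exchange_coords r (invert_coords r (exchange_coords r
      (invert_coords r (exchange_coords r c))))) i = s *s c i"
    proof (cases "i \<le> 5")
      case True
      then show ?thesis using small[OF i] by (intro exI[of _ 1]) simp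
    next
      case False
      then have "i \<in> {6..r}" using i by simp
      then show ?thesis
        using nz[of i] 2[of "c i $ 1" "c i $ 4"] 2[of "c i $ 2" "c i $ 4"] 2[of "c i $ 3" "c i $ 4"]
        by (intro exI[of _ "inverse (c i $ 4 * c i $ 4)"])
          (simp add: inv vec_eq_iff forall_4 exchange_matrix_mult)
    qed
  qed
qed

subsection \<open>Words\<close>

definition word_map :: "nat \<Rightarrow> generator list \<Rightarrow> ('k::field tuple set \<rightharpoonup> 'k tuple set)" where
  "word_map r w = foldr (\<lambda>a f. generator_map r a \<circ>\<^sub>m f) w (identity_map (U_space r))"

lemma word_map_simps [simp]:
  "word_map r [] = identity_map (U_space r)"
  "word_map r (a # w) = generator_map r a \<circ>\<^sub>m word_map r w"
  by (simp_all add: word_map_def)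

lemma word_map_Nil_Some: "word_map r [] x = Some y \<Longrightarrow> y = x"
  by (simp add: identity_map_def restrict_map_def split: if_splits)

lemma word_map_Cons_Some:
  "word_map r (a # w) x = Some y \<Longrightarrow> \<exists>z. word_map r w x = Some z \<and> generator_map r a z = Some y"
  by (simp add: map_comp_Some_iff)

lemma word_map_two:
  assumes "word_map r [a, b] x = Some y"
  obtains z where "generator_map r b x = Some z" "generator_map r a z = Some y"
  using assms word_map_Cons_Some word_map_Nil_Some by metis

lemma word_map_two_append:
  assumes "word_map r (a # b # w) x = Some y"
  obtains u z where "word_map r w x = Some u" "generator_map r b u = Some z" "generator_map r a z = Some y"
  using assms word_map_Cons_Some by metis

lemma word_map_four:
  assumes "word_map r [a, b, a, b] x = Some y"
  obtains u1 u2 u3 where "generator_map r b x = Some u1" "generator_map r a u1 = Some u2"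
    "generator_map r b u2 = Some u3" "generator_map r a u3 = Some y"
proof -
  obtain u2 u3 where u: "word_map r [a, b] x = Some u2" "generator_map r b u2 = Some u3"
    "generator_map r a u3 = Some y" by (rule word_map_two_append[OF assms])
  obtain u1 where "generator_map r b x = Some u1" "generator_map r a u1 = Some u2"
    by (rule word_map_two[OF u(1)])
  with u that show ?thesis by blast
qed

lemma word_map_six:
  assumes "word_map r [a, b, a, b, a, b] x = Some y"
  obtains u1 u2 u3 u4 u5 where "generator_map r b x = Some u1" "generator_map r a u1 = Some u2"
    "generator_map r b u2 = Some u3" "generator_map r a u3 = Some u4"
    "generator_map r b u4 = Some u5" "generator_map r a u5 = Some y"
proof -
  obtain u4 u5 where u: "word_map r [a, b, a, b] x = Some u4" "generator_map r b u4 = Some u5"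
    "generator_map r a u5 = Some y" by (rule word_map_two_append[OF assms])
  obtain u1 u2 u3 where "generator_map r b x = Some u1" "generator_map r a u1 = Some u2"
    "generator_map r b u2 = Some u3" "generator_map r a u3 = Some u4"
    by (rule word_map_four[OF u(1)])
  with u that show ?thesis by blast
qed

text \<open>On lifts this is an identity between permutations.\<close>

lemma swap_swap_relator:
  assumes "i \<noteq> j" "1 \<le> i" "i < r" "1 \<le> j" "j < r" "r \<ge> 4" "x \<in> U_set r"
    and "word_map r (concat (replicate (coxeter_exponent (Tau i) (Tau j)) [Tau i, Tau j])) x = Some y"
  shows "y = x"
proof -
  obtain c where c: "c \<in> lifts r" "x = lift_class r c" using assms(7) by (auto simp: U_set_eq)
  have step: "y' = lift_class r (swap_lift l e) \<and> swap_lift l e \<in> lifts r"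
    if "generator_map r (Tau l) (lift_class r e) = Some y'" "e \<in> lifts r" "1 \<le> l" "l < r" for e l y'
    using swap_map_lift[OF that(3,4,2)] swap_lift_lifts[OF assms(6) that(3,4,2)] that(1) by simp
  have "\<exists>e. e \<in> lifts r \<and> y' = lift_class r e \<and> e = ((\<lambda>c. swap_lift i (swap_lift j c)) ^^ n) c"
    if "word_map r (concat (replicate n [Tau i, Tau j])) x = Some y'" for n y'
    using that
  proof (induction n arbitrary: y')
    case 0
    then show ?case using c word_map_Nil_Some by auto
  next
    case (Suc n)
    then have "word_map r (Tau i # Tau j # concat (replicate n [Tau i, Tau j])) x = Some y'" by simp
    then obtain u z where u: "word_map r (concat (replicate n [Tau i, Tau j])) x = Some u"
      "generator_map r (Tau j) u = Some z" "generator_map r (Tau i) z = Some y'"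
      by (rule word_map_two_append)
    from Suc.IH[OF u(1)] obtain e where e: "e \<in> lifts r" "u = lift_class r e"
      "e = ((\<lambda>c. swap_lift i (swap_lift j c)) ^^ n) c" by blast
    have z: "z = lift_class r (swap_lift j e)" "swap_lift j e \<in> lifts r"
      using step[of j e z] u(2) e assms by auto
    have "y' = lift_class r (swap_lift i (swap_lift j e))" "swap_lift i (swap_lift j e) \<in> lifts r"
      using step[of i "swap_lift j e" y'] u(3) z assms by auto
    then show ?case using e(3) by auto
  qed
  from this[OF assms(8)] have "y = lift_class r (((\<lambda>c. swap_lift i (swap_lift j c)) ^^
      coxeter_exponent (Tau i) (Tau j)) c)" by blast
  also have "((\<lambda>c. swap_lift i (swap_lift j c)) ^^ coxeter_exponent (Tau i) (Tau j)) c = c"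
  proof (cases "joined (Tau i) (Tau j)")
    case True
    then have "j = Suc i \<or> i = Suc j" by simp
    then show ?thesis
      using True assms(1) by (auto simp: coxeter_exponent_def numeral_3_eq_3 swap_lift_def fun_eq_iff)
  next
    case False
    then show ?thesis
      using assms(1) by (auto simp: coxeter_exponent_def numeral_2_eq_2 swap_lift_def fun_eq_iff)
  qed
  finally show ?thesis using c(2) by simp
qed

lemma swap_cremona_commute_relator:
  assumes "r \<ge> 4" "1 \<le> i" "i < r" "i \<noteq> 4"
  shows "word_map r [Tau i, Cr, Tau i, Cr] x = Some y \<Longrightarrow> y = x"
    and "word_map r [Cr, Tau i, Cr, Tau i] x = Some y \<Longrightarrow> y = x"
proof -
  have ti: "Tau i \<in> generators r" using assms by (simp add: Tau_in_generators)
  note inv_t = generator_map_involution[OF assms(1) ti]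
    and inv_s = generator_map_involution[OF assms(1) Cr_in_generators]
  show "y = x" if word: "word_map r [Tau i, Cr, Tau i, Cr] x = Some y"
  proof -
    obtain u1 u2 u3 where u: "generator_map r Cr x = Some u1" "generator_map r (Tau i) u1 = Some u2"
      "generator_map r Cr u2 = Some u3" "generator_map r (Tau i) u3 = Some y"
      by (rule word_map_four[OF word])
    obtain x' where x': "generator_map r (Tau i) x = Some x'" "generator_map r Cr x' = Some u2"
      using swap_map_cremona_map[OF assms, of x u1] u by auto
    then show ?thesis using inv_s[OF x'(2)] inv_t[OF x'(1)] u(3,4) by simp
  qed
  show "y = x" if word: "word_map r [Cr, Tau i, Cr, Tau i] x = Some y"
  proof -
    obtain u1 u2 u3 where u: "generator_map r (Tau i) x = Some u1" "generator_map r Cr u1 = Some u2"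
      "generator_map r (Tau i) u2 = Some u3" "generator_map r Cr u3 = Some y"
      by (rule word_map_four[OF word])
    obtain x' where x': "generator_map r (Tau i) u1 = Some x'" "generator_map r Cr x' = Some u3"
      using swap_map_cremona_map[OF assms, of u1 u2] u by auto
    then show ?thesis using inv_s[OF x'(2)] inv_t[OF u(1)] u(4) by simp
  qed
qed

lemma swap_cremona_braid_relator:
  assumes "r \<ge> 5" "x \<in> U_set r"
  shows "word_map r [Tau 4, Cr, Tau 4, Cr, Tau 4, Cr] x = Some y \<Longrightarrow> y = x"
    and "word_map r [Cr, Tau 4, Cr, Tau 4, Cr, Tau 4] x = Some y \<Longrightarrow> y = x"
proof -
  obtain c where c: "normalized r c" "x = lift_class r c"
    using normalized_representative[OF assms] .
  have s: "\<exists>e'. e' = invert_coords r e \<and> normalized r e' \<and> v = lift_class r e'"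
    if "normalized r e" "u = lift_class r e" "generator_map r Cr u = Some v" for e u v
    using normalized_cremona[OF assms(1) that(1), of v] that by simp
  have t: "\<exists>e'. e' = exchange_coords r e \<and> normalized r e' \<and> v = lift_class r e'"
    if "normalized r e" "u = lift_class r e" "generator_map r (Tau 4) u = Some v" for e u v
    using normalized_exchange[OF assms(1) that(1)] that by simp
  have ex: "normalized r (exchange_coords r c)" using normalized_exchange[OF assms(1) c(1)] ..
  show "y = x" if word: "word_map r [Tau 4, Cr, Tau 4, Cr, Tau 4, Cr] x = Some y"
  proof -
    obtain u1 u2 u3 u4 u5 where u: "generator_map r Cr x = Some u1" "generator_map r (Tau 4) u1 = Some u2"
      "generator_map r Cr u2 = Some u3" "generator_map r (Tau 4) u3 = Some u4"
      "generator_map r Cr u4 = Some u5" "generator_map r (Tau 4) u5 = Some y"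
      by (rule word_map_six[OF word])
    obtain e1 where e1: "e1 = invert_coords r c" "normalized r e1" "u1 = lift_class r e1"
      using s[OF c u(1)] by blast
    obtain e2 where e2: "e2 = exchange_coords r e1" "normalized r e2" "u2 = lift_class r e2"
      using t[OF e1(2,3) u(2)] by blast
    obtain e3 where e3: "e3 = invert_coords r e2" "normalized r e3" "u3 = lift_class r e3"
      using s[OF e2(2,3) u(3)] by blast
    obtain e4 where e4: "e4 = exchange_coords r e3" "normalized r e4" "u4 = lift_class r e4"
      using t[OF e3(2,3) u(4)] by blast
    obtain e5 where e5: "e5 = invert_coords r e4" "normalized r e5" "u5 = lift_class r e5"
      using s[OF e4(2,3) u(5)] by blast
    obtain e6 where e6: "e6 = exchange_coords r e5" "y = lift_class r e6"
      using t[OF e5(2,3) u(6)] by blast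
    have "y = lift_class r (exchange_coords r (invert_coords r (exchange_coords r (invert_coords r
        (exchange_coords r (invert_coords r c))))))"
      using e1(1) e2(1) e3(1) e4(1) e5(1) e6 by simp
    also have "\<dots> = x"
      using braid_cremona_exchange(1)[OF c(1) ex] c(2) by simp
    finally show ?thesis .
  qed
  show "y = x" if word: "word_map r [Cr, Tau 4, Cr, Tau 4, Cr, Tau 4] x = Some y"
  proof -
    obtain u1 u2 u3 u4 u5 where u: "generator_map r (Tau 4) x = Some u1" "generator_map r Cr u1 = Some u2"
      "generator_map r (Tau 4) u2 = Some u3" "generator_map r Cr u3 = Some u4"
      "generator_map r (Tau 4) u4 = Some u5" "generator_map r Cr u5 = Some y"
      by (rule word_map_six[OF word])
    obtain e1 where e1: "e1 = exchange_coords r c" "normalized r e1" "u1 = lift_class r e1"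
      using t[OF c u(1)] by blast
    obtain e2 where e2: "e2 = invert_coords r e1" "normalized r e2" "u2 = lift_class r e2"
      using s[OF e1(2,3) u(2)] by blast
    obtain e3 where e3: "e3 = exchange_coords r e2" "normalized r e3" "u3 = lift_class r e3"
      using t[OF e2(2,3) u(3)] by blast
    obtain e4 where e4: "e4 = invert_coords r e3" "normalized r e4" "u4 = lift_class r e4"
      using s[OF e3(2,3) u(4)] by blast
    obtain e5 where e5: "e5 = exchange_coords r e4" "normalized r e5" "u5 = lift_class r e5"
      using t[OF e4(2,3) u(5)] by blast
    obtain e6 where e6: "e6 = invert_coords r e5" "y = lift_class r e6"
      using s[OF e5(2,3) u(6)] by blast
    have "y = lift_class r (invert_coords r (exchange_coords r (invert_coords r (exchange_coords r
        (invert_coords r (exchange_coords r c))))))"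
      using e1(1) e2(1) e3(1) e4(1) e5(1) e6 by simp
    also have "\<dots> = x"
      using braid_cremona_exchange(2)[OF c(1) ex] c(2) by simp
    finally show ?thesis .
  qed
qed

lemma word_map_relator:
  assumes "r \<ge> 8" "a \<in> generators r" "b \<in> generators r"
    and "word_map r (concat (replicate (coxeter_exponent a b) [a, b])) x = Some y" "x \<in> U_set r"
  shows "y = x"
proof (cases "a = b")
  case True
  then obtain z where "generator_map r a x = Some z" "generator_map r a z = Some y"
    using assms(4) by (auto simp: coxeter_exponent_def elim: word_map_two simp del: word_map_simps)
  then show ?thesis using generator_map_involution[OF _ assms(2), of x z] assms(1) by simp
next
  case False
  have r: "r \<ge> 4" "r \<ge> 5" using assms(1) by simp_all
  note unf = coxeter_exponent_def numeral_3_eq_3 numeral_2_eq_2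
  show ?thesis
  proof (cases a)
    case a: (Tau i)
    then have i: "1 \<le> i" "i < r" using assms(2) by (auto simp: Tau_in_generators)
    show ?thesis
    proof (cases b)
      case (Tau j)
      then show ?thesis
        using swap_swap_relator[of i j r x y] False a i assms(3,4,5) r by (simp add: Tau_in_generators)
    next
      case Cr
      show ?thesis
      proof (cases "i = 4")
        case True
        then show ?thesis
          using swap_cremona_braid_relator(1)[OF r(2) assms(5)] assms(4)
          by (simp add: a Cr unf del: word_map_simps)
      next
        case False
        then show ?thesis
          using swap_cremona_commute_relator(1)[OF r(1) i] assms(4)
          by (simp add: a Cr unf del: word_map_simps)
      qed
    qed
  next
    case a: Cr
    then obtain i where b: "b = Tau i" using False by (cases b) auto
    then have i: "1 \<le> i" "i < r" using assms(3) by (auto simp: Tau_in_generators)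
    show ?thesis
    proof (cases "i = 4")
      case True
      then show ?thesis
        using swap_cremona_braid_relator(2)[OF r(2) assms(5)] assms(4)
        by (simp add: a b unf del: word_map_simps)
    next
      case False
      then show ?thesis
        using swap_cremona_commute_relator(2)[OF r(1) i] assms(4)
        by (simp add: a b unf del: word_map_simps)
    qed
  qed
qed

section \<open>The Coble representation is a well-defined homomorphism\<close>

lemma word_map_birational:
  assumes "infinite (UNIV :: 'k::field set)" "r \<ge> 8" "w \<in> lists (generators r)"
  shows "birational_map (U_space r) (word_map r w :: 'k tuple set \<rightharpoonup> 'k tuple set)"
  using assms(3)
proof (induction w)
  case Nil
  show ?case using birational_map_identity[OF local_functions_U_space] by simp
next
  case (Cons a w)
  then show ?case
    using birational_map_compose[OF local_functions_U_space birational_generator_map[OF assms(1,2)]]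
    by simp
qed

lemma word_map_append:
  assumes "infinite (UNIV :: 'k::field set)" "r \<ge> 8" "u \<in> lists (generators r)" "v \<in> lists (generators r)"
  shows "(word_map r (u @ v) :: 'k tuple set \<rightharpoonup> 'k tuple set) = word_map r u \<circ>\<^sub>m word_map r v"
  using assms(3)
proof (induction u)
  case Nil
  show ?case
    using rational_map_comp_identity(2)[OF birational_map_rational[OF word_map_birational[OF assms(1,2,4)]]]
    by simp
next
  case (Cons a u)
  then show ?case by (simp add: map_comp_assoc')
qed

text \<open>Both sides of a relator are birational, and the composite of the relator fixes every point at
  which it is defined; as its domain is dense, it agrees with the identity.\<close>

lemma agree_word_map_word_rel:
  assumes "infinite (UNIV :: 'k::field set)" "r \<ge> 8" "(u, v) \<in> word_rel r"
  shows "agree (U_space r) (word_map r u :: 'k tuple set \<rightharpoonup> 'k tuple set) (word_map r v)"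
  using assms(3)
proof (induction rule: word_rel.induct)
  case (refl w)
  show ?case using agree_refl[OF birational_map_dom[OF word_map_birational[OF assms(1,2) refl]]] .
next
  case (sym v w)
  show ?case by (rule agree_sym[OF sym.IH])
next
  case (trans u v w)
  show ?case by (rule agree_trans[OF trans.IH])
next
  case (relator a b u v)
  let ?e = "concat (replicate (coxeter_exponent a b) [a, b])"
  let ?m = "\<lambda>w. word_map r w :: 'k tuple set \<rightharpoonup> 'k tuple set"
  have e: "?e \<in> lists (generators r)"
    using word_rel_lists[OF word_rel.relator[OF relator]] by auto
  have bir: "birational_map (U_space r) (?m w)" if "w \<in> lists (generators r)" for w
    by (rule word_map_birational[OF assms(1,2) that])
  have "agree (U_space r) (?m ?e) (identity_map (U_space r))"
    unfolding agree_identity_map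
  proof (intro exI conjI ballI)
    show dom: "dense_open (U_space r) (dom (?m ?e))" by (rule birational_map_dom[OF bir[OF e]])
    fix x assume x: "x \<in> dom (?m ?e)"
    then obtain y where y: "?m ?e x = Some y" by auto
    have "x \<in> U_set r"
      using x dense_open_U_space_openin[OF dom] unfolding openin_U_zariski by blast
    with word_map_relator[OF assms(2) relator(1,2) y] y show "?m ?e x = Some x" by simp
  qed simp
  from agree_compose[OF bir[OF relator(4)] this agree_refl[OF birational_map_dom[OF bir[OF relator(4)]]]]
  have "agree (U_space r) (?m ?e \<circ>\<^sub>m ?m v) (?m v)"
    using rational_map_comp_identity(2)[OF birational_map_rational[OF bir[OF relator(4)]]] by simp
  then have "agree (U_space r) (?m (?e @ v)) (?m v)"
    using word_map_append[OF assms(1,2) e relator(4)] by simp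
  moreover have ev: "?e @ v \<in> lists (generators r)" using e relator(4) by (rule append_in_lists_conv[THEN iffD2, OF conjI])
  ultimately have "agree (U_space r) (?m u \<circ>\<^sub>m ?m (?e @ v)) (?m u \<circ>\<^sub>m ?m v)"
    using agree_compose[OF bir[OF ev] agree_refl[OF birational_map_dom[OF bir[OF relator(3)]]]] by blast
  then show ?case
    using word_map_append[OF assms(1,2) relator(3) ev] word_map_append[OF assms(1,2) relator(3,4)]
    by (simp only:)
qed

lemma word_value_class:
  assumes "infinite (UNIV :: 'k::field set)" "r \<ge> 8" "w \<in> lists (generators r)"
  shows "word_value r w = birational_rel (U_space r) `` {word_map r w :: 'k tuple set \<rightharpoonup> 'k tuple set}"
  using assms(3)
proof (induction w rule: list.induct)
  case Nil
  show ?case by (simp add: word_value_def Bir_def)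
next
  case (Cons a w)
  then have aw: "a \<in> generators r" "w \<in> lists (generators r)" by auto
  have "word_value r (a # w) = (birational_rel (U_space r) `` {generator_map r a :: 'k tuple set \<rightharpoonup> 'k tuple set})
      \<otimes>\<^bsub>Bir (U_space r)\<^esub> word_value r w"
    by (simp add: word_value_def)
  also have "\<dots> = birational_rel (U_space r) `` {generator_map r a \<circ>\<^sub>m word_map r w}"
    unfolding Cons.IH[OF aw(2)]
    by (rule Bir_mult_class[OF local_functions_U_space birational_generator_map[OF assms(1,2) aw(1)]
          word_map_birational[OF assms(1,2) aw(2)]])
  finally show ?case by simp
qed

lemma equiv_word_rel: "equiv (lists (generators r)) (word_rel r)"
  unfolding equiv_def
proof (intro conjI)
  show "refl_on (lists (generators r)) (word_rel r)"
    by (rule refl_onI) (rule word_rel.refl)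
  show "sym (word_rel r)" by (rule symI) (rule word_rel.sym)
  show "trans (word_rel r)" by (rule transI) (rule word_rel.trans)
  show "word_rel r \<subseteq> lists (generators r) \<times> lists (generators r)"
  proof
    fix p assume "p \<in> word_rel r"
    then show "p \<in> lists (generators r) \<times> lists (generators r)"
      using word_rel_lists[of "fst p" "snd p" r] by (cases p) simp
  qed
qed

lemma weyl_group_mult_class:
  assumes "u \<in> lists (generators r)" "v \<in> lists (generators r)"
  shows "(word_rel r `` {u}) \<otimes>\<^bsub>weyl_group r\<^esub> (word_rel r `` {v}) = word_rel r `` {u @ v}"
proof -
  have "(\<Union>u'\<in>word_rel r `` {u}. \<Union>v'\<in>word_rel r `` {v}. word_rel r `` {u' @ v'})
      = (\<Union>u'\<in>word_rel r `` {u}. \<Union>v'\<in>word_rel r `` {v}. word_rel r `` {u @ v})"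
  proof (intro SUP_cong HOL.refl)
    fix u' v' assume "u' \<in> word_rel r `` {u}" "v' \<in> word_rel r `` {v}"
    then have "(u @ v, u' @ v') \<in> word_rel r" by (intro word_rel_append) simp_all
    then show "word_rel r `` {u' @ v'} = word_rel r `` {u @ v}"
      using equiv_class_eq[OF equiv_word_rel] by metis
  qed
  also have "u \<in> word_rel r `` {u}" "v \<in> word_rel r `` {v}"
    using assms word_rel.refl by simp_all
  then have "(\<Union>u'\<in>word_rel r `` {u}. \<Union>v'\<in>word_rel r `` {v}. word_rel r `` {u @ v}) = word_rel r `` {u @ v}"
    by blast
  finally show ?thesis by (simp add: weyl_group_def)
qed

lemma coble_class:
  assumes "infinite (UNIV :: 'k::field set)" "r \<ge> 8" "u \<in> lists (generators r)"
  shows "coble r (word_rel r `` {u}) = birational_rel (U_space r) `` {word_map r u :: 'k tuple set \<rightharpoonup> 'k tuple set}"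
proof -
  have "word_value r v = birational_rel (U_space r) `` {word_map r u :: 'k tuple set \<rightharpoonup> 'k tuple set}"
    if "v \<in> word_rel r `` {u}" for v
  proof -
    have uv: "(u, v) \<in> word_rel r" using that by simp
    have v: "v \<in> lists (generators r)" using word_rel_lists[OF uv] by blast
    show ?thesis
      unfolding word_value_class[OF assms(1,2) v]
        birational_rel_class_eq[OF word_map_birational[OF assms(1,2) v] word_map_birational[OF assms]]
      by (rule agree_sym[OF agree_word_map_word_rel[OF assms(1,2) uv]])
  qed
  moreover have "u \<in> word_rel r `` {u}" using assms(3) word_rel.refl by simp
  ultimately have "word_value r ` (word_rel r `` {u})
      = {birational_rel (U_space r) `` {word_map r u :: 'k tuple set \<rightharpoonup> 'k tuple set}}" by blast
  then show ?thesis by (simp add: coble_def)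
qed

lemma weyl_group_carrierE:
  assumes "A \<in> carrier (weyl_group r)"
  obtains u where "u \<in> lists (generators r)" "A = word_rel r `` {u}"
proof -
  have "A \<in> lists (generators r) // word_rel r" using assms by (simp add: weyl_group_def)
  then show ?thesis using that by (rule quotientE)
qed

proposition coble_hom:
  assumes "infinite (UNIV :: 'k::field set)" "r \<ge> 8"
  shows "(coble r :: generator list set \<Rightarrow> ('k tuple set \<rightharpoonup> 'k tuple set) set)
    \<in> hom (weyl_group r) (Bir (U_space r))"
proof -
  let ?co = "coble r :: generator list set \<Rightarrow> ('k tuple set \<rightharpoonup> 'k tuple set) set"
  have closed: "?co A \<in> carrier (Bir (U_space r))" if A: "A \<in> carrier (weyl_group r)" for A
  proof -
    obtain u where u: "u \<in> lists (generators r)" "A = word_rel r `` {u}"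
      using weyl_group_carrierE[OF A] .
    show ?thesis
      unfolding u(2) coble_class[OF assms u(1)]
      using word_map_birational[OF assms u(1)] by (simp add: Bir_def quotientI)
  qed
  have mult: "?co (A \<otimes>\<^bsub>weyl_group r\<^esub> B) = ?co A \<otimes>\<^bsub>Bir (U_space r)\<^esub> ?co B"
    if A: "A \<in> carrier (weyl_group r)" and B: "B \<in> carrier (weyl_group r)" for A B
  proof -
    obtain u where u: "u \<in> lists (generators r)" "A = word_rel r `` {u}"
      using weyl_group_carrierE[OF A] .
    obtain v where v: "v \<in> lists (generators r)" "B = word_rel r `` {v}"
      using weyl_group_carrierE[OF B] .
    have uv: "u @ v \<in> lists (generators r)" using u(1) v(1) by auto
    show ?thesis
      unfolding u(2) v(2) weyl_group_mult_class[OF u(1) v(1)] coble_class[OF assms u(1)]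
        coble_class[OF assms v(1)] coble_class[OF assms uv] word_map_append[OF assms u(1) v(1)]
      by (rule Bir_mult_class[OF local_functions_U_space word_map_birational[OF assms u(1)]
            word_map_birational[OF assms v(1)], symmetric])
  qed
  show ?thesis using closed mult by (rule homI)
qed

section \<open>Cross-ratios\<close>

text \<open>Each index occurs equally often in numerator and denominator, so the quotient is a function on
  \<open>U\<^sub>r\<close>. Geometrically it is the cross-ratio of four planes through the line joining the
  points \<open>a\<close> and \<open>b\<close>.\<close>

definition cross_ratio :: "nat \<Rightarrow> nat \<Rightarrow> nat \<Rightarrow> nat \<Rightarrow> nat \<Rightarrow> nat \<Rightarrow> (nat \<Rightarrow> 'k::field ^ 4) \<Rightarrow> 'k" where
  "cross_ratio a b c d i j e =
    (bracket e a b c i * bracket e a b d j) / (bracket e a b c j * bracket e a b d i)"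

lemma cross_ratio_proj_equiv:
  assumes "proj_equiv r e f"
    and "a \<in> {1..r}" "b \<in> {1..r}" "c \<in> {1..r}" "d \<in> {1..r}" "i \<in> {1..r}" "j \<in> {1..r}"
  shows "cross_ratio a b c d i j f = cross_ratio a b c d i j e"
proof -
  obtain A \<mu> where A: "invertible A" and \<mu>: "\<And>i. i \<in> {1..r} \<Longrightarrow> \<mu> i \<noteq> 0 \<and> f i = \<mu> i *s (A *v e i)"
    using assms(1) unfolding proj_equiv_def by blast
  have f: "\<And>i. i \<in> {1..r} \<Longrightarrow> f i = \<mu> i *s (A *v e i)" using \<mu> by blast
  let ?s = "\<mu> a * \<mu> b * \<mu> c * \<mu> i * det A * (\<mu> a * \<mu> b * \<mu> d * \<mu> j * det A)"
  have br: "bracket f p q u v = \<mu> p * \<mu> q * \<mu> u * \<mu> v * det A * bracket e p q u v"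
    if "p \<in> {1..r}" "q \<in> {1..r}" "u \<in> {1..r}" "v \<in> {1..r}" for p q u v
    by (rule bracket_transform[OF _ that]) (rule f)
  have s: "?s \<noteq> 0" using A \<mu> assms(2-) by (simp add: invertible_det_nz)
  have "cross_ratio a b c d i j f = (?s * (bracket e a b c i * bracket e a b d j))
      / (?s * (bracket e a b c j * bracket e a b d i))"
    unfolding cross_ratio_def br[OF assms(2,3,4,6)] br[OF assms(2,3,5,7)] br[OF assms(2,3,4,7)]
      br[OF assms(2,3,5,6)] by (simp only: mult_ac)
  also have "\<dots> = cross_ratio a b c d i j e"
    unfolding cross_ratio_def using s by (rule nonzero_mult_divide_mult_cancel_left)
  finally show ?thesis .
qed

text \<open>Triviality of \<open>w\<close> only gives \<open>w x = x\<close> on some dense set, which may miss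
  the configuration of interest. But the cross-ratio \<open>h\<close> and \<open>h \<circ> w\<close> are regular
  wherever \<open>w\<close> is defined, so the identity principle extends their agreement to the whole
  domain.\<close>

lemma cross_ratio_invariant:
  fixes e f :: "nat \<Rightarrow> 'k::field ^ 4"
  assumes inf: "infinite (UNIV :: 'k set)" and r: "r \<ge> 8" and w: "w \<in> lists (generators r)"
    and triv: "agree (U_space r) (word_map r w :: 'k tuple set \<rightharpoonup> 'k tuple set) (identity_map (U_space r))"
    and e: "e \<in> lifts r" and f: "f \<in> lifts r"
    and ef: "word_map r w (lift_class r e) = Some (lift_class r f)"
    and abcdij: "a \<in> {1..r}" "b \<in> {1..r}" "c \<in> {1..r}" "d \<in> {1..r}" "i \<in> {1..r}" "j \<in> {1..r}"
      "distinct [a, b, c, d, i, j]"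
  shows "cross_ratio a b c d i j f = cross_ratio a b c d i j e"
proof -
  have r4: "r \<ge> 4" using r by simp
  let ?F = "word_map r w :: 'k tuple set \<rightharpoonup> 'k tuple set"
  let ?cr = "cross_ratio a b c d i j :: (nat \<Rightarrow> 'k ^ 4) \<Rightarrow> 'k"
  let ?P = "\<lambda>V :: 'k tuple set set. {c \<in> lifts r. lift_class r c \<in> V}"
  \<comment> \<open>The cross-ratio as a function on \<open>U\<^sub>r\<close>, evaluated at an arbitrary lift.\<close>
  define h where "h x = ?cr (SOME c. c \<in> lifts r \<and> lift_class r c = x)" for x
  have h: "h (lift_class r c) = ?cr c" if "c \<in> lifts r" for c
  proof -
    let ?c = "SOME c'. c' \<in> lifts r \<and> lift_class r c' = lift_class r c"
    have "?c \<in> lifts r \<and> lift_class r ?c = lift_class r c"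
      by (rule someI[of _ c]) (simp add: that)
    then have "proj_equiv r c ?c"
      using lifts_nonzero[OF that] by (intro lift_class_proj_equiv) simp_all
    then show ?thesis
      unfolding h_def by (rule cross_ratio_proj_equiv[OF _ abcdij(1-6)])
  qed
  have bir: "rational_map (U_space r) ?F"
    by (rule birational_map_rational[OF word_map_birational[OF inf r w]])
  have reg: "h \<circ> lift_class r \<in> affine_regular r V"
    if V: "openin (affine_zariski r) V" "V \<subseteq> lifts r" for V
  proof (rule affine_regular_cong)
    show "?cr \<in> affine_regular r V"
      unfolding cross_ratio_def
    proof (rule affine_regular_quotient[OF V(1)])
      show "(\<lambda>e. bracket e a b c i * bracket e a b d j) \<in> poly_fun r"
        "(\<lambda>e. bracket e a b c j * bracket e a b d i) \<in> poly_fun r"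
        by (intro poly_fun.mult poly_fun_bracket abcdij)+
      fix e :: "nat \<Rightarrow> 'k ^ 4" assume "e \<in> V"
      then have e: "e \<in> lifts r" using V(2) by blast
      show "bracket e a b c j * bracket e a b d i \<noteq> 0"
        using lifts_bracket[OF e r4, of a b c j] lifts_bracket[OF e r4, of a b d i] abcdij by simp
    qed
    show "?cr c = (h \<circ> lift_class r) c" if "c \<in> V" for c
      using h[of c] that V(2) by auto
  qed
  have dense: "dense_open (U_space r) (dom ?F)" by (rule rational_mapD(1)[OF bir])
  have ran: "the (?F x) \<in> U_set r" if "x \<in> dom ?F" for x
    using rational_mapD(2)[OF bir] that unfolding U_space_simps topspace_U_zariski[OF r4] by auto
  have Uopen: "openin (zariski (U_space r)) (U_set r :: 'k tuple set set)"
    unfolding U_space_simps using openin_topspace[of "U_zariski r"] topspace_U_zariski[OF r4] by metis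
  have domopen: "openin (affine_zariski r) (?P (dom ?F))"
    using dense_open_U_space_openin[OF dense] unfolding openin_U_zariski by blast
  have hU: "h \<in> regular (U_space r) (U_set r)"
  proof -
    have "?P (U_set r) = lifts r" by (auto simp: U_set_eq)
    then show ?thesis
      using reg[OF openin_lifts[OF r4] subset_refl] by (simp add: U_space_simps comp_def)
  qed
  have "{x \<in> dom ?F. the (?F x) \<in> U_set r} = dom ?F" using ran by blast
  with rational_mapD(5)[OF bir Uopen hU]
  have g: "(\<lambda>c. h (the (?F (lift_class r c)))) \<in> affine_regular r (?P (dom ?F))"
    by (simp add: U_space_simps)
  obtain D where D: "dense_open (U_space r) D" "D \<subseteq> dom ?F" "\<forall>x\<in>D. ?F x = Some x"
    using triv unfolding agree_identity_map by blast
  have Dopen: "openin (affine_zariski r) (?P D)"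
    using dense_open_U_space_openin[OF D(1)] unfolding openin_U_zariski by blast
  have "D \<inter> U_set r \<noteq> {}"
    using dense_open_meets[OF D(1) Uopen] e by (auto simp: U_set_eq)
  then have Dne: "?P D \<noteq> {}" by (auto simp: U_set_eq)
  have eV: "e \<in> ?P (dom ?F)" using e ef by auto
  have "h (the (?F (lift_class r e))) = (h \<circ> lift_class r) e"
  proof (rule affine_regular_identity[OF inf g reg[OF domopen] Dopen Dne _ eV])
    show "?P (dom ?F) \<subseteq> lifts r" by blast
    show "h (the (?F (lift_class r c))) = (h \<circ> lift_class r) c" if "c \<in> ?P D" for c
      using that D(3) by simp
  qed
  then show ?thesis using ef h[OF e] h[OF f] by simp
qed

definition root_product :: "nat \<Rightarrow> (nat \<Rightarrow> int) list \<Rightarrow> (nat \<Rightarrow> 'k::field) \<Rightarrow> 'k" where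
  "root_product r L X = (\<Prod>n\<leftarrow>L. 1 - character r n X)"

text \<open>The divisor of a cross-ratio on the torus of nodal configurations: it vanishes where one of the
  zero roots takes the value \<open>1\<close>, and has a pole where one of the pole roots does.\<close>

definition zero_roots :: "nat \<Rightarrow> nat \<Rightarrow> nat \<Rightarrow> nat \<Rightarrow> nat \<Rightarrow> nat \<Rightarrow> (nat \<Rightarrow> int) list" where
  "zero_roots a b c d i j =
    [difference_root i c, plane_root a b c i, difference_root j d, plane_root a b d j]"

definition pole_roots :: "nat \<Rightarrow> nat \<Rightarrow> nat \<Rightarrow> nat \<Rightarrow> nat \<Rightarrow> nat \<Rightarrow> (nat \<Rightarrow> int) list" where
  "pole_roots a b c d i j =
    [difference_root j c, plane_root a b c j, difference_root i d, plane_root a b d i]"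

text \<open>All Vandermonde factors that involve \<open>a\<close> or \<open>b\<close> cancel.\<close>

lemma cross_ratio_nodal:
  assumes r: "r \<ge> 4" and X: "X \<in> torus" and lift: "nodal r X \<in> lifts r"
    and *: "a \<in> {1..r}" "b \<in> {1..r}" "c \<in> {1..r}" "d \<in> {1..r}" "i \<in> {1..r}" "j \<in> {1..r}"
      "distinct [a, b, c, d, i, j]"
  shows "root_product r (pole_roots a b c d i j) X \<noteq> 0"
    and "cross_ratio a b c d i j (nodal r X)
      = root_product r (zero_roots a b c d i j) X / root_product r (pole_roots a b c d i j) X"
proof -
  have nz: "X k \<noteq> 0" for k using X by (simp add: torus_def)
  have num: "bracket (nodal r X) a b c i = nodal_bracket (X 0) (X a) (X b) (X c) (X i)"
    "bracket (nodal r X) a b d j = nodal_bracket (X 0) (X a) (X b) (X d) (X j)"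
    "bracket (nodal r X) a b c j = nodal_bracket (X 0) (X a) (X b) (X c) (X j)"
    "bracket (nodal r X) a b d i = nodal_bracket (X 0) (X a) (X b) (X d) (X i)"
    using * by (intro bracket_nodal; simp)+
  have "bracket (nodal r X) a b c j \<noteq> 0" "bracket (nodal r X) a b d i \<noteq> 0"
    using * by (intro lifts_bracket[OF lift r]; simp)+
  then have nb: "nodal_bracket (X 0) (X a) (X b) (X c) (X j) \<noteq> 0"
    "nodal_bracket (X 0) (X a) (X b) (X d) (X i) \<noteq> 0" unfolding num .
  have diff: "character r (difference_root i c) X = X i / X c" "character r (difference_root j d) X = X j / X d"
    "character r (difference_root j c) X = X j / X c" "character r (difference_root i d) X = X i / X d"
    using * by (intro character_difference_root[OF X]; auto)+
  have plane: "character r (plane_root a b c i) X = X 0 * X a * X b * X c * X i"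
    "character r (plane_root a b d j) X = X 0 * X a * X b * X d * X j"
    "character r (plane_root a b c j) X = X 0 * X a * X b * X c * X j"
    "character r (plane_root a b d i) X = X 0 * X a * X b * X d * X i"
    using * by (intro character_plane_root; auto)+
  have N: "root_product r (zero_roots a b c d i j) X
      = (X c - X i) / X c * (1 - X 0 * X a * X b * X c * X i) * ((X d - X j) / X d)
        * (1 - X 0 * X a * X b * X d * X j)"
    unfolding root_product_def zero_roots_def using nz by (simp add: diff plane diff_divide_distrib mult.assoc)
  have D: "root_product r (pole_roots a b c d i j) X
      = (X c - X j) / X c * (1 - X 0 * X a * X b * X c * X j) * ((X d - X i) / X d)
        * (1 - X 0 * X a * X b * X d * X i)"
    unfolding root_product_def pole_roots_def using nz by (simp add: diff plane diff_divide_distrib mult.assoc)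
  show Dnz: "root_product r (pole_roots a b c d i j) X \<noteq> 0"
    using nb nz unfolding D nodal_bracket_def by auto
  \<comment> \<open>The zero and pole products with denominators \<open>X c * X d\<close> cleared; \<open>W\<close> collects the factors
    of a bracket that involve a difference with \<open>a\<close> or \<open>b\<close>.\<close>
  define N' where "N' = (X c - X i) * (1 - X 0 * X a * X b * X c * X i)
    * ((X d - X j) * (1 - X 0 * X a * X b * X d * X j))"
  define D' where "D' = (X c - X j) * (1 - X 0 * X a * X b * X c * X j)
    * ((X d - X i) * (1 - X 0 * X a * X b * X d * X i))"
  define W where "W p q = (X b - X a) * (X p - X a) * (X q - X a) * (X p - X b) * (X q - X b)" for p q
  have nbW: "nodal_bracket (X 0) (X a) (X b) (X p) (X q)
      = W p q * ((X p - X q) * (1 - X 0 * X a * X b * X p * X q))" for p q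
  proof -
    have "(X q - X p) * (X 0 * X a * X b * X p * X q - 1) = (X p - X q) * (1 - X 0 * X a * X b * X p * X q)"
      by (simp only: minus_mult_minus[of "X p - X q" "1 - X 0 * X a * X b * X p * X q", symmetric] minus_diff_eq)
    then show ?thesis unfolding nodal_bracket_def W_def by (simp only: mult.assoc)
  qed
  have num': "nodal_bracket (X 0) (X a) (X b) (X c) (X i) * nodal_bracket (X 0) (X a) (X b) (X d) (X j)
      = (W c j * W d i) * N'"
    unfolding nbW N'_def W_def by (simp only: mult_ac)
  have den': "nodal_bracket (X 0) (X a) (X b) (X c) (X j) * nodal_bracket (X 0) (X a) (X b) (X d) (X i)
      = (W c j * W d i) * D'"
    unfolding nbW D'_def by (simp only: mult_ac)
  have W: "W c j * W d i \<noteq> 0" using nb unfolding nbW by simp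
  have "root_product r (zero_roots a b c d i j) X = N' / (X c * X d)"
    unfolding N N'_def by simp
  moreover have "root_product r (pole_roots a b c d i j) X = D' / (X c * X d)"
    unfolding D D'_def by simp
  moreover have "cross_ratio a b c d i j (nodal r X) = N' / D'"
    unfolding cross_ratio_def num num' den' using W by (rule nonzero_mult_divide_mult_cancel_left)
  ultimately show "cross_ratio a b c d i j (nodal r X)
      = root_product r (zero_roots a b c d i j) X / root_product r (pole_roots a b c d i j) X"
    using nz by simp
qed

subsection \<open>Words acting on nodal configurations\<close>

text \<open>If none of these roots takes the value \<open>1\<close> at a parameter, then all configurations
  along the word are in general position.\<close>

fun visited_roots :: "nat \<Rightarrow> generator list \<Rightarrow> (nat \<Rightarrow> int) set" where
  "visited_roots r [] = degeneracy_roots r"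
| "visited_roots r (a # w) = lattice_action (rev (a # w)) ` degeneracy_roots r \<union> visited_roots r w"

lemma finite_visited_roots: "finite (visited_roots r w)"
  by (induction w) (auto intro: finite_degeneracy_roots)

lemma visited_roots_norm:
  assumes "r \<ge> 8" "w \<in> lists (generators r)" "n \<in> visited_roots r w"
  shows "lattice_form r n n = 2"
  using assms(2,3)
proof (induction w rule: list.induct)
  case Nil
  then show ?case using degeneracy_roots_norm by simp
next
  case (Cons a w)
  then have aw: "rev (a # w) \<in> lists (generators r)" "w \<in> lists (generators r)" by auto
  from Cons.prems(2) consider "n \<in> lattice_action (rev (a # w)) ` degeneracy_roots r" | "n \<in> visited_roots r w"
    unfolding visited_roots.simps by blast
  then show ?case
  proof cases
    case 1
    then obtain m where "m \<in> degeneracy_roots r" "n = lattice_action (rev (a # w)) m" by blast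
    then show ?thesis using lattice_form_action[OF aw(1) assms(1)] degeneracy_roots_norm by metis
  next
    case 2
    then show ?thesis using Cons.IH aw(2) by blast
  qed
qed

lemma word_map_nodal:
  assumes r: "r \<ge> 4" and w: "w \<in> lists (generators r)" and X: "X \<in> torus"
    and generic: "\<And>n. n \<in> visited_roots r w \<Longrightarrow> character r n X \<noteq> 1"
  shows "nodal r X \<in> lifts r \<and> nodal r (torus_action w X) \<in> lifts r \<and>
    word_map r w (lift_class r (nodal r X)) = Some (lift_class r (nodal r (torus_action w X)))"
  using w generic
proof (induction w rule: list.induct)
  case Nil
  have "nodal r X \<in> lifts r" using Nil by (intro nodal_lifts[OF r X]) simp
  moreover from this have "lift_class r (nodal r X) \<in> U_set r" by (simp add: U_set_eq)
  ultimately show ?case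
    by (simp add: identity_map_def U_space_simps topspace_U_zariski[OF r])
next
  case (Cons a w)
  have aw: "a \<in> generators r" "w \<in> lists (generators r)" "a # w \<in> lists (generators r)"
    using Cons.prems(1) by auto
  have IH: "nodal r X \<in> lifts r" "nodal r (torus_action w X) \<in> lifts r"
    "word_map r w (lift_class r (nodal r X)) = Some (lift_class r (nodal r (torus_action w X)))"
    using Cons.IH[OF aw(2)] Cons.prems(2) unfolding visited_roots.simps by blast+
  have lift: "nodal r (torus_action (a # w) X) \<in> lifts r"
  proof (rule nodal_lifts[OF r torus_action_torus[OF X]])
    fix n assume "n \<in> degeneracy_roots r"
    then have "lattice_action (rev (a # w)) n \<in> visited_roots r (a # w)"
      unfolding visited_roots.simps by blast
    then show "character r n (torus_action (a # w) X) \<noteq> 1"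
      unfolding character_torus_action[OF X aw(3) r] by (rule Cons.prems(2))
  qed
  have "generator_map r a (lift_class r (nodal r (torus_action w X)))
      = Some (lift_class r (nodal r (torus_map a (torus_action w X))))"
    using lift by (intro generator_map_nodal[OF r aw(1) torus_action_torus[OF X] IH(2)]) simp
  then show ?case using IH lift by simp
qed

lemma root_product_torus_action:
  assumes "X \<in> torus" "w \<in> lists (generators r)" "r \<ge> 4"
  shows "root_product r L (torus_action w X) = root_product r (map (lattice_action (rev w)) L) X"
  by (simp add: root_product_def comp_def character_torus_action[OF assms])

lemma trivial_word_root_identity:
  fixes X :: "nat \<Rightarrow> 'k::field"
  assumes inf: "infinite (UNIV :: 'k set)" and r: "r \<ge> 8" and w: "w \<in> lists (generators r)"
    and triv: "agree (U_space r) (word_map r w :: 'k tuple set \<rightharpoonup> 'k tuple set) (identity_map (U_space r))"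
    and X: "X \<in> torus" and generic: "\<And>n. n \<in> visited_roots r w \<Longrightarrow> character r n X \<noteq> 1"
    and *: "a \<in> {1..r}" "b \<in> {1..r}" "c \<in> {1..r}" "d \<in> {1..r}" "i \<in> {1..r}" "j \<in> {1..r}"
      "distinct [a, b, c, d, i, j]"
  shows "root_product r (zero_roots a b c d i j) X
      * root_product r (map (lattice_action (rev w)) (pole_roots a b c d i j)) X
    = root_product r (map (lattice_action (rev w)) (zero_roots a b c d i j)) X
      * root_product r (pole_roots a b c d i j) X"
proof -
  have r4: "r \<ge> 4" using r by simp
  let ?Y = "torus_action w X"
  have Y: "?Y \<in> torus" by (rule torus_action_torus[OF X])
  have lifts: "nodal r X \<in> lifts r" "nodal r ?Y \<in> lifts r"
    and map: "word_map r w (lift_class r (nodal r X)) = Some (lift_class r (nodal r ?Y))"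
    using word_map_nodal[OF r4 w X generic] by blast+
  have "cross_ratio a b c d i j (nodal r ?Y) = cross_ratio a b c d i j (nodal r X)"
    by (rule cross_ratio_invariant[OF inf r w triv lifts map *])
  then show ?thesis
    using cross_ratio_nodal[OF r4 X lifts(1) *] cross_ratio_nodal[OF r4 Y lifts(2) *]
    unfolding root_product_torus_action[OF X w r4] by (simp add: frac_eq_eq mult.commute)
qed

section \<open>Specialization to one-parameter subgroups\<close>

text \<open>Laurent polynomials in one variable, as functions on the nonzero scalars.\<close>

definition laurent :: "('k::field \<Rightarrow> 'k) \<Rightarrow> bool" where
  "laurent f \<longleftrightarrow> (\<exists>K p. \<forall>s. s \<noteq> 0 \<longrightarrow> s ^ K * f s = poly p s)"

lemma laurent_const: "laurent (\<lambda>s. a)"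
  unfolding laurent_def by (intro exI[of _ 0] exI[of _ "[:a:]"]) simp

lemma laurent_power_int: "laurent (\<lambda>s. s powi n)"
proof (cases "n \<ge> 0")
  case True
  then show ?thesis
    unfolding laurent_def
    by (intro exI[of _ 0] exI[of _ "monom 1 (nat n)"]) (simp add: poly_monom power_int_def)
next
  case False
  then show ?thesis
    unfolding laurent_def
    by (intro exI[of _ "nat (- n)"] exI[of _ "[:1:]"])
      (simp add: power_int_def power_inverse)
qed

lemma laurent_mult:
  assumes "laurent f" "laurent g"
  shows "laurent (\<lambda>s. f s * g s)"
proof -
  from assms(1) obtain K p where p: "\<forall>s. s \<noteq> 0 \<longrightarrow> s ^ K * f s = poly p s"
    unfolding laurent_def by (elim exE)
  from assms(2) obtain L q where q: "\<forall>s. s \<noteq> 0 \<longrightarrow> s ^ L * g s = poly q s"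
    unfolding laurent_def by (elim exE)
  have "s ^ (K + L) * (f s * g s) = poly (p * q) s" if "s \<noteq> 0" for s
  proof -
    have "s ^ (K + L) * (f s * g s) = (s ^ K * f s) * (s ^ L * g s)"
      by (simp only: power_add mult_ac)
    then show ?thesis using p q that by simp
  qed
  then show ?thesis unfolding laurent_def by (intro exI allI impI)
qed

lemma laurent_diff:
  assumes "laurent f" "laurent g"
  shows "laurent (\<lambda>s. f s - g s)"
proof -
  from assms(1) obtain K p where p: "\<forall>s. s \<noteq> 0 \<longrightarrow> s ^ K * f s = poly p s"
    unfolding laurent_def by (elim exE)
  from assms(2) obtain L q where q: "\<forall>s. s \<noteq> 0 \<longrightarrow> s ^ L * g s = poly q s"
    unfolding laurent_def by (elim exE)
  have "s ^ (K + L) * (f s - g s) = poly (monom 1 L * p - monom 1 K * q) s" if "s \<noteq> 0" for s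
  proof -
    have "s ^ (K + L) * (f s - g s) = s ^ L * (s ^ K * f s) - s ^ K * (s ^ L * g s)"
      by (simp only: power_add right_diff_distrib mult_ac)
    then show ?thesis using p q that by (simp add: poly_monom)
  qed
  then show ?thesis unfolding laurent_def by (intro exI allI impI)
qed

lemma laurent_prod_list:
  assumes "\<And>n. n \<in> set L \<Longrightarrow> laurent (f n)"
  shows "laurent (\<lambda>s. \<Prod>n\<leftarrow>L. f n s)"
  using assms by (induction L) (simp_all add: laurent_const laurent_mult)

lemma laurent_zero:
  assumes "laurent f" "infinite {s. s \<noteq> 0 \<and> f s = 0}" "s \<noteq> 0"
  shows "f s = 0"
proof -
  obtain K p where p: "\<And>s. s \<noteq> 0 \<Longrightarrow> s ^ K * f s = poly p s" using assms(1) unfolding laurent_def by blast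
  have "{s. s \<noteq> 0 \<and> f s = 0} \<subseteq> {s. poly p s = 0}"
  proof
    fix s assume "s \<in> {s. s \<noteq> 0 \<and> f s = 0}"
    then show "s \<in> {s. poly p s = 0}" using p[of s] by simp
  qed
  then have "infinite {s. poly p s = 0}" using assms(2) infinite_super by blast
  then have "p = 0" using poly_roots_finite by blast
  then show ?thesis using p[OF assms(3)] assms(3) by simp
qed

lemma finite_power_int_eq:
  assumes "n \<noteq> (0 :: int)"
  shows "finite {s :: 'k::field. s \<noteq> 0 \<and> s powi n = c}"
proof (cases "{s :: 'k. s \<noteq> 0 \<and> s powi n = c} = {}")
  case False
  then obtain u :: 'k where u: "u \<noteq> 0" "u powi n = c" by blast
  have "{s :: 'k. s \<noteq> 0 \<and> s powi n = c} \<subseteq> (\<lambda>t. t * u) ` {t. t powi n = 1}"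
  proof
    fix s :: 'k assume "s \<in> {s. s \<noteq> 0 \<and> s powi n = c}"
    then have "s powi n = u powi n" using u by simp
    moreover have "u powi n \<noteq> 0" using u(1) by (simp add: power_int_eq_0_iff)
    ultimately have "(s / u) powi n = 1" by (simp add: power_int_divide_distrib)
    then show "s \<in> (\<lambda>t. t * u) ` {t. t powi n = 1}" using u by (intro image_eqI[of _ _ "s / u"]) simp_all
  qed
  then show ?thesis using finite_roots_of_unity[OF assms] finite_surj by blast
next
  case True
  then show ?thesis by (simp only: finite.emptyI)
qed

text \<open>If all two-by-two minors of \<open>(\<alpha>, \<beta>)\<close> vanish, the two vectors are
  proportional, and as they have the same nonzero norm they agree up to sign. A nonzero minor gives
  \<open>v\<close> directly.\<close>

lemma nonproportional_roots:
  assumes "lattice_form r \<alpha> \<alpha> = 2" "lattice_form r \<beta> \<beta> = 2"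
    and supp: "\<And>i. i > r \<Longrightarrow> \<alpha> i = 0" "\<And>i. i > r \<Longrightarrow> \<beta> i = 0"
    and ne: "\<beta> \<noteq> \<alpha>" "\<beta> \<noteq> (\<lambda>i. - \<alpha> i)"
  shows "\<exists>v. dot r v \<alpha> = 0 \<and> dot r v \<beta> \<noteq> 0"
proof (cases "\<exists>i\<in>{0..r}. \<exists>j\<in>{0..r}. \<alpha> i * \<beta> j \<noteq> \<alpha> j * \<beta> i")
  case True
  then obtain i j where ij: "i \<in> {0..r}" "j \<in> {0..r}" "\<alpha> i * \<beta> j \<noteq> \<alpha> j * \<beta> i" by blast
  define v where "v = (\<lambda>k. (if k = i then \<alpha> j else 0) - (if k = j then \<alpha> i else 0))"
  have "dot r v n = \<alpha> j * n i - \<alpha> i * n j" for n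
  proof -
    have "dot r v n = (\<Sum>k = 0..r. (if k = i then \<alpha> j * n k else 0) - (if k = j then \<alpha> i * n k else 0))"
      unfolding dot_def v_def by (intro sum.cong) auto
    then show ?thesis using ij by (simp add: sum_subtractf)
  qed
  then show ?thesis using ij(3) by (intro exI[of _ v]) simp
next
  case False
  then have pr: "\<And>i j. i \<in> {0..r} \<Longrightarrow> j \<in> {0..r} \<Longrightarrow> \<alpha> i * \<beta> j = \<alpha> j * \<beta> i" by blast
  obtain i where i: "i \<in> {0..r}" "\<alpha> i \<noteq> 0" using root_nonzero[OF assms(1)] by blast
  have "\<alpha> i * \<alpha> i * lattice_form r \<beta> \<beta> = lattice_form r (\<lambda>j. \<alpha> i * \<beta> j) (\<lambda>j. \<alpha> i * \<beta> j)"
    by (simp add: lattice_form_def sum_distrib_left algebra_simps)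
  also have "\<dots> = lattice_form r (\<lambda>j. \<beta> i * \<alpha> j) (\<lambda>j. \<beta> i * \<alpha> j)"
    unfolding lattice_form_def using pr[OF i(1)] by (simp add: mult.commute)
  also have "\<dots> = \<beta> i * \<beta> i * lattice_form r \<alpha> \<alpha>"
    by (simp add: lattice_form_def sum_distrib_left algebra_simps)
  finally have "\<alpha> i * \<alpha> i = \<beta> i * \<beta> i" using assms(1,2) by simp
  then have "\<beta> i = \<alpha> i \<or> \<beta> i = - \<alpha> i" using square_eq_iff[of "\<beta> i" "\<alpha> i"] by simp
  then show ?thesis
  proof
    assume e: "\<beta> i = \<alpha> i"
    have "\<beta> j = \<alpha> j" for j
      using pr[OF i(1), of j] i(2) e supp[of j] by (cases "j \<le> r") auto
    then show ?thesis using ne(1) by blast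
  next
    assume e: "\<beta> i = - \<alpha> i"
    have "\<beta> j = - \<alpha> j" for j
    proof (cases "j \<le> r")
      case True
      then have "\<alpha> i * \<beta> j = \<alpha> i * (- \<alpha> j)" using pr[OF i(1), of j] e by simp
      then show ?thesis by (rule mult_left_cancel[OF i(2), THEN iffD1])
    qed (use supp[of j] in simp)
    then show ?thesis using ne(2) by blast
  qed
qed

definition support_in :: "nat \<Rightarrow> (nat \<Rightarrow> int) \<Rightarrow> bool" where
  "support_in r n \<longleftrightarrow> (\<forall>i>r. n i = 0)"

text \<open>Comparison of divisors: the left-hand side vanishes where \<open>\<alpha>\<close> takes the value
  \<open>1\<close>, so some factor on the right-hand side must vanish on this whole subgroup. Otherwise there is
  a cocharacter \<open>v\<close> that is orthogonal to \<open>\<alpha>\<close> but to none of the roots on the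
  right, and on the curve \<open>X\<^sub>i = t\<^bsup>v i\<^esup> s\<^bsup>u i\<^esup>\<close>, with
  \<open>u\<close> generic and \<open>t\<close> fixed, the identity holds for all but finitely many
  \<open>s\<close>, hence also at \<open>s = 1\<close>, where only the left-hand side vanishes.\<close>

lemma root_identity_common_factor:
  fixes N D N' D' :: "(nat \<Rightarrow> int) list" and S :: "(nat \<Rightarrow> int) set"
  assumes inf: "infinite (UNIV :: 'k::field set)"
    and S: "finite S" "\<And>n. n \<in> S \<Longrightarrow> lattice_form r n n = 2"
    and root: "\<And>n. n \<in> set N' \<union> set D \<Longrightarrow> lattice_form r n n = 2 \<and> support_in r n"
    and \<alpha>: "\<alpha> \<in> set N" "lattice_form r \<alpha> \<alpha> = 2" "support_in r \<alpha>"
    and eq: "\<And>X :: nat \<Rightarrow> 'k. X \<in> torus \<Longrightarrow> (\<And>n. n \<in> S \<Longrightarrow> character r n X \<noteq> 1) \<Longrightarrow>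
      root_product r N X * root_product r D' X = root_product r N' X * root_product r D X"
  shows "\<exists>\<beta>\<in>set N' \<union> set D. \<beta> = \<alpha> \<or> \<beta> = (\<lambda>i. - \<alpha> i)"
proof (rule ccontr)
  assume none: "\<not> ?thesis"
  let ?T = "set N' \<union> set D"
  have "\<exists>v. dot r v \<alpha> = 0 \<and> dot r v n \<noteq> 0" if n: "n \<in> ?T" for n
    using none n root[OF n] \<alpha>(2,3) unfolding support_in_def
    by (intro nonproportional_roots) blast+
  from common_cocharacter[of ?T, OF _ this] obtain v
    where v: "dot r v \<alpha> = 0" "\<And>n. n \<in> ?T \<Longrightarrow> dot r v n \<noteq> 0" by blast
  obtain u where u: "\<And>n. n \<in> S \<Longrightarrow> dot r u n \<noteq> 0" using generic_cocharacter[OF S] by blast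
  have "finite (dot r v ` ?T)" "0 \<notin> dot r v ` ?T" using v(2) by auto
  then obtain t :: 'k where t: "t \<noteq> 0" "\<And>k. k \<in> dot r v ` ?T \<Longrightarrow> t powi k \<noteq> 1"
    using generic_scalar[OF inf] by blast
  define X where "X s = (\<lambda>i. t powi v i * s powi u i)" for s :: 'k
  have char: "character r n (X s) = t powi dot r v n * s powi dot r u n" if "s \<noteq> 0" for s n
  proof -
    have "character r n (X s) = character r n (\<lambda>i. t powi v i) * character r n (\<lambda>i. s powi u i)"
      by (simp add: character_def X_def power_int_mult_distrib prod.distrib)
    then show ?thesis by (simp add: character_one_parameter[OF t(1)] character_one_parameter[OF that])
  qed
  have rp: "root_product r L (X s) = (\<Prod>n\<leftarrow>L. 1 - t powi dot r v n * s powi dot r u n)" if "s \<noteq> 0" for s L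
    by (simp add: root_product_def char[OF that])
  \<comment> \<open>The product at \<open>X s\<close>, written as a Laurent polynomial in \<open>s\<close>.\<close>
  define f where "f L s = (\<Prod>n\<leftarrow>L. 1 - t powi dot r v n * s powi dot r u n)" for L and s :: 'k
  have f: "laurent (f L)" for L
    unfolding f_def by (intro laurent_prod_list laurent_diff laurent_mult laurent_const laurent_power_int)
  define g where "g s = f N s * f D' s - f N' s * f D s" for s
  have g: "laurent g" unfolding g_def by (intro laurent_diff laurent_mult f)
  have "finite {s :: 'k. s \<noteq> 0 \<and> s powi dot r u n = inverse (t powi dot r v n)}" if "n \<in> S" for n
    using u[OF that] by (rule finite_power_int_eq)
  then have fin: "finite (insert 0 (\<Union>n\<in>S. {s :: 'k. s \<noteq> 0 \<and> s powi dot r u n = inverse (t powi dot r v n)}))"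
    (is "finite ?B") using S(1) by blast
  have "s \<noteq> 0 \<and> g s = 0" if s: "s \<notin> ?B" for s
  proof -
    have s0: "s \<noteq> 0" using s by blast
    have "X s \<in> torus" using t(1) s0 by (simp add: torus_def X_def)
    moreover have "character r n (X s) \<noteq> 1" if n: "n \<in> S" for n
    proof
      assume "character r n (X s) = 1"
      then have "t powi dot r v n * s powi dot r u n = 1" using char[OF s0] by simp
      then have "s powi dot r u n = inverse (t powi dot r v n)" by (metis inverse_unique)
      then show False using s n s0 by blast
    qed
    ultimately have "root_product r N (X s) * root_product r D' (X s)
        = root_product r N' (X s) * root_product r D (X s)" by (rule eq)
    then show ?thesis using s0 by (simp add: g_def f_def rp[OF s0])
  qed
  then have "- ?B \<subseteq> {s. s \<noteq> 0 \<and> g s = 0}" by blast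
  moreover have "infinite (- ?B)" using fin inf by (simp add: finite_compl)
  ultimately have "infinite {s. s \<noteq> 0 \<and> g s = 0}" using infinite_super by blast
  then have "g 1 = 0" by (rule laurent_zero[OF g]) simp
  moreover have "f N 1 = 0"
  proof -
    have "0 \<in> (\<lambda>n. 1 - t powi dot r v n * 1 powi dot r u n) ` set N"
      by (rule image_eqI[OF _ \<alpha>(1)]) (simp add: v(1))
    then show ?thesis unfolding f_def prod_list_zero_iff by simp
  qed
  moreover have "f L 1 \<noteq> 0" if "set L \<subseteq> ?T" for L
  proof -
    have nz: "1 - t powi dot r v n * 1 powi dot r u n \<noteq> 0" if "n \<in> set L" for n
    proof -
      have "dot r v n \<in> dot r v ` ?T" using that \<open>set L \<subseteq> ?T\<close> by blast
      from t(2)[OF this] show ?thesis by simp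
    qed
    have "0 \<notin> (\<lambda>n. 1 - t powi dot r v n * 1 powi dot r u n) ` set L"
    proof
      assume "0 \<in> (\<lambda>n. 1 - t powi dot r v n * 1 powi dot r u n) ` set L"
      then obtain n where "0 = 1 - t powi dot r v n * 1 powi dot r u n" "n \<in> set L" by (rule imageE)
      then show False using nz[of n] by simp
    qed
    then show ?thesis unfolding f_def prod_list_zero_iff by simp
  qed
  then have "f N' 1 \<noteq> 0" "f D 1 \<noteq> 0" by simp_all
  ultimately show False by (simp add: g_def)
qed

section \<open>Injectivity of the Coble representation\<close>

lemma lattice_action_rev_cancel:
  assumes "w \<in> lists (generators r)"
  shows "lattice_action (rev w) (lattice_action w n) = n"
    "lattice_action w (lattice_action (rev w) n) = n"
proof -
  have "rev w \<in> lists (generators r)" using assms by auto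
  from lattice_action_word_rel[OF word_rel_rev_cancel[OF this]]
    lattice_action_word_rel[OF word_rel_rev_cancel[OF assms]]
  show "lattice_action (rev w) (lattice_action w n) = n"
    "lattice_action w (lattice_action (rev w) n) = n"
    by (simp_all add: fun_eq_iff)
qed

lemma degeneracy_roots_support: "n \<in> degeneracy_roots r \<Longrightarrow> support_in r n"
  unfolding degeneracy_roots_def support_in_def
  by (elim UnE CollectE exE conjE) (auto simp: difference_root_def plane_root_def)

lemma lattice_action_support:
  assumes "w \<in> lists (generators r)" "r \<ge> 8" "support_in r n"
  shows "support_in r (lattice_action w n)"
  using assms(1)
proof (induction w)
  case Nil
  show ?case using assms(3) by simp
next
  case (Cons a w)
  then have "support_in r (lattice_action w n)" by simp
  moreover have "simple_root a i = 0" if "i > r" for i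
    using Cons(1) that assms(2) by (cases a) (auto simp: generators_def)
  ultimately show ?case by (simp add: support_in_def reflect_def)
qed

lemma zero_pole_roots_degeneracy:
  assumes "a \<in> {1..r}" "b \<in> {1..r}" "c \<in> {1..r}" "d \<in> {1..r}" "i \<in> {1..r}" "j \<in> {1..r}"
      "distinct [a, b, c, d, i, j]"
  shows "set (zero_roots a b c d i j) \<subseteq> degeneracy_roots r"
    "set (pole_roots a b c d i j) \<subseteq> degeneracy_roots r"
proof -
  have diff: "difference_root k l \<in> degeneracy_roots r" if "k \<in> {1..r}" "l \<in> {1..r}" "k \<noteq> l" for k l
    using that unfolding degeneracy_roots_def by blast
  have plane: "plane_root k l m n \<in> degeneracy_roots r"
    if "k \<in> {1..r}" "l \<in> {1..r}" "m \<in> {1..r}" "n \<in> {1..r}" "distinct [k, l, m, n]" for k l m n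
    using that unfolding degeneracy_roots_def by blast
  show "set (zero_roots a b c d i j) \<subseteq> degeneracy_roots r"
    "set (pole_roots a b c d i j) \<subseteq> degeneracy_roots r"
    using assms by (auto simp: zero_roots_def pole_roots_def simp del: atLeastAtMost_iff intro!: diff plane)
qed

text \<open>A zero root \<open>\<alpha>\<close> is not a pole root up to sign, so the common factor must come
  from the image of a zero root.\<close>

lemma trivial_word_permutes_zero_roots:
  assumes inf: "infinite (UNIV :: 'k::field set)" and r: "r \<ge> 8" and w: "w \<in> lists (generators r)"
    and triv: "agree (U_space r) (word_map r w :: 'k tuple set \<rightharpoonup> 'k tuple set) (identity_map (U_space r))"
    and *: "a \<in> {1..r}" "b \<in> {1..r}" "c \<in> {1..r}" "d \<in> {1..r}" "i \<in> {1..r}" "j \<in> {1..r}"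
      "distinct [a, b, c, d, i, j]"
    and \<alpha>: "\<alpha> = difference_root i c \<or> \<alpha> = plane_root a b c i"
  shows "\<exists>n\<in>set (zero_roots a b c d i j). lattice_action (rev w) n = \<alpha> \<or> lattice_action (rev w) n = (\<lambda>k. - \<alpha> k)"
proof -
  have rw: "rev w \<in> lists (generators r)" using w by auto
  let ?act = "lattice_action (rev w)"
  let ?N = "zero_roots a b c d i j" and ?D = "pole_roots a b c d i j"
  note deg = zero_pole_roots_degeneracy[OF *]
  have \<alpha>N: "\<alpha> \<in> set ?N" using \<alpha> by (auto simp: zero_roots_def)
  have "\<exists>\<beta>\<in>set (map ?act ?N) \<union> set ?D. \<beta> = \<alpha> \<or> \<beta> = (\<lambda>k. - \<alpha> k)"
  proof (rule root_identity_common_factor[OF inf finite_visited_roots[of r w] visited_roots_norm[OF r w] _ \<alpha>N])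
    show "lattice_form r \<alpha> \<alpha> = 2" "support_in r \<alpha>"
      using \<alpha>N deg(1) degeneracy_roots_norm degeneracy_roots_support by blast+
    show "lattice_form r n n = 2 \<and> support_in r n" if n: "n \<in> set (map ?act ?N) \<union> set ?D" for n
    proof (cases "n \<in> set ?D")
      case True
      then show ?thesis using deg(2) degeneracy_roots_norm degeneracy_roots_support by blast
    next
      case False
      then obtain m where m: "m \<in> set ?N" "n = ?act m" using n by auto
      then have "m \<in> degeneracy_roots r" using deg(1) by blast
      then show ?thesis
        using lattice_form_action[OF rw r, of m m] lattice_action_support[OF rw r, of m]
          degeneracy_roots_norm degeneracy_roots_support m(2) by simp
    qed
    show "root_product r ?N X * root_product r (map ?act ?D) X = root_product r (map ?act ?N) X * root_product r ?D X"
      if "X \<in> torus" "\<And>n. n \<in> visited_roots r w \<Longrightarrow> character r n X \<noteq> 1" for X :: "nat \<Rightarrow> 'k"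
      by (rule trivial_word_root_identity[OF inf r w triv that *])
  qed
  moreover have "\<not> (\<beta> = \<alpha> \<or> \<beta> = (\<lambda>k. - \<alpha> k))" if "\<beta> \<in> set ?D" for \<beta>
  proof
    assume eq: "\<beta> = \<alpha> \<or> \<beta> = (\<lambda>k. - \<alpha> k)"
    have nz: "a \<noteq> 0" "b \<noteq> 0" "c \<noteq> 0" "d \<noteq> 0" "i \<noteq> 0" "j \<noteq> 0" using * by auto
    have "\<beta> 0 = \<alpha> 0 \<and> \<beta> c = \<alpha> c \<and> \<beta> i = \<alpha> i \<and> \<beta> j = \<alpha> j \<and> \<beta> a = \<alpha> a \<and> \<beta> d = \<alpha> d
      \<or> \<beta> 0 = - \<alpha> 0 \<and> \<beta> c = - \<alpha> c \<and> \<beta> i = - \<alpha> i \<and> \<beta> j = - \<alpha> j \<and> \<beta> a = - \<alpha> a \<and> \<beta> d = - \<alpha> d"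
      using eq by auto
    then show False
      using that \<alpha> *(7) nz
      by (elim disjE) (auto simp: pole_roots_def difference_root_def plane_root_def)
  qed
  ultimately show ?thesis by auto
qed

lemma lattice_action_inj:
  assumes "w \<in> lists (generators r)" "lattice_action w n = lattice_action w m"
  shows "n = m"
  using lattice_action_rev_cancel(1)[OF assms(1)] assms(2) by metis

text \<open>Two sets of candidates for the preimage of \<open>\<alpha>\<close> that have only
  \<open>\<alpha>\<close> in common up to sign.\<close>

lemma fixed_up_to_sign:
  assumes w: "w \<in> lists (generators r)"
    and 1: "n \<in> A" "lattice_action w n = \<alpha> \<or> lattice_action w n = (\<lambda>k. - \<alpha> k)"
    and 2: "m \<in> B" "lattice_action w m = \<alpha> \<or> lattice_action w m = (\<lambda>k. - \<alpha> k)"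
    and AB: "\<And>n m. n \<in> A \<Longrightarrow> m \<in> B \<Longrightarrow> n = m \<or> n = (\<lambda>k. - m k) \<Longrightarrow> n = \<alpha>"
  shows "lattice_action w \<alpha> = \<alpha> \<or> lattice_action w \<alpha> = (\<lambda>k. - \<alpha> k)"
proof -
  have "lattice_action w n = lattice_action w m \<or> lattice_action w n = lattice_action w (\<lambda>k. - m k)"
    using 1(2) 2(2) by (auto simp: lattice_action_minus)
  then have "n = m \<or> n = (\<lambda>k. - m k)" using lattice_action_inj[OF w] by blast
  then have "n = \<alpha>" by (rule AB[OF 1(1) 2(1)])
  then show ?thesis using 1(2) by simp
qed

lemma list_of_length_5:
  assumes "length xs = 5"
  shows "xs = [xs ! 0, xs ! 1, xs ! 2, xs ! 3, xs ! 4]"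
proof (rule nth_equalityI)
  fix i assume "i < length xs"
  then have "i = 0 \<or> i = 1 \<or> i = 2 \<or> i = 3 \<or> i = 4" using assms by arith
  then show "xs ! i = [xs ! 0, xs ! 1, xs ! 2, xs ! 3, xs ! 4] ! i"
    by (elim disjE) simp_all
qed (simp add: assms)

text \<open>Each simple root is a zero root of two cross-ratios that share no other zero root up to sign. For
  \<open>\<tau>\<^sub>k\<close> this takes five further points, for \<open>s\<close> three points besides the
  first four.\<close>

lemma trivial_word_fixes_simple_roots:
  assumes inf: "infinite (UNIV :: 'k::field set)" and r: "r \<ge> 8" and w: "w \<in> lists (generators r)"
    and triv: "agree (U_space r) (word_map r w :: 'k tuple set \<rightharpoonup> 'k tuple set) (identity_map (U_space r))"
    and s: "s \<in> generators r"
  shows "lattice_action (rev w) (simple_root s) = simple_root s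
    \<or> lattice_action (rev w) (simple_root s) = (\<lambda>k. - simple_root s k)"
proof -
  have rw: "rev w \<in> lists (generators r)" using w by auto
  note perm = trivial_word_permutes_zero_roots[OF inf r w triv]
  show ?thesis
  proof (cases s)
    case (Tau k)
    then have k: "1 \<le> k" "k < r" using s by (auto simp: Tau_in_generators)
    define \<alpha> where "\<alpha> = difference_root (Suc k) k"
    have \<alpha>: "simple_root s = \<alpha>" by (auto simp: Tau \<alpha>_def difference_root_def)
    have "card ({1..r} - {k, Suc k}) = r - 2" using k by (simp add: card_Diff_subset)
    then have "5 \<le> card ({1..r} - {k, Suc k})" using r by simp
    then obtain Q where Q: "Q \<subseteq> {1..r} - {k, Suc k}" "card Q = 5" "finite Q"
      by (rule obtain_subset_with_card_n)
    then obtain q where q: "distinct q" "set q = Q" "length q = 5"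
      using finite_distinct_list[OF Q(3)] distinct_card by metis
    obtain q1 q2 q3 q4 q5 where qs: "q = [q1, q2, q3, q4, q5]"
      using list_of_length_5[OF q(3)] by blast
    have sub: "{q1, q2, q3, q4, q5} \<subseteq> {1..r} - {k, Suc k}" using q(2) Q(1) unfolding qs by simp
    then have mem: "q1 \<in> {1..r}" "q2 \<in> {1..r}" "q3 \<in> {1..r}" "q4 \<in> {1..r}" "q5 \<in> {1..r}"
      by blast+
    have "distinct [q1, q2, q3, q4, q5]" using q(1) unfolding qs .
    moreover have "q1 \<notin> {k, Suc k}" "q2 \<notin> {k, Suc k}" "q3 \<notin> {k, Suc k}" "q4 \<notin> {k, Suc k}"
      "q5 \<notin> {k, Suc k}" using sub by blast+
    ultimately have dist: "distinct [q1, q2, q3, q4, q5, k, Suc k]" by simp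
    have kr: "k \<in> {1..r}" "Suc k \<in> {1..r}" using k by auto
    \<comment> \<open>Both cross-ratios vanish where the points \<open>k\<close> and \<open>k + 1\<close> collide.\<close>
    let ?A = "set (zero_roots q1 q2 k q3 (Suc k) q4)" and ?B = "set (zero_roots q1 q3 k q2 (Suc k) q5)"
    obtain n where n: "n \<in> ?A" "lattice_action (rev w) n = \<alpha> \<or> lattice_action (rev w) n = (\<lambda>k. - \<alpha> k)"
      using perm[OF mem(1,2) kr(1) mem(3) kr(2) mem(4), of \<alpha>] dist by (auto simp: \<alpha>_def)
    obtain m where m: "m \<in> ?B" "lattice_action (rev w) m = \<alpha> \<or> lattice_action (rev w) m = (\<lambda>k. - \<alpha> k)"
      using perm[OF mem(1,3) kr(1) mem(2) kr(2) mem(5), of \<alpha>] dist by (auto simp: \<alpha>_def)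
    have nz: "q1 \<noteq> 0" "q2 \<noteq> 0" "q3 \<noteq> 0" "q4 \<noteq> 0" "q5 \<noteq> 0" "k \<noteq> 0" using mem k by auto
    have step: "n = \<alpha>" if "n \<in> ?A" "m \<in> ?B" and eq: "n = m \<or> n = (\<lambda>k. - m k)" for n m
    proof (rule ccontr)
      assume "n \<noteq> \<alpha>"
      have "n 0 = m 0 \<and> n q2 = m q2 \<and> n q3 = m q3 \<and> n q4 = m q4 \<and> n q5 = m q5 \<and> n k = m k
        \<or> n 0 = - m 0 \<and> n q2 = - m q2 \<and> n q3 = - m q3 \<and> n q4 = - m q4 \<and> n q5 = - m q5 \<and> n k = - m k"
        using eq by auto
      then show False
        using that(1,2) dist nz \<open>n \<noteq> \<alpha>\<close>
        by (elim disjE) (auto simp: zero_roots_def difference_root_def plane_root_def \<alpha>_def)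
    qed
    show ?thesis unfolding \<alpha> by (rule fixed_up_to_sign[OF rw n m step])
  next
    case Cr
    define \<alpha> where "\<alpha> = plane_root 1 2 3 4"
    have \<alpha>: "simple_root s = \<alpha>" by (auto simp: Cr \<alpha>_def plane_root_def fun_eq_iff)
    have \<alpha>': "plane_root 1 3 2 4 = \<alpha>" by (auto simp: \<alpha>_def plane_root_def fun_eq_iff)
    have mem: "1 \<in> {1..r}" "2 \<in> {1..r}" "3 \<in> {1..r}" "4 \<in> {1..r}" "5 \<in> {1..r}" "6 \<in> {1..r}" "7 \<in> {1..r}"
      using r by auto
    \<comment> \<open>Both cross-ratios vanish where the first four points become coplanar.\<close>
    let ?A = "set (zero_roots 1 2 3 5 4 6)" and ?B = "set (zero_roots 1 3 2 5 4 7)"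
    obtain n where n: "n \<in> ?A" "lattice_action (rev w) n = \<alpha> \<or> lattice_action (rev w) n = (\<lambda>k. - \<alpha> k)"
      using perm[OF mem(1,2,3,5,4,6), of \<alpha>] by (auto simp: \<alpha>_def)
    obtain m where m: "m \<in> ?B" "lattice_action (rev w) m = \<alpha> \<or> lattice_action (rev w) m = (\<lambda>k. - \<alpha> k)"
      using perm[OF mem(1,3,2,5,4,7), of \<alpha>] \<alpha>' by auto
    have step: "n = \<alpha>" if "n \<in> ?A" "m \<in> ?B" and eq: "n = m \<or> n = (\<lambda>k. - m k)" for n m
    proof (rule ccontr)
      assume "n \<noteq> \<alpha>"
      have "n 0 = m 0 \<and> n 2 = m 2 \<and> n 3 = m 3 \<and> n 4 = m 4 \<and> n 6 = m 6 \<and> n 7 = m 7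
        \<or> n 0 = - m 0 \<and> n 2 = - m 2 \<and> n 3 = - m 3 \<and> n 4 = - m 4 \<and> n 6 = - m 6 \<and> n 7 = - m 7"
        using eq by auto
      then show False
        using that(1,2) \<open>n \<noteq> \<alpha>\<close> unfolding zero_roots_def \<alpha>_def[symmetric]
        by (elim disjE) (auto simp: difference_root_def plane_root_def \<alpha>_def)
    qed
    show ?thesis unfolding \<alpha> by (rule fixed_up_to_sign[OF rw n m step])
  qed
qed

proposition trivial_word_map_imp_trivial_word:
  assumes "infinite (UNIV :: 'k::field set)" "r \<ge> 8" "w \<in> lists (generators r)"
    and "agree (U_space r) (word_map r w :: 'k tuple set \<rightharpoonup> 'k tuple set) (identity_map (U_space r))"
  shows "(w, []) \<in> word_rel r"
proof -
  have rw: "rev w \<in> lists (generators r)" using assms(3) by auto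
  have "(rev w, []) \<in> word_rel r"
    by (rule word_trivial_if_roots_fixed_up_to_sign[OF assms(2) rw trivial_word_fixes_simple_roots[OF assms]])
  from word_rel_append[OF this word_rel.refl[OF assms(3)]] have "(rev w @ w, w) \<in> word_rel r" by simp
  then show ?thesis using word_rel_rev_cancel[OF assms(3)] by (blast intro: word_rel.trans word_rel.sym)
qed

text \<open>Apply triviality to \<open>v\<^sup>-\<^sup>1 u\<close>; since generators are involutions,
  \<open>rev v\<close> represents \<open>v\<^sup>-\<^sup>1\<close>.\<close>

lemma word_rel_of_agreeing_word_maps:
  assumes inf: "infinite (UNIV :: 'k::field set)" and r: "r \<ge> 8"
    and u: "u \<in> lists (generators r)" and v: "v \<in> lists (generators r)"
    and agr: "agree (U_space r) (word_map r u :: 'k tuple set \<rightharpoonup> 'k tuple set) (word_map r v)"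
  shows "(u, v) \<in> word_rel r"
proof -
  have rv: "rev v \<in> lists (generators r)" using v by auto
  have rvu: "rev v @ u \<in> lists (generators r)" using rv u by auto
  let ?m = "\<lambda>w. word_map r w :: 'k tuple set \<rightharpoonup> 'k tuple set"
  have "agree (U_space r) (?m (rev v @ u)) (?m (rev v @ v))"
    unfolding word_map_append[OF inf r rv u] word_map_append[OF inf r rv v]
    by (rule agree_compose[OF word_map_birational[OF inf r u]
          agree_refl[OF birational_map_dom[OF word_map_birational[OF inf r rv]]] agr])
  moreover have "agree (U_space r) (?m (rev v @ v)) (identity_map (U_space r))"
    using agree_word_map_word_rel[OF inf r word_rel_rev_cancel[OF v]] by simp
  ultimately have "(rev v @ u, []) \<in> word_rel r"
    using trivial_word_map_imp_trivial_word[OF inf r rvu] agree_trans by blast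
  from word_rel_append[OF word_rel.refl[OF v] this] have 1: "(v @ rev v @ u, v) \<in> word_rel r" by simp
  have "(v @ rev v, []) \<in> word_rel r" using word_rel_rev_cancel[OF rv] by simp
  from word_rel_append[OF this word_rel.refl[OF u]] have "(v @ rev v @ u, u) \<in> word_rel r" by simp
  with 1 show ?thesis by (blast intro: word_rel.trans word_rel.sym)
qed

theorem theorem1p2:
  fixes r :: nat
  assumes "uncountable (UNIV :: 'k::alg_closed_field set)"
    and "r \<ge> 8"
  shows "(coble r :: generator list set \<Rightarrow> ('k tuple set \<rightharpoonup> 'k tuple set) set)
    \<in> mon (weyl_group r) (Bir (U_space r))"
proof -
  have inf: "infinite (UNIV :: 'k set)" using assms(1) uncountable_infinite by blast
  let ?co = "coble r :: generator list set \<Rightarrow> ('k tuple set \<rightharpoonup> 'k tuple set) set"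
  have "inj_on ?co (carrier (weyl_group r))"
  proof (rule inj_onI)
    fix A B assume "A \<in> carrier (weyl_group r)" "B \<in> carrier (weyl_group r)" and eq: "?co A = ?co B"
    then obtain u v where u: "u \<in> lists (generators r)" "A = word_rel r `` {u}"
      and v: "v \<in> lists (generators r)" "B = word_rel r `` {v}" using weyl_group_carrierE by metis
    from eq have "agree (U_space r) (word_map r u :: 'k tuple set \<rightharpoonup> 'k tuple set) (word_map r v)"
      unfolding u(2) v(2) coble_class[OF inf assms(2) u(1)] coble_class[OF inf assms(2) v(1)]
        birational_rel_class_eq[OF word_map_birational[OF inf assms(2) u(1)]
          word_map_birational[OF inf assms(2) v(1)]] .
    then have "(u, v) \<in> word_rel r"
      by (rule word_rel_of_agreeing_word_maps[OF inf assms(2) u(1) v(1)])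
    then show "A = B" unfolding u(2) v(2) by (rule equiv_class_eq[OF equiv_word_rel])
  qed
  with coble_hom[OF inf assms(2)] show ?thesis by (simp add: mon_def)
qed

end
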